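(* Let $\ell\ge 1$ and let $Q_\ell(\mu;w_1,\dots,w_\ell)=1+(-1)^{\ell+1}\mu^{\ell+1}+\sum_{i=1}^{\ell}(-1)^i w_i\mu^i$. Consider any Frobenius manifold obtained from $Q_\ell$ by a shift $w_i\mapsto w_i+f_i\lambda/w_0$, $i\in I\subset\{1,\dots,\ell\}$ (in the sense explained in the context), and write $|I|=p+1$. Then $I=\{\bar k,\bar k+1,\dots,\bar k+p\}$ for some $\bar k\in\{1,\dots,\ell-p\}$, and there is a partition $\pi=(m_1,\dots,m_{\ell(\pi)})$ of $p$, of length $\ell(\pi)$, such that the Frobenius manifold is semisimple, has dimension $\ell+1+\ell(\pi)$ and charge $d=1$, and has a Landau--Ginzburg model of the form $$\lambda(\mu;\underline w)=\frac{w_0\,Q_\ell(\mu;w_1,\dots,w_\ell)}{\mu^{\bar k}\prod_{\alpha=1}^{\ell(\pi)}(\mu-w_{-\alpha})^{m_\alpha}},\qquad \phi=\mathrm d\log\mu ,$$ where $w_{-\ell(\pi)},\dots,w_{-1},w_0,w_1,\dots,w_\ell$ are coordinates on the Frobenius manifold.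
   Context: Shifts. $Q_\ell$ is the characteristic polynomial of the type $A_\ell$ relativistic Toda Lax operator in the defining $(\ell+1)$-dimensional representation; $w_1,\dots,w_\ell$ are the fundamental characters, regarded as independent parameters. For a non-empty $I\subset\{1,\dots,\ell\}$ replace $w_i$ by $w_i+f_i\lambda/w_0$ for $i\in I$, where $w_0\neq0$ is a further parameter and the $f_i$ do not depend on $\mu,\lambda,w_0,\dots,w_\ell$. Setting the shifted polynomial equal to $0$ and solving for $\lambda$ gives the rational function $\lambda=-w_0Q_\ell\big/\sum_{i\in I}(-1)^i f_i\mu^i$. One normalises $f_{\max I}=1$ (rescaling $w_0$) and absorbs overall signs into $w_0$. The remaining $f_i$ are generic non-zero parameters, which are adjoined to $w_0,\dots,w_\ell$ as additional coordinates; for generic $f_i$ all poles of $\lambda$ in $\mathbb C^*$ are simple. When $I$ consists of consecutive integers, the poles of $\lambda$ in $\mathbb C^*$ may be used as coordinates in place of the $f_i$, and one also allows the family obtained by restricting to a locus where these poles coalesce with a fixed pattern of multiplicities. The shift yields a Frobenius manifold if (an open dense subset of) the parameter space of the resulting family $\lambda$ is a Frobenius manifold with metric and three-tensor $$\eta(X,Y)=-\sum_{q:\,\mathrm d\lambda(q)=0}\operatorname{Res}_q\frac{X(\lambda)Y(\lambda)\,\phi^2}{\mathrm d\lambda},\qquad c(X,Y,Z)=\eta(X\cdot Y,Z)=-\sum_{q:\,\mathrm d\lambda(q)=0}\operatorname{Res}_q\frac{X(\lambda)Y(\lambda)Z(\lambda)\,\phi^2}{\mathrm d\lambda},$$ $\phi=\mathrm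 d\log\mu$ (derivatives of $\lambda$ along vector fields are taken at fixed $\mu$), and with unit $e$ and Euler field $E$ satisfying $e(\lambda)=1$, $E(\lambda)=\lambda$. The pair $(\lambda,\phi)$ is then called a Landau--Ginzburg model. A Frobenius manifold of charge $d$ is a complex manifold with a commutative associative unital $\mathcal O$-bilinear product on the tangent sheaf, a flat metric $\eta$ such that $c(X,Y,Z)=\eta(X\cdot Y,Z)$ and $\nabla c$ are totally symmetric, a flat unit field $e$, and an Euler field $E$ with $\mathcal L_E(\cdot)=\cdot$ and $\mathcal L_E\eta=(2-d)\eta$. It is semisimple if the tangent algebras have no nilpotents generically. *)

theory Defs
  imports "HOL-Complex_Analysis.Complex_Analysis"
begin

section \<open>Holomorphic functions on open subsets of \<open>\<complex>\<^sup>n\<close>\<close>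

definition holo_on :: "(complex ^ 'n) set \<Rightarrow> (complex ^ 'n \<Rightarrow> complex) \<Rightarrow> bool" where
  "holo_on U f \<longleftrightarrow>
     (\<forall>x\<in>U. \<exists>D. (f has_derivative D) (at x) \<and> (\<forall>c v. D (c *s v) = c * D v))"

definition pd :: "'n \<Rightarrow> (complex ^ 'n \<Rightarrow> complex) \<Rightarrow> complex ^ 'n \<Rightarrow> complex" where
  "pd i f x = deriv (\<lambda>t. f (x + axis i t)) 0"

definition local_chart :: "(complex ^ 'n) set \<Rightarrow> (complex ^ 'n \<Rightarrow> complex ^ 'n) \<Rightarrow> bool" where
  "local_chart V \<psi> \<longleftrightarrow>
     open V \<and> (\<forall>i. holo_on V (\<lambda>x. \<psi> x $ i)) \<and> open (\<psi> ` V) \<and>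
     (\<exists>\<theta>. (\<forall>i. holo_on (\<psi> ` V) (\<lambda>y. \<theta> y $ i)) \<and> (\<forall>x\<in>V. \<theta> (\<psi> x) = x))"


section \<open>Frobenius manifolds\<close>

text \<open>
  Tensor fields on an open subset of \<open>\<complex>\<^sup>n\<close> are given by their components in the
  ambient coordinates: \<open>g x $ i $ j\<close> is \<open>\<eta>(\<partial>\<^sub>i, \<partial>\<^sub>j)\<close> at \<open>x\<close>, and
  \<open>C x k i j\<close> is the coefficient of \<open>\<partial>\<^sub>k\<close> in the product \<open>\<partial>\<^sub>i \<cdot> \<partial>\<^sub>j\<close> at \<open>x\<close>.
\<close>

definition tmult ::
  "(complex ^ 'n \<Rightarrow> 'n \<Rightarrow> 'n \<Rightarrow> 'n \<Rightarrow> complex) \<Rightarrow> complex ^ 'n \<Rightarrow>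
   complex ^ 'n \<Rightarrow> complex ^ 'n \<Rightarrow> complex ^ 'n" where
  "tmult C x u v = (\<chi> k. \<Sum>i\<in>UNIV. \<Sum>j\<in>UNIV. C x k i j * u $ i * v $ j)"

definition christoffel ::
  "(complex ^ 'n \<Rightarrow> complex ^ 'n ^ 'n) \<Rightarrow> 'n \<Rightarrow> 'n \<Rightarrow> 'n \<Rightarrow> complex ^ 'n \<Rightarrow> complex" where
  "christoffel g k i j x =
     (\<Sum>l\<in>UNIV. matrix_inv (g x) $ k $ l *
        (pd i (\<lambda>y. g y $ j $ l) x + pd j (\<lambda>y. g y $ i $ l) x - pd l (\<lambda>y. g y $ i $ j) x)) / 2"

text \<open>The component \<open>R\<^sup>l\<^sub>k\<^sub>i\<^sub>j\<close> of the curvature, i.e. the \<open>\<partial>\<^sub>l\<close>-coefficient of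
  \<open>(\<nabla>\<^sub>i \<nabla>\<^sub>j - \<nabla>\<^sub>j \<nabla>\<^sub>i) \<partial>\<^sub>k\<close>.\<close>

definition curvature ::
  "(complex ^ 'n \<Rightarrow> complex ^ 'n ^ 'n) \<Rightarrow> 'n \<Rightarrow> 'n \<Rightarrow> 'n \<Rightarrow> 'n \<Rightarrow> complex ^ 'n \<Rightarrow> complex" where
  "curvature g l k i j x =
     pd i (christoffel g l j k) x - pd j (christoffel g l i k) x
     + (\<Sum>m\<in>UNIV. christoffel g l i m x * christoffel g m j k x
                - christoffel g l j m x * christoffel g m i k x)"

text \<open>\<open>c\<^sub>i\<^sub>j\<^sub>k = \<eta>(\<partial>\<^sub>i \<cdot> \<partial>\<^sub>j, \<partial>\<^sub>k)\<close>.\<close>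

definition three_tensor ::
  "(complex ^ 'n \<Rightarrow> complex ^ 'n ^ 'n) \<Rightarrow> (complex ^ 'n \<Rightarrow> 'n \<Rightarrow> 'n \<Rightarrow> 'n \<Rightarrow> complex) \<Rightarrow>
   'n \<Rightarrow> 'n \<Rightarrow> 'n \<Rightarrow> complex ^ 'n \<Rightarrow> complex" where
  "three_tensor g C i j k x = (\<Sum>m\<in>UNIV. C x m i j * g x $ m $ k)"

definition nabla_three_tensor ::
  "(complex ^ 'n \<Rightarrow> complex ^ 'n ^ 'n) \<Rightarrow> (complex ^ 'n \<Rightarrow> 'n \<Rightarrow> 'n \<Rightarrow> 'n \<Rightarrow> complex) \<Rightarrow>
   'n \<Rightarrow> 'n \<Rightarrow> 'n \<Rightarrow> 'n \<Rightarrow> complex ^ 'n \<Rightarrow> complex" where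
  "nabla_three_tensor g C l i j k x =
     pd l (three_tensor g C i j k) x
     - (\<Sum>m\<in>UNIV. christoffel g m l i x * three_tensor g C m j k x
                + christoffel g m l j x * three_tensor g C i m k x
                + christoffel g m l k x * three_tensor g C i j m x)"

definition lie_metric ::
  "(complex ^ 'n \<Rightarrow> complex ^ 'n) \<Rightarrow> (complex ^ 'n \<Rightarrow> complex ^ 'n ^ 'n) \<Rightarrow>
   'n \<Rightarrow> 'n \<Rightarrow> complex ^ 'n \<Rightarrow> complex" where
  "lie_metric E g i j x =
     (\<Sum>k\<in>UNIV. E x $ k * pd k (\<lambda>y. g y $ i $ j) x
                + g x $ k $ j * pd i (\<lambda>y. E y $ k) x
                + g x $ i $ k * pd j (\<lambda>y. E y $ k) x)"

definition lie_product ::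
  "(complex ^ 'n \<Rightarrow> complex ^ 'n) \<Rightarrow> (complex ^ 'n \<Rightarrow> 'n \<Rightarrow> 'n \<Rightarrow> 'n \<Rightarrow> complex) \<Rightarrow>
   'n \<Rightarrow> 'n \<Rightarrow> 'n \<Rightarrow> complex ^ 'n \<Rightarrow> complex" where
  "lie_product E C k i j x =
     (\<Sum>l\<in>UNIV. E x $ l * pd l (\<lambda>y. C y k i j) x
                - C x l i j * pd l (\<lambda>y. E y $ k) x
                + C x k l j * pd i (\<lambda>y. E y $ l) x
                + C x k i l * pd j (\<lambda>y. E y $ l) x)"

locale frobenius_manifold =
  fixes U :: "(complex ^ 'n) set"
    and g :: "complex ^ 'n \<Rightarrow> complex ^ 'n ^ 'n"
    and C :: "complex ^ 'n \<Rightarrow> 'n \<Rightarrow> 'n \<Rightarrow> 'n \<Rightarrow> complex"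
    and e E :: "complex ^ 'n \<Rightarrow> complex ^ 'n"
    and d :: complex
  assumes open_U: "open U"
    and holo_metric: "holo_on U (\<lambda>x. g x $ i $ j)"
    and holo_product: "holo_on U (\<lambda>x. C x k i j)"
    and holo_unit: "holo_on U (\<lambda>x. e x $ i)"
    and holo_euler: "holo_on U (\<lambda>x. E x $ i)"
    and product_commute: "x \<in> U \<Longrightarrow> tmult C x u v = tmult C x v u"
    and product_assoc: "x \<in> U \<Longrightarrow> tmult C x (tmult C x u v) w = tmult C x u (tmult C x v w)"
    and product_unit: "x \<in> U \<Longrightarrow> tmult C x (e x) v = v"
    and metric_sym: "x \<in> U \<Longrightarrow> g x $ i $ j = g x $ j $ i"
    and metric_nondegenerate: "x \<in> U \<Longrightarrow> invertible (g x)"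
    and metric_flat: "x \<in> U \<Longrightarrow> curvature g l k i j x = 0"
    and three_tensor_sym:
      "x \<in> U \<Longrightarrow> three_tensor g C i j k x = three_tensor g C j i k x"
      "x \<in> U \<Longrightarrow> three_tensor g C i j k x = three_tensor g C i k j x"
    and nabla_three_tensor_sym:
      "x \<in> U \<Longrightarrow> nabla_three_tensor g C l i j k x = nabla_three_tensor g C i l j k x"
      "x \<in> U \<Longrightarrow> nabla_three_tensor g C l i j k x = nabla_three_tensor g C l j i k x"
      "x \<in> U \<Longrightarrow> nabla_three_tensor g C l i j k x = nabla_three_tensor g C l i k j x"
    and unit_flat:
      "x \<in> U \<Longrightarrow> pd i (\<lambda>y. e y $ k) x + (\<Sum>j\<in>UNIV. christoffel g k i j x * e x $ j) = 0"
    and euler_product: "x \<in> U \<Longrightarrow> lie_product E C k i j x = C x k i j"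
    and euler_metric: "x \<in> U \<Longrightarrow> lie_metric E g i j x = (2 - d) * g x $ i $ j"

definition semisimple ::
  "(complex ^ 'n) set \<Rightarrow> (complex ^ 'n \<Rightarrow> 'n \<Rightarrow> 'n \<Rightarrow> 'n \<Rightarrow> complex) \<Rightarrow> bool" where
  "semisimple U C \<longleftrightarrow>
     (\<exists>V. open V \<and> V \<subseteq> U \<and> U \<subseteq> closure V \<and>
        (\<forall>x\<in>V. \<forall>v. (\<exists>N. (tmult C x v ^^ N) v = 0) \<longrightarrow> v = 0))"


section \<open>Landau--Ginzburg models on \<open>\<complex>\<^sup>*\<close> with \<open>\<phi> = d log \<mu>\<close>\<close>

text \<open>
  The zeros in \<open>\<complex>\<^sup>*\<close> of the differential of a meromorphic function \<open>h\<close>. The function \<open>h\<close> is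
  given by a formula involving a quotient, whose value at a cancelled zero of the denominator is
  meaningless; hence the passage to the analytic continuation \<open>G\<close>. Only \<open>\<complex>\<^sup>*\<close> needs
  to be considered, since all superpotentials below have poles at \<open>0\<close> and \<open>\<infinity>\<close>.
\<close>

definition crit_points :: "(complex \<Rightarrow> complex) \<Rightarrow> complex set" where
  "crit_points h =
     {q. q \<noteq> 0 \<and> (\<exists>G. G analytic_on {q} \<and> (\<forall>\<^sub>F z in at q. G z = h z) \<and> deriv G q = 0)}"

text \<open>\<open>lam x \<mu>\<close> is the superpotential at the parameter \<open>x\<close>; note
  \<open>\<phi>\<^sup>2 / d\<lambda> = d\<mu> / (\<mu>\<^sup>2 \<lambda>'(\<mu>))\<close>.
  The identities \<open>e(\<lambda>) = 1\<close> and \<open>E(\<lambda>) = \<lambda>\<close> are identities of rational functions of \<open>\<mu>\<close>,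
  hence required for all but finitely many \<open>\<mu>\<close>.\<close>

definition landau_ginzburg ::
  "(complex ^ 'n) set \<Rightarrow> (complex ^ 'n \<Rightarrow> complex \<Rightarrow> complex) \<Rightarrow>
   (complex ^ 'n \<Rightarrow> complex ^ 'n ^ 'n) \<Rightarrow> (complex ^ 'n \<Rightarrow> 'n \<Rightarrow> 'n \<Rightarrow> 'n \<Rightarrow> complex) \<Rightarrow>
   (complex ^ 'n \<Rightarrow> complex ^ 'n) \<Rightarrow> (complex ^ 'n \<Rightarrow> complex ^ 'n) \<Rightarrow> bool" where
  "landau_ginzburg U lam g C e E \<longleftrightarrow>
     (\<forall>x\<in>U.
        (\<forall>i j. g x $ i $ j =
           - (\<Sum>q\<in>crit_points (lam x).
                residue (\<lambda>\<mu>. pd i (\<lambda>y. lam y \<mu>) x * pd j (\<lambda>y. lam y \<mu>) x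
                              / (\<mu>\<^sup>2 * deriv (lam x) \<mu>)) q)) \<and>
        (\<forall>i j k. three_tensor g C i j k x =
           - (\<Sum>q\<in>crit_points (lam x).
                residue (\<lambda>\<mu>. pd i (\<lambda>y. lam y \<mu>) x * pd j (\<lambda>y. lam y \<mu>) x
                              * pd k (\<lambda>y. lam y \<mu>) x / (\<mu>\<^sup>2 * deriv (lam x) \<mu>)) q)) \<and>
        (\<forall>\<^sub>\<infinity>\<mu>. (\<Sum>i\<in>UNIV. e x $ i * pd i (\<lambda>y. lam y \<mu>) x) = 1) \<and>
        (\<forall>\<^sub>\<infinity>\<mu>. (\<Sum>i\<in>UNIV. E x $ i * pd i (\<lambda>y. lam y \<mu>) x) = lam x \<mu>))"


section \<open>Shifts of the characteristic polynomial\<close>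

text \<open>Parameters carry integer labels: \<open>w 0, \<dots>, w l\<close> are \<open>w\<^sub>0, \<dots>, w\<^sub>l\<close>, and negative labels
  are used for the additional parameters.\<close>

definition Q :: "nat \<Rightarrow> (int \<Rightarrow> complex) \<Rightarrow> complex \<Rightarrow> complex" where
  "Q l w \<mu> = 1 + (-1) ^ (l + 1) * \<mu> ^ (l + 1) + (\<Sum>i = 1..l. (-1) ^ i * w (int i) * \<mu> ^ i)"

definition shift_den :: "nat set \<Rightarrow> (nat \<Rightarrow> complex) \<Rightarrow> complex poly" where
  "shift_den I f = (\<Sum>i\<in>I. monom ((-1) ^ i * f i) i)"

definition shift_lambda ::
  "nat \<Rightarrow> nat set \<Rightarrow> (int \<Rightarrow> complex) \<Rightarrow> (nat \<Rightarrow> complex) \<Rightarrow> complex \<Rightarrow> complex" where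
  "shift_lambda l I w f \<mu> = - w 0 * Q l w \<mu> / poly (shift_den I f) \<mu>"

text \<open>\<open>shift_lambda\<close> is obtained by solving the shifted characteristic equation for \<open>\<lambda>\<close>:\<close>

lemma shift_lambda_iff:
  assumes I: "I \<subseteq> {1..l}" and w0: "w 0 \<noteq> 0" and den: "poly (shift_den I f) \<mu> \<noteq> 0"
  shows "Q l (\<lambda>j. if j \<in> int ` I then w j + f (nat j) * \<Lambda> / w 0 else w j) \<mu> = 0
           \<longleftrightarrow> \<Lambda> = shift_lambda l I w f \<mu>"
proof -
  have fin: "finite I" using I finite_subset by blast
  have D: "poly (shift_den I f) \<mu> = (\<Sum>i\<in>I. (-1) ^ i * f i * \<mu> ^ i)"
    by (simp add: shift_den_def poly_sum poly_monom)
  have "(\<Sum>i = 1..l. (-1) ^ i * (if int i \<in> int ` I then w (int i) + f (nat (int i)) * \<Lambda> / w 0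
            else w (int i)) * \<mu> ^ i)
        = (\<Sum>i = 1..l. (-1) ^ i * w (int i) * \<mu> ^ i
            + (if i \<in> I then (-1) ^ i * f i * \<mu> ^ i * (\<Lambda> / w 0) else 0))"
    by (intro sum.cong) (auto simp: algebra_simps)
  also have "\<dots> = (\<Sum>i = 1..l. (-1) ^ i * w (int i) * \<mu> ^ i)
       + (\<Sum>i\<in>{1..l} \<inter> I. (-1) ^ i * f i * \<mu> ^ i * (\<Lambda> / w 0))"
    by (simp only: sum.distrib sum.inter_restrict[OF finite_atLeastAtMost])
  also have "{1..l} \<inter> I = I" using I by blast
  also have "(\<Sum>i\<in>I. (-1) ^ i * f i * \<mu> ^ i * (\<Lambda> / w 0)) = poly (shift_den I f) \<mu> * (\<Lambda> / w 0)"
    by (simp only: D sum_distrib_right)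
  finally have "Q l (\<lambda>j. if j \<in> int ` I then w j + f (nat j) * \<Lambda> / w 0 else w j) \<mu>
        = Q l w \<mu> + poly (shift_den I f) \<mu> * (\<Lambda> / w 0)"
    by (simp add: Q_def)
  also have "\<dots> = 0 \<longleftrightarrow> \<Lambda> = shift_lambda l I w f \<mu>"
    using w0 den by (auto simp: shift_lambda_def field_simps add_eq_0_iff)
  finally show ?thesis .
qed

text \<open>
  The family for arbitrary \<open>I\<close>. The coordinates are \<open>w\<^sub>0, \<dots>, w\<^sub>l\<close> and the \<open>f\<^sub>i\<close> with
  \<open>i \<in> I - {Max I}\<close>, the latter with label \<open>-i\<close>. Coordinate labels are matched with the
  index type \<open>'n\<close> by a bijection \<open>\<iota>\<close>.
\<close>

definition generic_labels :: "nat \<Rightarrow> nat set \<Rightarrow> int set" where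
  "generic_labels l I = {0..int l} \<union> (\<lambda>i. - int i) ` (I - {Max I})"

definition generic_f :: "nat set \<Rightarrow> (int \<Rightarrow> complex) \<Rightarrow> nat \<Rightarrow> complex" where
  "generic_f I w i = (if i = Max I then 1 else w (- int i))"

definition generic_space :: "nat set \<Rightarrow> (int \<Rightarrow> 'n) \<Rightarrow> (complex ^ 'n) set" where
  "generic_space I \<iota> =
     {x. x $ \<iota> 0 \<noteq> 0 \<and>
         (\<forall>i\<in>I - {Max I}. x $ \<iota> (- int i) \<noteq> 0) \<and>
         (\<forall>a. a \<noteq> 0 \<longrightarrow> poly (shift_den I (generic_f I (\<lambda>j. x $ \<iota> j))) a = 0 \<longrightarrow>
              order a (shift_den I (generic_f I (\<lambda>j. x $ \<iota> j))) = 1)}"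

definition generic_lambda ::
  "nat \<Rightarrow> nat set \<Rightarrow> (int \<Rightarrow> 'n) \<Rightarrow> complex ^ 'n \<Rightarrow> complex \<Rightarrow> complex" where
  "generic_lambda l I \<iota> x = shift_lambda l I (\<lambda>j. x $ \<iota> j) (generic_f I (\<lambda>j. x $ \<iota> j))"

text \<open>
  The family for \<open>I = {k..k + p}\<close>, with the poles in \<open>\<complex>\<^sup>*\<close> as coordinates (labels
  \<open>-1, \<dots>, -length m\<close>) and a fixed pattern \<open>m\<close> of multiplicities. The \<open>f\<^sub>i\<close> with
  \<open>f\<^sub>k\<^sub>+\<^sub>p = 1\<close> are recovered from the poles, see \<open>shift_den_pole_f\<close>.
\<close>

definition is_partition :: "nat list \<Rightarrow> nat \<Rightarrow> bool" where
  "is_partition m p \<longleftrightarrow> sorted_wrt (\<ge>) m \<and> (\<forall>i\<in>set m. 0 < i) \<and> sum_list m = p"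

definition pole_poly :: "nat \<Rightarrow> nat list \<Rightarrow> (int \<Rightarrow> complex) \<Rightarrow> complex poly" where
  "pole_poly k m w = monom 1 k * (\<Prod>\<alpha> = 1..length m. [:- w (- int \<alpha>), 1:] ^ (m ! (\<alpha> - 1)))"

definition pole_f :: "nat \<Rightarrow> nat list \<Rightarrow> (int \<Rightarrow> complex) \<Rightarrow> nat \<Rightarrow> complex" where
  "pole_f k m w i = (-1) ^ i * (-1) ^ (k + sum_list m) * coeff (pole_poly k m w) i"

lemma degree_pole_poly: "degree (pole_poly k m w) = k + sum_list m"
proof -
  have "degree (\<Prod>\<alpha> = 1..length m. [:- w (- int \<alpha>), 1:] ^ (m ! (\<alpha> - 1)))
      = (\<Sum>\<alpha> = 1..length m. m ! (\<alpha> - 1))"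
    by (subst degree_prod_eq_sum_degree) (auto simp: degree_power_eq)
  also have "\<dots> = (\<Sum>\<alpha><length m. m ! \<alpha>)"
    by (rule sum.reindex_bij_witness[of _ Suc "\<lambda>i. i - 1"]) auto
  also have "\<dots> = sum_list m" by (simp add: sum_list_sum_nth atLeast0LessThan)
  finally show ?thesis
    unfolding pole_poly_def by (subst degree_mult_eq) (auto simp: degree_monom_eq)
qed

lemma shift_den_pole_f:
  "shift_den {k..k + sum_list m} (pole_f k m w) = smult ((-1) ^ (k + sum_list m)) (pole_poly k m w)"
proof (rule poly_eqI)
  fix n
  have 1: "coeff (pole_poly k m w) n = 0" if "n \<notin> {k..k + sum_list m}"
  proof (cases "n < k")
    case True
    then show ?thesis by (simp add: pole_poly_def coeff_monom_mult)
  next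
    case False
    then show ?thesis using that by (intro coeff_eq_0) (simp add: degree_pole_poly)
  qed
  have "coeff (shift_den {k..k + sum_list m} (pole_f k m w)) n
      = (if n \<in> {k..k + sum_list m} then (-1) ^ n * pole_f k m w n else 0)"
    unfolding shift_den_def coeff_sum coeff_monom by (subst sum.delta) auto
  also have "\<dots> = (-1) ^ (k + sum_list m) * coeff (pole_poly k m w) n"
    using 1 by (auto simp: pole_f_def mult.assoc[symmetric] power_mult_distrib[symmetric])
  finally show "coeff (shift_den {k..k + sum_list m} (pole_f k m w)) n
      = coeff (smult ((-1) ^ (k + sum_list m)) (pole_poly k m w)) n"
    by simp
qed

definition pole_labels :: "nat \<Rightarrow> nat list \<Rightarrow> int set" where
  "pole_labels l m = {- int (length m)..int l}"

definition pole_space :: "nat list \<Rightarrow> (int \<Rightarrow> 'n) \<Rightarrow> (complex ^ 'n) set" where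
  "pole_space m \<iota> =
     {x. x $ \<iota> 0 \<noteq> 0 \<and>
         (\<forall>\<alpha>\<in>{1..length m}. x $ \<iota> (- int \<alpha>) \<noteq> 0) \<and>
         inj_on (\<lambda>\<alpha>. x $ \<iota> (- int \<alpha>)) {1..length m}}"

definition pole_lambda ::
  "nat \<Rightarrow> nat \<Rightarrow> nat list \<Rightarrow> (int \<Rightarrow> 'n) \<Rightarrow> complex ^ 'n \<Rightarrow> complex \<Rightarrow> complex" where
  "pole_lambda l k m \<iota> x =
     shift_lambda l {k..k + sum_list m} (\<lambda>j. x $ \<iota> j) (pole_f k m (\<lambda>j. x $ \<iota> j))"

definition shift_family ::
  "nat \<Rightarrow> nat set \<Rightarrow> (complex ^ 'n) set \<Rightarrow> (complex ^ 'n \<Rightarrow> complex \<Rightarrow> complex) \<Rightarrow> bool" where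
  "shift_family l I P lam \<longleftrightarrow>
     (\<exists>\<iota>. bij_betw \<iota> (generic_labels l I) UNIV \<and>
          P = generic_space I \<iota> \<and> lam = generic_lambda l I \<iota>) \<or>
     (\<exists>k p m \<iota>. I = {k..k + p} \<and> is_partition m p \<and> bij_betw \<iota> (pole_labels l m) UNIV \<and>
          P = pole_space m \<iota> \<and> lam = pole_lambda l k m \<iota>)"

definition shift_frobenius_manifold ::
  "nat \<Rightarrow> nat set \<Rightarrow> (complex ^ 'n) set \<Rightarrow> (complex ^ 'n \<Rightarrow> complex ^ 'n ^ 'n) \<Rightarrow>
   (complex ^ 'n \<Rightarrow> 'n \<Rightarrow> 'n \<Rightarrow> 'n \<Rightarrow> complex) \<Rightarrow>
   (complex ^ 'n \<Rightarrow> complex ^ 'n) \<Rightarrow> (complex ^ 'n \<Rightarrow> complex ^ 'n) \<Rightarrow> complex \<Rightarrow> bool" where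
  "shift_frobenius_manifold l I U g C e E d \<longleftrightarrow>
     (\<exists>P lam. shift_family l I P lam \<and> U \<subseteq> P \<and> P \<subseteq> closure U \<and>
        frobenius_manifold U g C e E d \<and> landau_ginzburg U lam g C e E)"

end

theory Submission
  imports Defs "HOL-Computational_Algebra.Fundamental_Theorem_Algebra"
begin

text \<open>
  Write \<open>\<lambda> = - w\<^sub>0 Q / D\<close>. Moving only \<open>w\<^sub>1\<close> and \<open>w\<^sub>2\<close>, one reaches parameters for which all critical
  points of \<open>\<lambda>\<close> are simple and no zero of \<open>Q\<close> is a zero of \<open>D\<close>. There metric and three-tensor are weighted
  sums over the critical points, so that non-degeneracy of the metric makes the evaluation of
  \<open>\<partial>\<lambda>\<close> at the critical points injective. Consequently \<open>E = w\<^sub>0 \<partial>\<^sub>0\<close>, and the scaling of the metric in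
  \<open>w\<^sub>0\<close> gives \<open>d = 1\<close>. If there are no more critical points than coordinates, the evaluation is an
  isomorphism of algebras, which gives semisimplicity; it holds on an open set because unit vectors
  with square zero form a compact family. If the exponents in \<open>D\<close> have a gap, the Euler--Jacobi
  formula yields a non-zero tangent vector orthogonal to everything. Finally, the simple poles are
  local holomorphic functions of the coefficients of \<open>D\<close>.
\<close>


section \<open>Linear systems and polynomials\<close>

text \<open>The count behind semisimplicity and behind the gap argument: once the factors caused by
  multiple poles are cancelled, the numerator of \<lambda>' has degree \<open>l\<close> plus the
  number of distinct zeros of \<open>D\<close>, the zero at the origin included. With the poles as
  coordinates this is exactly the dimension. With coefficients as coordinates and exponents between
  \<open>a\<close> and \<open>b\<close>, it is \<open>l + 1 + (b - a)\<close> against the dimension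
  \<open>l + card I\<close>; a gap thus leaves more critical points than coordinates, and non-zero
  weights no longer guarantee a non-degenerate metric. Moving \<open>w\<^sub>1\<close> and
  \<open>w\<^sub>2\<close> changes \<open>Q\<close> but not \<open>D\<close>, and the critical
  polynomial is affine in them, so genericity becomes a question about pencils of polynomials in one
  variable. Generic parameters are only dense, which suffices: the formula for \<open>E\<close>
  extends by continuity, while the charge and the gap argument need a single point. Such a point
  exists because the parameter space is non-empty and lies in the closure of
  \<open>U\<close>.\<close>

lemma homogeneous_system:
  fixes a :: "'b \<Rightarrow> 'a \<Rightarrow> 'f::field"
  assumes "finite Y" "finite X" "card Y < card X"
  shows "\<exists>s. (\<exists>x\<in>X. s x \<noteq> 0) \<and> (\<forall>y\<in>Y. (\<Sum>x\<in>X. a y x * s x) = 0)"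
  using assms
proof (induction Y arbitrary: X a rule: finite_induct)
  case empty
  then have "X \<noteq> {}" by auto
  then show ?case by (intro exI[of _ "\<lambda>_. 1"]) auto
next
  case (insert y Y)
  show ?case
  proof (cases "\<forall>x\<in>X. a y x = 0")
    case True
    have "card Y < card X" using insert by simp
    from insert.IH[OF insert.prems(1) this, of a] obtain s
      where s: "\<exists>x\<in>X. s x \<noteq> 0" "\<forall>y\<in>Y. (\<Sum>x\<in>X. a y x * s x) = 0" by blast
    moreover have "(\<Sum>x\<in>X. a y x * s x) = 0" using True by simp
    ultimately show ?thesis by blast
  next
    case False
    then obtain x0 where x0: "x0 \<in> X" "a y x0 \<noteq> 0" by blast
    \<comment> \<open>Gaussian elimination: equation \<open>y\<close> has the pivot
      \<open>x0\<close>, and \<open>b\<close> is the system left after eliminating that unknown;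
      \<open>s'\<close> below recovers its value.\<close>
    define b where "b = (\<lambda>y' x. a y' x - a y' x0 * a y x / a y x0)"
    have "card Y < card (X - {x0})" using insert x0 by simp
    from insert.IH[OF _ this, of b] obtain s where s: "\<exists>x\<in>X-{x0}. s x \<noteq> 0"
      "\<forall>y\<in>Y. (\<Sum>x\<in>X-{x0}. b y x * s x) = 0" using insert.prems by blast
    define S where "S = (\<Sum>x\<in>X-{x0}. a y x * s x)"
    define s' where "s' = s(x0 := - S / a y x0)"
    have sum: "(\<Sum>x\<in>X. a y' x * s' x) = - a y' x0 * S / a y x0 + (\<Sum>x\<in>X-{x0}. a y' x * s x)" for y'
    proof -
      have "(\<Sum>x\<in>X. a y' x * s' x) = a y' x0 * s' x0 + (\<Sum>x\<in>X-{x0}. a y' x * s' x)"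
        using x0 insert.prems by (subst sum.remove[of X x0]) auto
      also have "(\<Sum>x\<in>X-{x0}. a y' x * s' x) = (\<Sum>x\<in>X-{x0}. a y' x * s x)"
        by (intro sum.cong) (auto simp: s'_def)
      finally show ?thesis by (simp add: s'_def)
    qed
    have "(\<Sum>x\<in>X. a y' x * s' x) = 0" if "y' \<in> insert y Y" for y'
    proof (cases "y' = y")
      case True
      then show ?thesis using x0 by (simp add: sum S_def)
    next
      case False
      then have "0 = (\<Sum>x\<in>X-{x0}. b y' x * s x)" using s that by auto
      also have "\<dots> = (\<Sum>x\<in>X-{x0}. a y' x * s x - a y' x0 / a y x0 * (a y x * s x))"
        by (intro sum.cong) (auto simp: b_def algebra_simps)
      also have "\<dots> = (\<Sum>x\<in>X-{x0}. a y' x * s x) - a y' x0 / a y x0 * S"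
        by (simp only: S_def sum_subtractf sum_distrib_left)
      finally show ?thesis by (simp add: sum)
    qed
    moreover have "\<exists>x\<in>X. s' x \<noteq> 0" using s(1) by (auto simp: s'_def)
    ultimately show ?thesis by blast
  qed
qed

lemma rsquarefree_if_simple_roots:
  fixes p :: "complex poly"
  assumes "p \<noteq> 0" and "\<And>z. poly p z = 0 \<Longrightarrow> poly (pderiv p) z \<noteq> 0"
  shows "rsquarefree p"
  using assms by (simp add: rsquarefree_roots)

lemma card_roots_simple:
  fixes B :: "complex poly"
  assumes nz: "B \<noteq> 0" and simple: "\<And>z. poly B z = 0 \<Longrightarrow> poly (pderiv B) z \<noteq> 0"
  shows "card {z. poly B z = 0} = degree B"
proof -
  have "B = smult (lead_coeff B) (\<Prod>z|poly B z = 0. [:-z, 1:])"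
    using complex_poly_decompose_rsquarefree[OF rsquarefree_if_simple_roots[OF assms]] by simp
  then have "degree B = degree (\<Prod>z|poly B z = 0. [:-z, 1:])"
    using nz by (metis degree_smult_eq leading_coeff_0_iff)
  then show ?thesis by (subst (asm) degree_prod_eq_sum_degree) auto
qed

lemma degree_prod_linear: "finite A \<Longrightarrow> degree (\<Prod>z\<in>A. [:- z, 1::complex:]) = card A"
  by (subst degree_prod_eq_sum_degree) auto

lemma poly_prod_linear_remove:
  fixes z :: complex
  assumes "finite A" "z \<in> A" "y \<in> A"
  shows "poly (\<Prod>z'\<in>A - {z}. [:- z', 1:]) y = (if y = z then \<Prod>z'\<in>A-{z}. z - z' else 0)"
  using assms by (auto simp: poly_prod)

lemma poly_eq_0_if_many_roots:
  fixes p :: "complex poly"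
  assumes "finite A" "degree p < card A" "\<And>z. z \<in> A \<Longrightarrow> poly p z = 0"
  shows "p = 0"
proof (rule ccontr)
  assume "p \<noteq> 0"
  then have "card A \<le> card {z. poly p z = 0}"
    using assms by (intro card_mono poly_roots_finite) auto
  then show False using card_poly_roots_bound[OF \<open>p \<noteq> 0\<close>] assms(2) by simp
qed

text \<open>Read off the top coefficient in Lagrange's interpolation formula for \<open>A\<close> at the roots of \<open>B\<close>.\<close>

lemma euler_jacobi:
  fixes A B :: "complex poly"
  assumes simple: "\<And>z. poly B z = 0 \<Longrightarrow> poly (pderiv B) z \<noteq> 0"
    and deg: "degree A + 2 \<le> degree B"
  shows "(\<Sum>z|poly B z = 0. poly A z / poly (pderiv B) z) = 0"
proof -
  define Z where "Z = {z. poly B z = 0}"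
  define c where "c = lead_coeff B"
  define P where "P = (\<lambda>z. \<Prod>z'\<in>Z-{z}. [:-z', 1:])"
  have B0: "B \<noteq> 0" using deg by auto
  have finZ: "finite Z" unfolding Z_def using B0 by (rule poly_roots_finite)
  have cardZ: "card Z = degree B" unfolding Z_def by (rule card_roots_simple[OF B0 simple])
  have B: "B = smult c (\<Prod>z\<in>Z. [:-z, 1:])"
    using complex_poly_decompose_rsquarefree[OF rsquarefree_if_simple_roots[OF B0 simple]]
    by (simp add: Z_def c_def)
  have B': "pderiv B = smult c (\<Sum>z\<in>Z. P z)"
    by (subst B) (simp add: pderiv_smult pderiv_prod P_def pderiv_pCons)
  have PY: "poly (P z) y = 0" if "z \<in> Z" "y \<in> Z" "y \<noteq> z" for z y
    using that finZ by (simp add: P_def poly_prod_linear_remove)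
  have B'z: "poly (pderiv B) z = c * poly (P z) z" if "z \<in> Z" for z
  proof -
    have "poly (pderiv B) z = c * (\<Sum>y\<in>Z. poly (P y) z)" by (simp add: B' poly_sum)
    also have "(\<Sum>y\<in>Z. poly (P y) z) = (\<Sum>y\<in>Z. if y = z then poly (P z) z else 0)"
      using that by (intro sum.cong) (auto simp: PY)
    finally show ?thesis using that finZ by (simp add: sum.delta)
  qed
  \<comment> \<open>As \<open>B'(z) = c * P z (z)\<close>, the factor \<open>c\<close> makes
    \<open>R\<close> take the value of \<open>A\<close> at every root of \<open>B\<close>.\<close>
  define R where "R = (\<Sum>z\<in>Z. smult (c * poly A z / poly (pderiv B) z) (P z))"
  have degP: "degree (P z) = degree B - 1" if "z \<in> Z" for z
    using finZ that by (simp add: P_def degree_prod_linear cardZ)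
  have "R - A = 0"
  proof (rule poly_eq_0_if_many_roots[OF finZ])
    have "degree R \<le> degree B - 1" unfolding R_def
      by (intro degree_sum_le finZ) (auto intro: order_trans[OF degree_smult_le] simp: degP)
    then have "degree (R - A) \<le> degree B - 1"
      using deg by (intro degree_diff_le) auto
    then show "degree (R - A) < card Z" using deg by (simp add: cardZ)
    fix y assume y: "y \<in> Z"
    have "poly R y = (\<Sum>z\<in>Z. if z = y then poly A y else 0)"
      unfolding R_def poly_sum
      using y simple B'z by (intro sum.cong) (auto simp: PY Z_def)
    then show "poly (R - A) y = 0" using y finZ by simp
  qed
  then have "coeff R (degree B - 1) = coeff A (degree B - 1)" by simp
  also have "\<dots> = 0" using deg by (intro coeff_eq_0) auto
  also have "coeff R (degree B - 1) = (\<Sum>z\<in>Z. c * poly A z / poly (pderiv B) z)"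
  proof -
    have "coeff (P z) (degree B - 1) = 1" if "z \<in> Z" for z
    proof -
      have "lead_coeff (P z) = 1" unfolding P_def by (subst lead_coeff_prod) auto
      then show ?thesis by (simp add: degP[OF that])
    qed
    then show ?thesis by (simp add: R_def coeff_sum)
  qed
  also have "\<dots> = c * (\<Sum>z\<in>Z. poly A z / poly (pderiv B) z)"
    by (simp add: sum_distrib_left)
  finally show ?thesis using B0 by (simp add: Z_def c_def)
qed

text \<open>A multiple root \<open>q\<close> of \<open>J + \<epsilon> K\<close> is a root of the Wronskian of \<open>J\<close> and \<open>K\<close>, and determines \<open>\<epsilon>\<close>.\<close>

lemma finite_nonsimple_pencil:
  fixes J K :: "complex poly"
  assumes coprime: "\<And>q. poly J q = 0 \<Longrightarrow> poly K q \<noteq> 0" and J: "degree J \<noteq> 0"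
  shows "finite {\<epsilon>. \<exists>q. poly (J + smult \<epsilon> K) q = 0 \<and> poly (pderiv (J + smult \<epsilon> K)) q = 0}"
    (is "finite ?S")
proof -
  define W where "W = J * pderiv K - pderiv J * K"
  have "W \<noteq> 0"
  proof
    assume "W = 0"
    then have W: "J * pderiv K = pderiv J * K" by (simp add: W_def)
    have "\<not> constant (poly J)" using J by (simp add: constant_degree)
    then obtain q where q: "poly J q = 0" using fundamental_theorem_of_algebra by blast
    have J0: "J \<noteq> 0" "pderiv J \<noteq> 0" using J by (auto simp: pderiv_eq_0_iff)
    have Kq: "poly K q \<noteq> 0" using coprime q by blast
    then have K0: "K \<noteq> 0" by auto
    then have nz: "pderiv J * K \<noteq> 0" using J0 by simp
    then have nz': "J * pderiv K \<noteq> 0" using W by simp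
    \<comment> \<open>The two sides of \<open>J * K' = J' * K\<close> are compared at a root
      \<open>q\<close> of \<open>J\<close>, where \<open>K\<close> does not vanish: the right side
      has order one less than \<open>J\<close>, the left side at least the order of
      \<open>J\<close>.\<close>
    have "order q (pderiv J * K) = order q (pderiv J)"
      using Kq nz by (simp add: order_mult order_0I)
    moreover have "order q (J * pderiv K) \<ge> order q J"
      using nz' by (simp add: order_mult)
    moreover have "order q J \<noteq> 0" using q J0 by (simp add: order_root)
    ultimately show False using W q order_pderiv[of J q] J0 by simp
  qed
  have "?S \<subseteq> (\<lambda>q. - poly J q / poly K q) ` {q. poly W q = 0}"
  proof
    fix \<epsilon> assume "\<epsilon> \<in> ?S"
    then obtain q where q: "poly J q + \<epsilon> * poly K q = 0"
      "poly (pderiv J) q + \<epsilon> * poly (pderiv K) q = 0"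
      by (auto simp: pderiv_add pderiv_smult)
    have Kq: "poly K q \<noteq> 0" using coprime[of q] q(1) by auto
    have "poly J q = - (\<epsilon> * poly K q)" "poly (pderiv J) q = - (\<epsilon> * poly (pderiv K) q)"
      using q by (auto simp: add_eq_0_iff2)
    then have "poly W q = 0" "\<epsilon> = - poly J q / poly K q" using Kq by (auto simp: W_def)
    then show "\<epsilon> \<in> (\<lambda>q. - poly J q / poly K q) ` {q. poly W q = 0}" by blast
  qed
  then show ?thesis
    using poly_roots_finite[OF \<open>W \<noteq> 0\<close>] finite_subset by blast
qed

lemma small_avoiding_finite:
  fixes S :: "complex set"
  assumes "finite S" "0 < \<delta>"
  obtains \<epsilon> where "cmod \<epsilon> < \<delta>" "\<epsilon> \<notin> S"
proof -
  have "uncountable (ball (0::complex) \<delta>)" using assms by (simp add: uncountable_ball)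
  then have "\<not> ball (0::complex) \<delta> \<subseteq> S" using assms countable_finite countable_subset by blast
  then show ?thesis using that by (auto simp: subset_iff)
qed

section \<open>Critical points of the superpotential\<close>

definition radical_poly :: "complex poly \<Rightarrow> complex poly" where
  "radical_poly D = (\<Prod>z|poly D z = 0. [:- z, 1:])"

text \<open>Numerator of \<open>D' / D\<close>, the sum of \<open>order z D / (X - z)\<close>, over
  the common denominator \<open>radical_poly D\<close>. Using this pair instead of \<open>D'\<close>
  and \<open>D\<close> keeps multiple poles of \<lambda> from producing spurious zeros in the
  numerator of \<lambda>'.\<close>

definition log_deriv_num :: "complex poly \<Rightarrow> complex poly" where
  "log_deriv_num D = (\<Sum>z|poly D z = 0.
     smult (of_nat (order z D)) (\<Prod>z'\<in>{z. poly D z = 0} - {z}. [:- z', 1:]))"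

text \<open>Leibniz rule for the factorization of \<open>D\<close>: in the summand of
  \<open>z\<close>, the factor \<open>X - z\<close> of the radical restores the power lowered by
  differentiation and leaves the multiplicity as a coefficient.\<close>

lemma pderiv_mult_radical:
  assumes "D \<noteq> 0"
  shows "pderiv D * radical_poly D = log_deriv_num D * D"
proof -
  define R where "R = {z. poly D z = 0}"
  define c where "c = lead_coeff D"
  have fin: "finite R" unfolding R_def using assms by (rule poly_roots_finite)
  have D: "D = smult c (\<Prod>z\<in>R. [:-z, 1:] ^ order z D)"
    using complex_poly_decompose[of D] by (simp add: R_def c_def)
  have ord: "order z D \<noteq> 0" if "z \<in> R" for z using that assms by (simp add: R_def order_root)
  have pd: "pderiv ([:-z, 1:] ^ n) * [:-z, 1:] = smult (of_nat n) ([:-z, 1:] ^ n)" for z :: complex and n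
  proof (cases n)
    case (Suc k)
    have "pderiv ([:-z, 1:] ^ Suc k) = smult (of_nat (Suc k)) ([:-z, 1:] ^ k)"
      by (simp only: pderiv_power_Suc) (simp add: pderiv_pCons)
    then show ?thesis unfolding Suc by (simp only: mult_smult_left power_Suc2)
  qed simp
  have "pderiv D * radical_poly D =
    (\<Sum>z\<in>R. smult c ((\<Prod>z'\<in>R-{z}. [:-z', 1:] ^ order z' D) * pderiv ([:-z, 1:] ^ order z D)) *
       ([:-z, 1:] * (\<Prod>z'\<in>R-{z}. [:-z', 1:])))"
    (is "_ = (\<Sum>z\<in>R. ?f z)")
  proof -
    have "radical_poly D = [:-z, 1:] * (\<Prod>z'\<in>R-{z}. [:-z', 1:])" if "z \<in> R" for z
      unfolding radical_poly_def R_def[symmetric] by (rule prod.remove[OF fin that])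
    then have "smult c ((\<Prod>z'\<in>R-{z}. [:-z', 1:] ^ order z' D) * pderiv ([:-z, 1:] ^ order z D)) *
        radical_poly D = ?f z" if "z \<in> R" for z using that by simp
    moreover have "pderiv D =
        (\<Sum>z\<in>R. smult c ((\<Prod>z'\<in>R-{z}. [:-z', 1:] ^ order z' D) * pderiv ([:-z, 1:] ^ order z D)))"
    proof -
      have "pderiv D = [:c:] * (\<Sum>z\<in>R. (\<Prod>z'\<in>R-{z}. [:-z', 1:] ^ order z' D) * pderiv ([:-z, 1:] ^ order z D))"
        by (subst D) (simp add: pderiv_smult pderiv_prod)
      then show ?thesis by (simp add: sum_distrib_left)
    qed
    ultimately show ?thesis by (simp only: sum_distrib_right cong: sum.cong)
  qed
  also have "\<dots> = (\<Sum>z\<in>R. smult (of_nat (order z D)) (\<Prod>z'\<in>R-{z}. [:-z', 1:]) * D)"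
  proof (intro sum.cong refl)
    fix z assume z: "z \<in> R"
    let ?A = "\<Prod>z'\<in>R-{z}. [:-z', 1:] ^ order z' D" and ?B = "\<Prod>z'\<in>R-{z}. [:-z', 1::complex:]"
    have alg: "smult c (A * P) * (X * B) = smult c (A * B) * (P * X)" for A P X B :: "complex poly"
      by (simp add: mult_ac)
    have alg': "smult c (A * B) * smult n X = smult n B * smult c (X * A)" for A B X :: "complex poly" and n
      by (simp add: mult_ac)
    have "D = smult c ([:-z, 1:] ^ order z D * ?A)"
      by (subst D) (subst prod.remove[OF fin z], rule refl)
    moreover have "smult c (?A * pderiv ([:-z, 1:] ^ order z D)) * ([:-z, 1:] * ?B)
      = smult c (?A * ?B) * (pderiv ([:-z, 1:] ^ order z D) * [:-z, 1:])"
      by (rule alg)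
    ultimately show "smult c (?A * pderiv ([:-z, 1:] ^ order z D)) * ([:-z, 1:] * ?B)
      = smult (of_nat (order z D)) ?B * D"
      by (simp only: pd alg')
  qed
  also have "\<dots> = log_deriv_num D * D"
    by (simp add: log_deriv_num_def R_def sum_distrib_right)
  finally show ?thesis .
qed

lemma poly_radical_eq_0_iff: "D \<noteq> 0 \<Longrightarrow> poly (radical_poly D) z = 0 \<longleftrightarrow> poly D z = 0"
  using poly_roots_finite[of D] by (auto simp: radical_poly_def poly_prod)

text \<open>Only the summand of \<open>z\<close> survives at \<open>z\<close>. Hence
  \<open>log_deriv_num D / radical_poly D\<close> is in lowest terms.\<close>

lemma poly_log_deriv_num_nonzero:
  assumes "D \<noteq> 0" "poly D z = 0"
  shows "poly (log_deriv_num D) z \<noteq> 0"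
proof -
  let ?R = "{z. poly D z = 0}"
  have fin: "finite ?R" using assms(1) by (rule poly_roots_finite)
  have "poly (log_deriv_num D) z =
    (\<Sum>y\<in>?R. if y = z then of_nat (order z D) * (\<Prod>z'\<in>?R-{z}. z - z') else 0)"
    unfolding log_deriv_num_def poly_sum
    using assms fin by (intro sum.cong) (auto simp: poly_prod_linear_remove)
  also have "\<dots> = of_nat (order z D) * (\<Prod>z'\<in>?R-{z}. z - z')" using fin assms by (simp add: sum.delta)
  also have "\<dots> \<noteq> 0" using fin assms by (auto simp: order_root)
  finally show ?thesis .
qed

lemma degree_radical_poly: "D \<noteq> 0 \<Longrightarrow> degree (radical_poly D) = card {z. poly D z = 0}"
  unfolding radical_poly_def by (intro degree_prod_linear poly_roots_finite)

lemma lead_coeff_radical_poly: "lead_coeff (radical_poly D) = 1"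
  unfolding radical_poly_def by (subst lead_coeff_prod) auto

lemma sum_order_eq_degree:
  fixes D :: "complex poly"
  assumes "D \<noteq> 0"
  shows "(\<Sum>z|poly D z = 0. order z D) = degree D"
proof -
  have "degree D = degree (\<Prod>z|poly D z = 0. [:-z, 1:] ^ order z D)"
    using assms complex_poly_decompose[of D] by (metis degree_smult_eq leading_coeff_0_iff)
  also have "\<dots> = (\<Sum>z|poly D z = 0. order z D)"
    by (subst degree_prod_eq_sum_degree) (auto simp: degree_power_eq)
  finally show ?thesis by simp
qed

lemma degree_log_deriv_num_le:
  assumes "D \<noteq> 0"
  shows "degree (log_deriv_num D) \<le> card {z. poly D z = 0} - 1"
  unfolding log_deriv_num_def using poly_roots_finite[OF assms]
  by (intro degree_sum_le) (auto intro!: order_trans[OF degree_smult_le] simp: degree_prod_linear)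

text \<open>All products are monic of the same degree, so the multiplicities add up. This is the
  residue of \<open>D' / D\<close> at infinity up to sign, and it enters the degree of the critical
  polynomial.\<close>

lemma coeff_log_deriv_num:
  assumes "D \<noteq> 0"
  shows "coeff (log_deriv_num D) (card {z. poly D z = 0} - 1) = of_nat (degree D)"
proof -
  let ?R = "{z. poly D z = 0}"
  have fin: "finite ?R" using assms by (rule poly_roots_finite)
  have "coeff (\<Prod>z'\<in>?R-{z}. [:- z', 1:]) (card ?R - 1) = 1" if "z \<in> ?R" for z
  proof -
    have "lead_coeff (\<Prod>z'\<in>?R-{z}. [:- z', 1:]) = 1" by (subst lead_coeff_prod) auto
    then show ?thesis using fin that by (simp add: degree_prod_linear)
  qed
  then have "coeff (log_deriv_num D) (card ?R - 1) = (\<Sum>z\<in>?R. of_nat (order z D))"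
    by (simp add: log_deriv_num_def coeff_sum)
  then show ?thesis using sum_order_eq_degree[OF assms] by (metis of_nat_sum)
qed

section \<open>The critical polynomial and the density of good parameters\<close>

definition Q_poly :: "nat \<Rightarrow> (int \<Rightarrow> complex) \<Rightarrow> complex poly" where
  "Q_poly l w = 1 + monom ((-1) ^ (l + 1)) (l + 1) + (\<Sum>i = 1..l. monom ((-1) ^ i * w (int i)) i)"

text \<open>The numerator of \<open>\<lambda>'\<close> for \<open>\<lambda> = - w\<^sub>0 Q / D\<close>, and its derivative along \<open>(-1)\<^sup>j w\<^sub>j\<close>.\<close>

definition crit_poly :: "nat \<Rightarrow> (int \<Rightarrow> complex) \<Rightarrow> complex poly \<Rightarrow> complex poly" where
  "crit_poly l w D = Q_poly l w * log_deriv_num D - pderiv (Q_poly l w) * radical_poly D"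

definition crit_direction :: "nat \<Rightarrow> complex poly \<Rightarrow> complex poly" where
  "crit_direction j D = monom 1 j * log_deriv_num D - monom (of_nat j) (j - 1) * radical_poly D"

text \<open>The second clause says that no pole of \<lambda> is cancelled by a zero of
  \<open>Q\<close>. It also keeps the roots of the critical polynomial away from the zeros of
  \<open>D\<close>; by the first clause they are non-degenerate critical points.\<close>

definition good :: "nat \<Rightarrow> (int \<Rightarrow> complex) \<Rightarrow> complex poly \<Rightarrow> bool" where
  "good l w D \<longleftrightarrow>
     (\<forall>q. poly (crit_poly l w D) q = 0 \<longrightarrow> poly (pderiv (crit_poly l w D)) q \<noteq> 0) \<and>
     (\<forall>z. poly D z = 0 \<longrightarrow> Q l w z \<noteq> 0)"

lemma poly_Q_poly: "poly (Q_poly l w) \<mu> = Q l w \<mu>"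
  by (simp add: Q_poly_def Q_def poly_sum poly_monom)

lemma Q_0: "Q l w 0 = 1"
  by (simp add: Q_def)

lemma coeff_mult_at_degree_bounds:
  fixes p q :: "'a::comm_semiring_0 poly"
  assumes "degree p \<le> m" "degree q \<le> n"
  shows "coeff (p * q) (m + n) = coeff p m * coeff q n"
proof -
  have "coeff (p * q) (m + n) = (\<Sum>i\<le>m+n. if i = m then coeff p m * coeff q n else 0)"
    unfolding coeff_mult
  proof (intro sum.cong refl)
    fix i assume "i \<in> {..m + n}"
    consider "i < m" | "i = m" | "i > m" by linarith
    then show "coeff p i * coeff q (m + n - i) = (if i = m then coeff p m * coeff q n else 0)"
    proof cases
      case 1
      then have "coeff q (m + n - i) = 0" using assms by (intro coeff_eq_0) auto
      then show ?thesis using 1 by simp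
    next
      case 3
      then have "coeff p i = 0" using assms by (intro coeff_eq_0) auto
      then show ?thesis using 3 by simp
    qed simp
  qed
  then show ?thesis by (simp add: sum.delta)
qed

lemma degree_Q_poly_le: "degree (Q_poly l w) \<le> l + 1"
  unfolding Q_poly_def
  by (intro degree_add_le degree_sum_le order_trans[OF degree_monom_le]) auto

lemma coeff_Q_poly_top: "coeff (Q_poly l w) (l + 1) = (-1) ^ (l + 1)"
  by (simp add: Q_poly_def coeff_sum)

text \<open>The coefficient in the expected top degree is, up to sign,
  \<open>degree D - (l + 1)\<close>. It is non-zero because \<open>degree D \<le> l\<close>, that
  is, because \<lambda> has a pole at infinity.\<close>

lemma degree_crit_poly:
  assumes D: "D \<noteq> 0" "poly D 0 = 0" "degree D \<le> l"
  shows "degree (crit_poly l w D) = l + card {z. poly D z = 0}"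
proof -
  let ?R = "{z. poly D z = 0}"
  have fin: "finite ?R" using D(1) by (rule poly_roots_finite)
  have "?R \<noteq> {}" using D by auto
  then obtain r where r: "card ?R = Suc r" using fin by (metis card_eq_0_iff not0_implies_Suc)
  let ?Q = "Q_poly l w" and ?L = "log_deriv_num D" and ?N = "radical_poly D"
  have dL: "degree ?L \<le> r" using degree_log_deriv_num_le[OF D(1)] r by simp
  have dN: "degree ?N \<le> Suc r" using degree_radical_poly[OF D(1)] r by simp
  have dQ': "degree (pderiv ?Q) \<le> l" using degree_Q_poly_le[of l w] by (simp add: degree_pderiv)
  have c1: "coeff (?Q * ?L) (l + Suc r) = (-1) ^ (l + 1) * of_nat (degree D)"
    using coeff_mult_at_degree_bounds[OF degree_Q_poly_le[of l w] dL]
      coeff_log_deriv_num[OF D(1)] r by (simp add: coeff_Q_poly_top[simplified])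
  have N: "coeff ?N (Suc r) = 1"
    using lead_coeff_radical_poly[of D] degree_radical_poly[OF D(1)] r by simp
  have "coeff (pderiv ?Q) l = of_nat (l + 1) * (-1) ^ (l + 1)"
    using coeff_Q_poly_top[of l w] by (simp add: coeff_pderiv)
  then have c2: "coeff (pderiv ?Q * ?N) (l + Suc r) = of_nat (l + 1) * (-1) ^ (l + 1)"
    using coeff_mult_at_degree_bounds[OF dQ' dN] N by simp
  have "coeff (crit_poly l w D) (l + Suc r) = (-1) ^ (l + 1) * (of_nat (degree D) - of_nat (l + 1))"
    by (simp only: crit_poly_def coeff_diff c1 c2) (simp add: algebra_simps)
  also have "of_nat (degree D) - of_nat (l + 1) \<noteq> (0::complex)"
    using D(3) by (simp del: of_nat_Suc of_nat_add add: of_nat_eq_iff)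
  then have "(-1) ^ (l + 1) * (of_nat (degree D) - of_nat (l + 1)) \<noteq> (0::complex)" by simp
  finally have "l + Suc r \<le> degree (crit_poly l w D)" by (rule le_degree)
  moreover have "degree (crit_poly l w D) \<le> l + Suc r" unfolding crit_poly_def
    using degree_Q_poly_le[of l w] dL dN dQ'
    by (intro degree_diff_le order_trans[OF degree_mult_le]) auto
  ultimately show ?thesis using r by simp
qed

text \<open>The radical vanishes at \<open>z\<close> and the other factor
  \<open>log_deriv_num\<close> does not, so a zero of \<open>D\<close> is a root of the critical
  polynomial only if \<open>Q\<close> vanishes there as well. At 0 this never happens, since
  \<open>Q\<close> has constant term 1.\<close>

lemma poly_crit_poly_root:
  assumes "D \<noteq> 0" "poly D z = 0"
  shows "poly (crit_poly l w D) z = Q l w z * poly (log_deriv_num D) z"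
  using assms by (simp add: crit_poly_def poly_radical_eq_0_iff poly_Q_poly)

text \<open>The sign in the increment of \<open>w j\<close> cancels the one in \<open>Q\<close>, so
  that the perturbation is exactly \<epsilon> times the monomial of degree \<open>j\<close>.\<close>

lemma Q_poly_update:
  assumes "j \<in> {1..l}"
  shows "Q_poly l (w(int j := w (int j) + (-1) ^ j * \<epsilon>)) = Q_poly l w + monom \<epsilon> j"
proof -
  have "(\<Sum>i = 1..l. monom ((-1) ^ i * (w(int j := w (int j) + (-1) ^ j * \<epsilon>)) (int i)) i)
    = (\<Sum>i = 1..l. monom ((-1) ^ i * w (int i)) i + (if i = j then monom \<epsilon> j else 0))"
    by (intro sum.cong) (auto simp: algebra_simps add_monom simp flip: power_add mult_2 power_mult_distrib)
  also have "\<dots> = (\<Sum>i = 1..l. monom ((-1) ^ i * w (int i)) i) + monom \<epsilon> j"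
    using assms by (simp add: sum.distrib sum.delta)
  finally show ?thesis by (simp add: Q_poly_def)
qed

lemma crit_poly_update:
  assumes "j \<in> {1..l}"
  shows "crit_poly l (w(int j := w (int j) + (-1) ^ j * \<epsilon>)) D
    = crit_poly l w D + smult \<epsilon> (crit_direction j D)"
proof -
  have "pderiv (monom \<epsilon> j) = smult \<epsilon> (monom (of_nat j) (j - 1))"
    by (simp add: pderiv_monom smult_monom mult.commute)
  moreover have "monom \<epsilon> j = smult \<epsilon> (monom 1 j)" by (simp add: smult_monom)
  ultimately show ?thesis
    unfolding crit_poly_def crit_direction_def Q_poly_update[OF assms]
    by (simp add: pderiv_add algebra_simps smult_diff_right)
qed

text \<open>Each clause of \<open>good\<close> excludes finitely many \<epsilon>: multiple roots by
  \<open>finite_nonsimple_pencil\<close>, and a cancellation at a zero \<open>z \<noteq> 0\<close>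
  of \<open>D\<close> because it fixes the value of \<open>\<epsilon> * z ^ j\<close>. At
  \<open>z = 0\<close> nothing can cancel.\<close>

lemma good_perturbation:
  assumes D: "D \<noteq> 0" "poly D 0 = 0" "degree D \<le> l" and j: "j \<in> {1..l}" and "0 < \<delta>"
    and coprime: "\<And>q. poly (crit_poly l w D) q = 0 \<Longrightarrow> poly (crit_direction j D) q \<noteq> 0"
  shows "\<exists>\<epsilon>. cmod \<epsilon> < \<delta> \<and> good l (w(int j := w (int j) + (-1) ^ j * \<epsilon>)) D"
proof -
  let ?J = "crit_poly l w D" and ?K = "crit_direction j D"
  have "degree ?J \<noteq> 0" using degree_crit_poly[OF D, of w] j by auto
  then have fin: "finite {\<epsilon>. \<exists>q. poly (?J + smult \<epsilon> ?K) q = 0 \<and> poly (pderiv (?J + smult \<epsilon> ?K)) q = 0}"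
    using finite_nonsimple_pencil[OF coprime] by blast
  have fin2: "finite ((\<lambda>z. - Q l w z / z ^ j) ` {z. poly D z = 0})"
    using D(1) by (intro finite_imageI poly_roots_finite)
  obtain \<epsilon> where \<epsilon>: "cmod \<epsilon> < \<delta>"
    "\<epsilon> \<notin> {\<epsilon>. \<exists>q. poly (?J + smult \<epsilon> ?K) q = 0 \<and> poly (pderiv (?J + smult \<epsilon> ?K)) q = 0}
       \<union> (\<lambda>z. - Q l w z / z ^ j) ` {z. poly D z = 0}"
    by (rule small_avoiding_finite[OF finite_UnI[OF fin fin2] \<open>0 < \<delta>\<close>])
  have "Q l (w(int j := w (int j) + (-1) ^ j * \<epsilon>)) z \<noteq> 0" if z: "poly D z = 0" for z
  proof (cases "z = 0")
    case False
    have "Q l (w(int j := w (int j) + (-1) ^ j * \<epsilon>)) z = Q l w z + \<epsilon> * z ^ j"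
      by (simp add: Q_poly_update[OF j] poly_monom flip: poly_Q_poly)
    moreover have "\<epsilon> \<noteq> - Q l w z / z ^ j" using \<epsilon>(2) z by auto
    ultimately show ?thesis using False by (auto simp: field_simps add_eq_0_iff2)
  qed (simp add: Q_0)
  then show ?thesis using \<epsilon> unfolding good_def crit_poly_update[OF j] by blast
qed

text \<open>The pencil argument needs \<open>J\<close> and \<open>K\<^sub>1\<close> without common roots, which is first achieved by moving
  \<open>w\<^sub>2\<close>: at a root \<open>q \<noteq> 0\<close> of \<open>K\<^sub>1\<close> one has \<open>K\<^sub>2(q) = - q N(q) \<noteq> 0\<close>. If \<open>D\<close> is linear, then
  \<open>K\<^sub>1 = 0\<close> and \<open>K\<^sub>2 = - X\<^sup>2\<close>; for \<open>l = 1\<close> moreover \<open>J = 1 - X\<^sup>2\<close> whatever the parameters are.\<close>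

lemma good_dense:
  assumes D: "D \<noteq> 0" "poly D 0 = 0" "degree D \<le> l" and \<delta>: "0 < \<delta>"
  shows "\<exists>w'. (\<forall>j. j \<notin> int ` {1..l} \<longrightarrow> w' j = w j) \<and> (\<forall>j. cmod (w' j - w j) < \<delta>) \<and> good l w' D"
proof -
  let ?R = "{z. poly D z = 0}"
  let ?J = "crit_poly l w D" and ?N = "radical_poly D" and ?L = "log_deriv_num D"
  have fin: "finite ?R" using D(1) by (rule poly_roots_finite)
  have dD: "degree D \<noteq> 0" using D(1,2) by (metis degree_eq_zeroE poly_const_conv pCons_0_0)
  have J0: "poly (crit_poly l w D) 0 \<noteq> 0" for w
    using poly_crit_poly_root[OF D(1,2)] poly_log_deriv_num_nonzero[OF D(1,2)] by (simp add: Q_0)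
  have K: "poly (crit_direction j D) q = q ^ j * poly ?L q - of_nat j * q ^ (j - 1) * poly ?N q" for j q
    by (simp add: crit_direction_def poly_monom)
  have LN: "poly ?L q \<noteq> 0" if "poly ?N q = 0" for q
    using that poly_log_deriv_num_nonzero[OF D(1)] poly_radical_eq_0_iff[OF D(1)] by blast
  have L0: "poly ?L 0 \<noteq> 0" using poly_log_deriv_num_nonzero[OF D(1,2)] .
  have N0: "poly ?N 0 = 0" using D poly_radical_eq_0_iff by blast
  have small: "cmod ((w(int j := w (int j) + (-1) ^ j * \<epsilon>)) i - w i) < \<delta>" if "cmod \<epsilon> < \<delta>" for w \<epsilon> i j
    using that \<delta> by (auto simp: norm_mult norm_power)
  show ?thesis
  proof (cases "degree D = 1")
    case True
    have zero_only: "z = 0" if "poly D z = 0" for z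
      using card_poly_roots_bound[OF D(1)] True card_le_Suc0_iff_eq[OF fin] D(2) that by auto
    then have R1: "?R = {0}" using D(2) by auto
    have N: "?N = [:0, 1:]" by (simp add: radical_poly_def R1)
    have L: "?L = 1"
      using degree_log_deriv_num_le[OF D(1)] coeff_log_deriv_num[OF D(1)] True
      by (auto simp: R1 one_pCons elim!: degree_eq_zeroE)
    show ?thesis
    proof (cases "l = 1")
      case l: True
      have "crit_poly l w D = [:1, 0, -1:]"
        by (simp add: crit_poly_def N L l Q_poly_def pderiv_add pderiv_monom monom_Suc one_pCons
          pderiv_pCons numeral_2_eq_2 monom_0)
      then have "poly (crit_poly l w D) q = 1 - q * q" "poly (pderiv (crit_poly l w D)) q = - 2 * q" for q
        by (simp_all add: pderiv_pCons algebra_simps)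
      moreover have "Q l w z \<noteq> 0" if "poly D z = 0" for z
        using zero_only[OF that] Q_0[of l w] by simp
      ultimately have "good l w D" unfolding good_def by auto
      then show ?thesis using \<delta> by (intro exI[of _ w]) auto
    next
      case False
      then have j: "2 \<in> {1..l}" using D(3) True by auto
      have "poly (crit_direction 2 D) q \<noteq> 0" if "poly ?J q = 0" for q
      proof
        assume "poly (crit_direction 2 D) q = 0"
        then have "q = 0" unfolding K N L by (simp add: power2_eq_square)
        then show False using J0[of w] that by simp
      qed
      from good_perturbation[OF D j \<delta> this] obtain \<epsilon> where \<epsilon>: "cmod \<epsilon> < \<delta>"
        "good l (w(int 2 := w (int 2) + (-1) ^ 2 * \<epsilon>)) D" by blast
      then show ?thesis using j small \<delta>
        by (intro exI[of _ "w(int 2 := w (int 2) + (-1) ^ 2 * \<epsilon>)"]) auto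
    qed
  next
    case False
    then have j1: "1 \<in> {1..l}" and j2: "2 \<in> {1..l}" using D(3) dD by auto
    let ?K1 = "crit_direction 1 D" and ?K2 = "crit_direction 2 D"
    have "?R \<noteq> {}" using D by auto
    then obtain r where r: "card ?R = Suc r" using fin by (metis card_eq_0_iff not0_implies_Suc)
    \<comment> \<open>This coefficient vanishes precisely for linear \<open>D\<close>, which is why
      that case was split off.\<close>
    have "coeff ?K1 (Suc r) = of_nat (degree D) - 1"
    proof -
      have "coeff ?N (Suc r) = 1"
        using lead_coeff_radical_poly[of D] degree_radical_poly[OF D(1)] r by simp
      moreover have "coeff ?L r = of_nat (degree D)" using coeff_log_deriv_num[OF D(1)] r by simp
      ultimately show ?thesis by (simp add: crit_direction_def coeff_monom_mult flip: one_pCons)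
    qed
    moreover have "of_nat (degree D) - 1 \<noteq> (0::complex)" using False by simp
    ultimately have "?K1 \<noteq> 0" by (metis coeff_0)
    then have finK1: "finite {q. poly ?K1 q = 0}" by (rule poly_roots_finite)
    have K1K2: "poly ?K2 q \<noteq> 0" if "poly ?K1 q = 0" "q \<noteq> 0" for q
    proof -
      have e: "q * poly ?L q = poly ?N q" using that by (simp add: K)
      then have "poly ?K2 q = - q * poly ?N q" using that
        by (simp add: K power2_eq_square mult.assoc)
      moreover have "poly ?N q \<noteq> 0" using LN[of q] e that(2) by (metis mult_eq_0_iff)
      ultimately show ?thesis using that by simp
    qed
    \<comment> \<open>The root 0 of \<open>?K1\<close> is also a root of \<open>?K2\<close>; the
      quotient is then 0 by convention and only \<open>\<epsilon>2 = 0\<close> is forbidden. This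
      root is no obstacle, since the critical polynomial is non-zero at 0 for all
      parameters.\<close>
    obtain \<epsilon>2 where \<epsilon>2: "cmod \<epsilon>2 < \<delta>" "\<epsilon>2 \<notin> (\<lambda>q. - poly ?J q / poly ?K2 q) ` {q. poly ?K1 q = 0}"
      using small_avoiding_finite[OF finite_imageI[OF finK1] \<delta>] by blast
    let ?w2 = "w(int 2 := w (int 2) + (-1) ^ 2 * \<epsilon>2)"
    have "poly ?K1 q \<noteq> 0" if "poly (crit_poly l ?w2 D) q = 0" for q
    proof
      assume K1: "poly ?K1 q = 0"
      have q0: "q \<noteq> 0" using J0[of ?w2] that by auto
      have "poly ?J q + \<epsilon>2 * poly ?K2 q = 0"
        using that unfolding crit_poly_update[OF j2] poly_add poly_smult .
      then have "\<epsilon>2 * poly ?K2 q = - poly ?J q" by (metis add.inverse_unique)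
      then have "\<epsilon>2 = - poly ?J q / poly ?K2 q" using K1K2[OF K1 q0]
        by (metis nonzero_mult_div_cancel_right)
      then show False using \<epsilon>2(2) K1 by blast
    qed
    from good_perturbation[OF D j1 \<delta> this] obtain \<epsilon>1 where \<epsilon>1: "cmod \<epsilon>1 < \<delta>"
      "good l (?w2(int 1 := ?w2 (int 1) + (-1) ^ 1 * \<epsilon>1)) D" by blast
    let ?w1 = "?w2(int 1 := ?w2 (int 1) + (-1) ^ 1 * \<epsilon>1)"
    have "1 \<in> int ` {1..l}" "2 \<in> int ` {1..l}" using j1 j2 by force+
    then have "\<forall>j. j \<notin> int ` {1..l} \<longrightarrow> ?w1 j = w j" by (metis fun_upd_apply of_nat_1 of_nat_numeral)
    moreover have "cmod (?w1 j - w j) < \<delta>" for j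
      using \<epsilon>1(1) \<epsilon>2(1) \<delta> by simp
    ultimately show ?thesis using \<epsilon>1(2) by blast
  qed
qed

section \<open>Congruence, residue and continuity facts\<close>

lemma Q_cong: "(\<And>i. i \<in> {1..l} \<Longrightarrow> w (int i) = w' (int i)) \<Longrightarrow> Q l w \<mu> = Q l w' \<mu>"
  by (simp add: Q_def)

lemma Q_poly_cong: "(\<And>i. i \<in> {1..l} \<Longrightarrow> w (int i) = w' (int i)) \<Longrightarrow> Q_poly l w = Q_poly l w'"
  by (simp add: Q_poly_def)

lemma good_cong:
  assumes "\<And>i. i \<in> {1..l} \<Longrightarrow> w (int i) = w' (int i)"
  shows "good l w D \<longleftrightarrow> good l w' D"
  using Q_poly_cong[of l w w'] Q_cong[of l w w'] assms by (simp add: good_def crit_poly_def)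

lemma residue_at_simple_root:
  fixes J :: "complex poly"
  assumes S: "open S" "q \<in> S" "f holomorphic_on S"
    and q: "poly J q = 0" "poly (pderiv J) q \<noteq> 0"
  shows "residue (\<lambda>\<mu>. f \<mu> / poly J \<mu>) q = f q / poly (pderiv J) q"
proof -
  obtain K where K: "J = [:-q, 1:] * K" using q(1) by (meson poly_eq_0_iff_dvd dvdE)
  have Kq: "poly (pderiv J) q = poly K q" by (simp only: K pderiv_mult poly_add poly_mult) (simp add: pderiv_pCons)
  let ?T = "S \<inter> {\<mu>. poly K \<mu> \<noteq> 0}"
  have "open {\<mu>. poly K \<mu> \<noteq> 0}" by (intro open_Collect_neq continuous_intros)
  then have T: "open ?T" "q \<in> ?T" using S q Kq by auto
  have "(\<lambda>\<mu>. f \<mu> / poly K \<mu>) holomorphic_on ?T"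
    by (intro holomorphic_intros holomorphic_on_subset[OF S(3)]) auto
  from residue_simple[OF T this]
  have "residue (\<lambda>w. f w / poly K w / (w - q)) q = f q / poly (pderiv J) q" by (simp add: Kq)
  moreover have "poly J w = poly K w * (w - q)" for w
    by (simp add: K algebra_simps)
  ultimately show ?thesis by (simp add: divide_divide_eq_left)
qed

lemma eventually_at_if_cofinite:
  fixes q :: complex
  assumes "\<forall>\<^sub>\<infinity>\<mu>. P \<mu>"
  shows "eventually P (at q)"
proof -
  have "finite {\<mu>. \<not> P \<mu>}" using assms by (simp add: eventually_cofinite)
  then have "\<not> q islimpt {\<mu>. \<not> P \<mu>}" by (rule islimpt_finite)
  then show ?thesis by (simp add: islimpt_iff_eventually)
qed

lemma norm_vec_less_if_components:
  fixes x :: "complex ^ 'n::finite"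
  assumes "\<And>i. cmod (x $ i) < \<delta>"
  shows "norm x < real CARD('n) * \<delta>"
proof -
  have "norm x \<le> (\<Sum>i\<in>UNIV. norm (x $ i))"
    unfolding norm_vec_def by (rule L2_set_le_sum) simp
  also have "\<dots> < (\<Sum>i\<in>(UNIV::'n set). \<delta>)"
    using assms by (intro sum_strict_mono) auto
  finally show ?thesis by simp
qed

lemma holo_on_imp_continuous_on: "holo_on U f \<Longrightarrow> continuous_on U f"
  unfolding holo_on_def
  by (meson continuous_at_imp_continuous_on has_derivative_continuous)

lemma axis_0: "axis i (0::complex) = 0"
  by (simp add: axis_def vec_eq_iff)

lemma eventually_axis_in_open:
  fixes U :: "(complex ^ 'n::finite) set"
  assumes "open U" "x \<in> U"
  shows "\<forall>\<^sub>F t in nhds 0. x + axis k t \<in> U"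
proof -
  have "((\<lambda>t. axis k t $ i) \<longlongrightarrow> axis k 0 $ i) (nhds (0::complex))" for i
    by (cases "i = k") (auto simp: axis_def filterlim_ident)
  then have "((\<lambda>t. axis k t) \<longlongrightarrow> axis k 0) (nhds (0::complex))" by (rule vec_tendstoI)
  then have "((\<lambda>t. x + axis k t) \<longlongrightarrow> x + axis k 0) (nhds 0)" by (intro tendsto_add tendsto_const)
  then show ?thesis using topological_tendstoD assms by (fastforce simp: axis_0)
qed

lemma invertible_ker:
  fixes A :: "complex ^ 'n ^ 'n::finite"
  assumes "invertible A" "A *v v = 0"
  shows "v = 0"
proof -
  obtain B where "B ** A = mat 1" using assms(1) by (auto simp: invertible_def)
  then have "v = B *v (A *v v)" by (simp add: matrix_vector_mul_assoc)
  then show ?thesis using assms(2) by simp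
qed

section \<open>Landau--Ginzburg models at generic parameters\<close>

text \<open>Both kinds of families have the form \<open>\<lambda> = - w\<^sub>0 Q / D\<close> with a denominator \<open>D\<close> depending only on the
  coordinates with negative labels; \<open>den' x j\<close> is the derivative of \<open>D\<close> along the coordinate with label \<open>j\<close>.\<close>

locale shift_lg =
  fixes l :: nat and \<Lambda> :: "int set" and \<iota> :: "int \<Rightarrow> 'n::finite"
    and U :: "(complex ^ 'n) set"
    and den :: "complex ^ 'n \<Rightarrow> complex poly"
    and den' :: "complex ^ 'n \<Rightarrow> int \<Rightarrow> complex poly"
    and g :: "complex ^ 'n \<Rightarrow> complex ^ 'n ^ 'n"
    and C :: "complex ^ 'n \<Rightarrow> 'n \<Rightarrow> 'n \<Rightarrow> 'n \<Rightarrow> complex"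
    and e E :: "complex ^ 'n \<Rightarrow> complex ^ 'n" and d :: complex
  assumes bij: "bij_betw \<iota> \<Lambda> UNIV" and labels: "{0..int l} \<subseteq> \<Lambda>" "\<Lambda> \<subseteq> {..int l}"
    and scale_nonzero: "\<And>x. x \<in> U \<Longrightarrow> x $ \<iota> 0 \<noteq> 0"
    and den_nonzero: "\<And>x. x \<in> U \<Longrightarrow> den x \<noteq> 0"
    and den_0: "\<And>x. x \<in> U \<Longrightarrow> poly (den x) 0 = 0"
    and degree_den: "\<And>x. x \<in> U \<Longrightarrow> degree (den x) \<le> l"
    and den_cong: "\<And>x y. (\<And>j. j \<in> \<Lambda> \<Longrightarrow> j < 0 \<Longrightarrow> x $ \<iota> j = y $ \<iota> j) \<Longrightarrow> den x = den y"
    and den'_cong: "\<And>x y. (\<And>j. j \<in> \<Lambda> \<Longrightarrow> j < 0 \<Longrightarrow> x $ \<iota> j = y $ \<iota> j) \<Longrightarrow> den' x = den' y"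
    and den_deriv: "\<And>x j \<mu>. x \<in> U \<Longrightarrow> j \<in> \<Lambda> \<Longrightarrow> j < 0 \<Longrightarrow>
      ((\<lambda>t. poly (den (x + axis (\<iota> j) t)) \<mu>) has_field_derivative poly (den' x j) \<mu>) (at 0)"
    and frobenius: "frobenius_manifold U g C e E d"
    and lg: "landau_ginzburg U
      (\<lambda>x \<mu>. - (x $ \<iota> 0) * Q l (\<lambda>j. x $ \<iota> j) \<mu> / poly (den x) \<mu>) g C e E"
begin

section \<open>The superpotential and its derivatives\<close>

sublocale frobenius_manifold U g C e E d by (rule frobenius)

definition lam :: "complex ^ 'n \<Rightarrow> complex \<Rightarrow> complex" where
  "lam x \<mu> = - (x $ \<iota> 0) * Q l (\<lambda>j. x $ \<iota> j) \<mu> / poly (den x) \<mu>"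

definition label :: "'n \<Rightarrow> int" where
  "label = inv_into \<Lambda> \<iota>"

text \<open>The derivatives of \<lambda> in the directions of \<open>w\<^sub>0\<close>, of the other
  \<open>w\<^sub>i\<close>, and of the coordinates of the denominator. Unlike \<open>pd\<close>,
  these formulas are visibly holomorphic in \<mu> off the zeros of \<open>den x\<close>.\<close>

definition lam_d :: "complex ^ 'n \<Rightarrow> 'n \<Rightarrow> complex \<Rightarrow> complex" where
  "lam_d x i \<mu> =
    (if label i = 0 then - Q l (\<lambda>j. x $ \<iota> j) \<mu> / poly (den x) \<mu>
     else if label i > 0 then - (x $ \<iota> 0) * (-1) ^ nat (label i) * \<mu> ^ nat (label i) / poly (den x) \<mu>
     else x $ \<iota> 0 * Q l (\<lambda>j. x $ \<iota> j) \<mu> * poly (den' x (label i)) \<mu> / (poly (den x) \<mu>)\<^sup>2)"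

abbreviation crit :: "complex ^ 'n \<Rightarrow> complex poly" where
  "crit x \<equiv> crit_poly l (\<lambda>j. x $ \<iota> j) (den x)"

definition generic :: "complex ^ 'n \<Rightarrow> bool" where
  "generic x \<longleftrightarrow> x \<in> U \<and> good l (\<lambda>j. x $ \<iota> j) (den x)"

text \<open>\<open>weight x q\<close> is \<open>1 / (q\<^sup>2 \<lambda>''(q))\<close>, the residue of \<open>\<phi>\<^sup>2 / d\<lambda>\<close> at a simple critical point.\<close>

definition weight :: "complex ^ 'n \<Rightarrow> complex \<Rightarrow> complex" where
  "weight x q = poly (den x) q * poly (radical_poly (den x)) q /
     (x $ \<iota> 0 * q\<^sup>2 * poly (pderiv (crit x)) q)"

lemma label_in: "label i \<in> \<Lambda>" and iota_label: "\<iota> (label i) = i"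
  using bij unfolding label_def
  by (metis UNIV_I bij_betw_imp_surj_on inv_into_into, metis UNIV_I bij_betw_imp_surj_on f_inv_into_f)

lemma label_iota: "j \<in> \<Lambda> \<Longrightarrow> label (\<iota> j) = j"
  using bij unfolding label_def by (simp add: bij_betw_inv_into_left)

lemma iota_eq_iff: "j \<in> \<Lambda> \<Longrightarrow> k \<in> \<Lambda> \<Longrightarrow> \<iota> j = \<iota> k \<longleftrightarrow> j = k"
  by (metis label_iota)

lemma zero_label: "0 \<in> \<Lambda>" and pos_label: "i \<in> {1..l} \<Longrightarrow> int i \<in> \<Lambda>"
  using labels by auto

lemma axis_component:
  assumes "j \<in> \<Lambda>" "k \<in> \<Lambda>"
  shows "axis (\<iota> j) t $ \<iota> k = (if k = j then t else 0)"
  using iota_eq_iff[OF assms(2,1)] by (simp add: axis_def)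

lemma den_axis: "j \<in> \<Lambda> \<Longrightarrow> j \<ge> 0 \<Longrightarrow> den (x + axis (\<iota> j) t) = den x"
  by (rule den_cong) (auto simp: axis_component)

lemma den'_axis: "j \<in> \<Lambda> \<Longrightarrow> j \<ge> 0 \<Longrightarrow> den' (x + axis (\<iota> j) t) = den' x"
  by (rule den'_cong) (auto simp: axis_component)

lemma Q_axis_other:
  "j \<in> \<Lambda> \<Longrightarrow> j \<le> 0 \<Longrightarrow> Q l (\<lambda>k. (x + axis (\<iota> j) t) $ \<iota> k) \<mu> = Q l (\<lambda>k. x $ \<iota> k) \<mu>"
  by (rule Q_cong) (auto simp: axis_component pos_label)

lemma Q_axis:
  assumes "j \<in> {1..l}"
  shows "Q l (\<lambda>k. (x + axis (\<iota> (int j)) t) $ \<iota> k) \<mu> = Q l (\<lambda>k. x $ \<iota> k) \<mu> + (-1) ^ j * t * \<mu> ^ j"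
proof -
  let ?w = "\<lambda>k. x $ \<iota> k"
  have "Q l (\<lambda>k. (x + axis (\<iota> (int j)) t) $ \<iota> k) \<mu>
      = Q l (?w(int j := ?w (int j) + (-1) ^ j * ((-1) ^ j * t))) \<mu>"
    using assms by (intro Q_cong) (auto simp: axis_component pos_label simp flip: mult.assoc power_add mult_2)
  also have "\<dots> = Q l ?w \<mu> + (-1) ^ j * t * \<mu> ^ j"
    using Q_poly_update[OF assms, of ?w "(-1) ^ j * t"]
    unfolding poly_Q_poly[symmetric] by (simp add: poly_monom)
  finally show ?thesis .
qed

lemma pd_lam:
  assumes x: "x \<in> U" and \<mu>: "poly (den x) \<mu> \<noteq> 0"
  shows "pd i (\<lambda>y. lam y \<mu>) x = lam_d x i \<mu>"
proof -
  let ?j = "label i" and ?D = "poly (den x) \<mu>" and ?Q = "Q l (\<lambda>j. x $ \<iota> j) \<mu>"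
  have ax: "axis i = axis (\<iota> ?j)" by (simp add: iota_label)
  note j = label_in[of i]
  have "((\<lambda>t. lam (x + axis (\<iota> ?j) t) \<mu>) has_field_derivative lam_d x i \<mu>) (at 0)"
  proof -
    consider "?j = 0" | "?j > 0" | "?j < 0" by linarith
    then show ?thesis
    proof cases
      case 1
      have "lam (x + axis (\<iota> ?j) t) \<mu> = - (x $ \<iota> 0 + t) * ?Q / ?D" for t
        unfolding 1 lam_def Q_axis_other[OF zero_label order_refl] den_axis[OF zero_label order_refl]
        by (simp add: axis_component zero_label)
      then show ?thesis
        using 1 \<mu> by (auto intro!: derivative_eq_intros simp: lam_d_def)
    next
      case 2
      then obtain k where k: "?j = int k" "k \<in> {1..l}" using j labels(2)
        by (intro that[of "nat ?j"]) (auto simp: subset_iff)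
      have "lam (x + axis (\<iota> ?j) t) \<mu> = - (x $ \<iota> 0) * (?Q + (-1) ^ k * t * \<mu> ^ k) / ?D" for t
        unfolding lam_def k(1) Q_axis[OF k(2)]
        using 2 j k by (simp add: den_axis axis_component zero_label)
      then show ?thesis
        using 2 k \<mu> by (auto intro!: derivative_eq_intros simp: lam_d_def)
    next
      case 3
      have "lam (x + axis (\<iota> ?j) t) \<mu> = - (x $ \<iota> 0) * ?Q / poly (den (x + axis (\<iota> ?j) t)) \<mu>" for t
        unfolding lam_def Q_axis_other[OF j less_imp_le[OF 3]]
        using 3 j by (simp add: axis_component zero_label)
      then show ?thesis
        using 3 \<mu> j by (auto intro!: derivative_eq_intros den_deriv[OF x] simp: lam_d_def power2_eq_square axis_0)
    qed
  qed
  then show ?thesis unfolding pd_def ax by (rule DERIV_imp_deriv)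
qed

lemma open_den_nonzero: "open {\<mu>. poly (den x) \<mu> \<noteq> 0}"
  by (intro open_Collect_neq continuous_intros)

lemma lam_d_holomorphic: "lam_d x i holomorphic_on {\<mu>. poly (den x) \<mu> \<noteq> 0}"
  unfolding lam_d_def poly_Q_poly[symmetric] by (cases "label i = 0"; cases "label i > 0")
    (auto intro!: holomorphic_intros)

lemma lam_holomorphic: "lam x holomorphic_on {\<mu>. poly (den x) \<mu> \<noteq> 0}"
  unfolding lam_def poly_Q_poly[symmetric] by (auto intro!: holomorphic_intros)

text \<open>Writing \<open>D' = L * D / N\<close>, with \<open>N\<close> the radical and
  \<open>L\<close> the logarithmic numerator, cancels one factor \<open>D\<close> in the quotient
  rule and leaves the critical polynomial over \<open>D * N\<close>.\<close>

lemma deriv_lam: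
  assumes x: "x \<in> U" and \<mu>: "poly (den x) \<mu> \<noteq> 0"
  shows "deriv (lam x) \<mu> = x $ \<iota> 0 * poly (crit x) \<mu> / (poly (den x) \<mu> * poly (radical_poly (den x)) \<mu>)"
proof -
  let ?D = "poly (den x) \<mu>" and ?D' = "poly (pderiv (den x)) \<mu>" and ?N = "poly (radical_poly (den x)) \<mu>"
    and ?L = "poly (log_deriv_num (den x)) \<mu>" and ?q = "Q_poly l (\<lambda>j. x $ \<iota> j)"
  have N: "?N \<noteq> 0" using \<mu> x by (simp add: poly_radical_eq_0_iff den_nonzero)
  have "?D' * ?N = ?L * ?D"
    using pderiv_mult_radical[OF den_nonzero[OF x]] by (metis poly_mult)
  then have D': "?D' = ?L * ?D / ?N" using N by (simp add: eq_divide_eq)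
  have "(lam x has_field_derivative
    - (x $ \<iota> 0) * ((poly (pderiv ?q) \<mu> * ?D - poly ?q \<mu> * ?D') / (?D * ?D))) (at \<mu>)"
    unfolding lam_def[abs_def] poly_Q_poly[symmetric] 
    using \<mu> by (auto intro!: derivative_eq_intros simp: field_simps)
  then have "deriv (lam x) \<mu> = - (x $ \<iota> 0) * ((poly (pderiv ?q) \<mu> * ?D - poly ?q \<mu> * ?D') / (?D * ?D))"
    by (rule DERIV_imp_deriv)
  also have "\<dots> = x $ \<iota> 0 * poly (crit x) \<mu> / (?D * ?N)"
    unfolding D' crit_poly_def using \<mu> N by (simp add: field_simps)
  finally show ?thesis .
qed

section \<open>Residues at generic parameters\<close>

lemma generic_in_U: "generic x \<Longrightarrow> x \<in> U"
  by (simp add: generic_def)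

lemma den_crit_nonzero:
  assumes "generic x" "poly (crit x) q = 0"
  shows "poly (den x) q \<noteq> 0"
proof
  assume D: "poly (den x) q = 0"
  have x: "den x \<noteq> 0" using assms by (simp add: generic_def den_nonzero)
  have "Q l (\<lambda>j. x $ \<iota> j) q \<noteq> 0" using assms D by (auto simp: generic_def good_def)
  then show False
    using poly_crit_poly_root[OF x D] poly_log_deriv_num_nonzero[OF x D] assms(2) by simp
qed

lemma crit_simple: "generic x \<Longrightarrow> poly (crit x) q = 0 \<Longrightarrow> poly (pderiv (crit x)) q \<noteq> 0"
  by (simp add: generic_def good_def)

lemma degree_crit: "x \<in> U \<Longrightarrow> degree (crit x) = l + card {z. poly (den x) z = 0}"
  by (simp add: degree_crit_poly den_nonzero den_0 degree_den)

lemma crit_nonzero: "x \<in> U \<Longrightarrow> crit x \<noteq> 0"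
  using poly_crit_poly_root[OF den_nonzero den_0] poly_log_deriv_num_nonzero[OF den_nonzero den_0]
  by (metis Q_0 mult_1 poly_0)

lemma finite_crit: "x \<in> U \<Longrightarrow> finite {q. poly (crit x) q = 0}"
  by (intro poly_roots_finite crit_nonzero)

lemma crit_nz: "generic x \<Longrightarrow> poly (crit x) q = 0 \<Longrightarrow> q \<noteq> 0"
  using den_crit_nonzero den_0 generic_in_U by blast

lemma weight_nonzero: "generic x \<Longrightarrow> poly (crit x) q = 0 \<Longrightarrow> weight x q \<noteq> 0"
  using den_crit_nonzero[of x q] crit_simple[of x q] crit_nz[of x q] generic_in_U[of x]
  by (simp add: weight_def poly_radical_eq_0_iff den_nonzero scale_nonzero)

text \<open>A continuation \<open>G\<close> across a zero of \<open>D\<close> would force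
  \<open>Q\<close> to vanish there, against \<open>good\<close>. Hence \<open>lam x\<close> is
  continuous at \<open>q\<close>, agrees with \<open>G\<close> in a full neighbourhood, and has the
  same derivative.\<close>

lemma crit_points_generic:
  assumes gx: "generic x"
  shows "crit_points (lam x) = {q. poly (crit x) q = 0}"
proof (intro equalityI subsetI)
  have x: "x \<in> U" using gx by (rule generic_in_U)
  fix q assume "q \<in> crit_points (lam x)"
  then obtain G where q: "q \<noteq> 0" and G: "G analytic_on {q}" "\<forall>\<^sub>F z in at q. G z = lam x z" "deriv G q = 0"
    by (auto simp: crit_points_def)
  have contG: "isCont G q" using G(1) analytic_at_imp_isCont by blast
  have D: "poly (den x) q \<noteq> 0"
  proof
    assume D: "poly (den x) q = 0"
    have "\<forall>\<^sub>F z in at q. poly (den x) z \<noteq> 0"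
      using poly_roots_finite[OF den_nonzero[OF x]]
      by (intro eventually_at_if_cofinite) (simp add: eventually_cofinite)
    with G(2) have "\<forall>\<^sub>F z in at q. G z * poly (den x) z = - (x $ \<iota> 0) * Q l (\<lambda>j. x $ \<iota> j) z"
      by eventually_elim (simp add: lam_def)
    moreover have "((\<lambda>z. G z * poly (den x) z) \<longlongrightarrow> G q * poly (den x) q) (at q)"
      using contG by (intro tendsto_intros) (auto simp: isCont_def)
    ultimately have "((\<lambda>z. - (x $ \<iota> 0) * Q l (\<lambda>j. x $ \<iota> j) z) \<longlongrightarrow> G q * poly (den x) q) (at q)"
      by (rule Lim_transform_eventually[rotated])
    moreover have "((\<lambda>z. - (x $ \<iota> 0) * Q l (\<lambda>j. x $ \<iota> j) z) \<longlongrightarrow> - (x $ \<iota> 0) * Q l (\<lambda>j. x $ \<iota> j) q) (at q)"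
      unfolding poly_Q_poly[symmetric] by (intro tendsto_intros)
    ultimately have "G q * poly (den x) q = - (x $ \<iota> 0) * Q l (\<lambda>j. x $ \<iota> j) q"
      using tendsto_unique[OF at_neq_bot] by blast
    then show False using D gx scale_nonzero[OF x] by (auto simp: generic_def good_def)
  qed
  have "lam x holomorphic_on {\<mu>. poly (den x) \<mu> \<noteq> 0}" by (rule lam_holomorphic)
  then have "isCont (lam x) q"
    using D open_den_nonzero continuous_on_interior holomorphic_on_imp_continuous_on
    by (metis (mono_tags, lifting) interior_open mem_Collect_eq)
  moreover have "(G \<longlongrightarrow> G q) (at q)" using contG by (simp add: isCont_def)
  then have "(lam x \<longlongrightarrow> G q) (at q)" using G(2) by (rule Lim_transform_eventually)
  ultimately have "G q = lam x q"
    using tendsto_unique[OF at_neq_bot] by (metis isCont_def)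
  then have "\<forall>\<^sub>F z in nhds q. G z = lam x z" using G(2) by (simp add: eventually_nhds_conv_at)
  then have "deriv G q = deriv (lam x) q" by (rule deriv_cong_ev) simp
  then show "q \<in> {q. poly (crit x) q = 0}"
    using G(3) deriv_lam[OF x D] D scale_nonzero[OF x] by (simp add: poly_radical_eq_0_iff den_nonzero[OF x])
next
  have x: "x \<in> U" using gx by (rule generic_in_U)
  fix q assume q: "q \<in> {q. poly (crit x) q = 0}"
  then have D: "poly (den x) q \<noteq> 0" using den_crit_nonzero[OF gx] by simp
  have "lam x analytic_on {q}"
    using lam_holomorphic[of x] open_den_nonzero[of x] D by (auto simp: analytic_at)
  moreover have "deriv (lam x) q = 0" using deriv_lam[OF x D] q by simp
  ultimately show "q \<in> crit_points (lam x)"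
    using crit_nz[OF gx, of q] q by (auto simp: crit_points_def intro!: exI[of _ "lam x"])
qed

text \<open>By \<open>deriv_lam\<close> the form has a simple pole at \<open>q\<close>, coming from
  the critical polynomial alone. \<open>H\<close> is the product of \<open>pd\<close> terms, known
  to equal the holomorphic \<open>h\<close> only off the zeros of \<open>den x\<close>, which is
  enough for a residue.\<close>

lemma residue_generic:
  assumes gx: "generic x" and q: "poly (crit x) q = 0"
    and h: "h holomorphic_on {\<mu>. poly (den x) \<mu> \<noteq> 0}"
    and H: "\<And>\<mu>. poly (den x) \<mu> \<noteq> 0 \<Longrightarrow> H \<mu> = h \<mu>"
  shows "residue (\<lambda>\<mu>. H \<mu> / (\<mu>\<^sup>2 * deriv (lam x) \<mu>)) q = weight x q * h q"
proof -
  have x: "x \<in> U" using gx by (rule generic_in_U)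
  let ?S = "{\<mu>. poly (den x) \<mu> \<noteq> 0}"
  let ?f = "\<lambda>\<mu>. h \<mu> * poly (den x) \<mu> * poly (radical_poly (den x)) \<mu> / (x $ \<iota> 0 * \<mu>\<^sup>2)"
  have D: "q \<in> ?S" using den_crit_nonzero[OF gx q] by simp
  have "H \<mu> / (\<mu>\<^sup>2 * deriv (lam x) \<mu>) = ?f \<mu> / poly (crit x) \<mu>" if "\<mu> \<in> ?S" for \<mu>
    using that H[of \<mu>] deriv_lam[OF x, of \<mu>] by (simp add: field_simps)
  then have "\<forall>\<^sub>F \<mu> in at q. H \<mu> / (\<mu>\<^sup>2 * deriv (lam x) \<mu>) = ?f \<mu> / poly (crit x) \<mu>"
    using eventually_at_in_open'[OF open_den_nonzero D] by (auto elim: eventually_mono)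
  then have "residue (\<lambda>\<mu>. H \<mu> / (\<mu>\<^sup>2 * deriv (lam x) \<mu>)) q = residue (\<lambda>\<mu>. ?f \<mu> / poly (crit x) \<mu>) q"
    by (rule residue_cong) simp
  also have "?f holomorphic_on ?S"
    using scale_nonzero[OF x] den_0[OF x] by (auto intro!: holomorphic_intros h)
  then have "residue (\<lambda>\<mu>. ?f \<mu> / poly (crit x) \<mu>) q = ?f q / poly (pderiv (crit x)) q"
    by (rule residue_at_simple_root[OF open_den_nonzero D]) (use q crit_simple[OF gx q] in auto)
  finally show ?thesis by (simp add: weight_def)
qed

lemma metric_generic:
  assumes gx: "generic x"
  shows "g x $ i $ j = - (\<Sum>q|poly (crit x) q = 0. weight x q * (lam_d x i q * lam_d x j q))"
proof -
  have x: "x \<in> U" using gx by (rule generic_in_U)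
  have "g x $ i $ j = - (\<Sum>q\<in>crit_points (lam x).
                residue (\<lambda>\<mu>. pd i (\<lambda>y. lam y \<mu>) x * pd j (\<lambda>y. lam y \<mu>) x
                              / (\<mu>\<^sup>2 * deriv (lam x) \<mu>)) q)"
    using lg x unfolding landau_ginzburg_def lam_def[abs_def] by blast
  also have "\<dots> = - (\<Sum>q|poly (crit x) q = 0. weight x q * (lam_d x i q * lam_d x j q))"
    unfolding crit_points_generic[OF gx]
    by (intro arg_cong[where f = uminus] sum.cong refl residue_generic[OF gx])
      (auto intro!: holomorphic_intros lam_d_holomorphic simp: pd_lam[OF x])
  finally show ?thesis .
qed

lemma three_tensor_generic:
  assumes gx: "generic x"
  shows "three_tensor g C i j k x =
    - (\<Sum>q|poly (crit x) q = 0. weight x q * (lam_d x i q * lam_d x j q * lam_d x k q))"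
proof -
  have x: "x \<in> U" using gx by (rule generic_in_U)
  have "three_tensor g C i j k x = - (\<Sum>q\<in>crit_points (lam x).
                residue (\<lambda>\<mu>. pd i (\<lambda>y. lam y \<mu>) x * pd j (\<lambda>y. lam y \<mu>) x * pd k (\<lambda>y. lam y \<mu>) x
                              / (\<mu>\<^sup>2 * deriv (lam x) \<mu>)) q)"
    using lg x unfolding landau_ginzburg_def lam_def[abs_def] by blast
  also have "\<dots> = - (\<Sum>q|poly (crit x) q = 0. weight x q * (lam_d x i q * lam_d x j q * lam_d x k q))"
    unfolding crit_points_generic[OF gx]
    by (intro arg_cong[where f = uminus] sum.cong refl residue_generic[OF gx])
      (auto intro!: holomorphic_intros lam_d_holomorphic simp: pd_lam[OF x])
  finally show ?thesis .
qed

text \<open>The inner sum is the derivative of \<lambda> along \<open>v\<close> at \<open>q\<close>,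
  so the hypothesis says that \<open>v\<close> is orthogonal to all coordinate directions.\<close>

lemma metric_kernel:
  assumes gx: "generic x"
    and v: "\<And>i. (\<Sum>q|poly (crit x) q = 0. weight x q * lam_d x i q * (\<Sum>k\<in>UNIV. v $ k * lam_d x k q)) = 0"
  shows "v = 0"
proof (rule invertible_ker)
  show "invertible (g x)" using gx by (intro metric_nondegenerate generic_in_U)
  have "(g x *v v) $ i = 0" for i
  proof -
    have "(g x *v v) $ i = (\<Sum>k\<in>UNIV. - (\<Sum>q|poly (crit x) q = 0. weight x q * (lam_d x i q * lam_d x k q)) * v $ k)"
      by (simp add: matrix_vector_mult_def metric_generic[OF gx])
    also have "\<dots> = - (\<Sum>k\<in>UNIV. \<Sum>q|poly (crit x) q = 0. weight x q * lam_d x i q * (v $ k * lam_d x k q))"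
      unfolding sum_negf[symmetric] by (intro sum.cong refl) (simp add: sum_negf sum_distrib_left mult_ac)
    also have "\<dots> = - (\<Sum>q|poly (crit x) q = 0. weight x q * lam_d x i q * (\<Sum>k\<in>UNIV. v $ k * lam_d x k q))"
      by (subst sum.swap) (simp add: sum_distrib_left)
    finally show ?thesis using v by simp
  qed
  then show "g x *v v = 0" by (simp add: vec_eq_iff)
qed

lemma evaluation_inj:
  assumes "generic x" and "\<And>q. poly (crit x) q = 0 \<Longrightarrow> (\<Sum>k\<in>UNIV. v $ k * lam_d x k q) = 0"
  shows "v = 0"
  using assms by (intro metric_kernel) auto

text \<open>\<open>E(\<lambda>) = \<lambda>\<close> is given for almost all \<mu> and extends by
  continuity to the critical points. There \<open>w\<^sub>0\<close> times the derivative along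
  \<open>w\<^sub>0\<close> also yields \<lambda>, and \<open>evaluation_inj\<close> identifies the
  two vectors.\<close>

lemma euler_generic:
  assumes gx: "generic x"
  shows "E x = axis (\<iota> 0) (x $ \<iota> 0)"
proof -
  have x: "x \<in> U" using gx by (rule generic_in_U)
  have "E x - axis (\<iota> 0) (x $ \<iota> 0) = 0"
  proof (rule evaluation_inj[OF gx])
    fix q assume "poly (crit x) q = 0"
    then have D: "q \<in> {\<mu>. poly (den x) \<mu> \<noteq> 0}" using den_crit_nonzero[OF gx] by simp
    let ?F = "\<lambda>\<mu>. (\<Sum>i\<in>UNIV. E x $ i * lam_d x i \<mu>) - lam x \<mu>"
    have "\<forall>\<^sub>\<infinity>\<mu>. (\<Sum>i\<in>UNIV. E x $ i * pd i (\<lambda>y. lam y \<mu>) x) = lam x \<mu>"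
      using lg x unfolding landau_ginzburg_def lam_def[abs_def] by blast
    then have "\<forall>\<^sub>F \<mu> in at q. (\<Sum>i\<in>UNIV. E x $ i * pd i (\<lambda>y. lam y \<mu>) x) = lam x \<mu>"
      by (rule eventually_at_if_cofinite)
    with eventually_at_in_open'[OF open_den_nonzero D] have "\<forall>\<^sub>F \<mu> in at q. 0 = ?F \<mu>"
      by eventually_elim (simp add: pd_lam[OF x])
    then have "(?F \<longlongrightarrow> 0) (at q)"
      by (rule Lim_transform_eventually[OF tendsto_const])
    moreover have "?F holomorphic_on {\<mu>. poly (den x) \<mu> \<noteq> 0}"
      by (intro holomorphic_intros lam_d_holomorphic lam_holomorphic)
    then have "continuous_on {\<mu>. poly (den x) \<mu> \<noteq> 0} ?F" by (rule holomorphic_on_imp_continuous_on)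
    then have "isCont ?F q" using D continuous_on_eq_continuous_at[OF open_den_nonzero] by blast
    then have "(?F \<longlongrightarrow> ?F q) (at q)" unfolding isCont_def .
    ultimately have F: "?F q = 0" by (rule tendsto_unique[OF at_neq_bot, rotated])
    have "(\<Sum>k\<in>UNIV. (E x - axis (\<iota> 0) (x $ \<iota> 0)) $ k * lam_d x k q)
       = (\<Sum>k\<in>UNIV. E x $ k * lam_d x k q - (if k = \<iota> 0 then x $ \<iota> 0 * lam_d x (\<iota> 0) q else 0))"
      by (intro sum.cong) (auto simp: axis_def algebra_simps)
    also have "\<dots> = (\<Sum>k\<in>UNIV. E x $ k * lam_d x k q) - x $ \<iota> 0 * lam_d x (\<iota> 0) q"
      by (simp add: sum_subtractf)
    also have "x $ \<iota> 0 * lam_d x (\<iota> 0) q = lam x q"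
      by (simp add: lam_d_def lam_def label_iota zero_label)
    finally show "(\<Sum>k\<in>UNIV. (E x - axis (\<iota> 0) (x $ \<iota> 0)) $ k * lam_d x k q) = 0" using F by simp
  qed
  then show ?thesis by simp
qed

text \<open>\<open>good_dense\<close> moves only \<open>w\<^sub>1, \<dots>, w\<^sub>l\<close>, on
  which \<open>den\<close> does not depend, so the new point keeps its denominator. Dividing the
  radius by the dimension turns bounds on components into a bound on the norm.\<close>

lemma generic_dense:
  assumes "x \<in> U" "open W" "x \<in> W"
  shows "\<exists>y\<in>W. generic y"
proof -
  have "open (U \<inter> W)" using open_U assms by blast
  then obtain r where r: "r > 0" "ball x r \<subseteq> U \<inter> W" using assms by (meson Int_iff openE)
  let ?\<delta> = "r / real CARD('n)"
  have "?\<delta> > 0" using r by simp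
  from good_dense[OF den_nonzero den_0 degree_den this, OF assms(1) assms(1) assms(1), of "\<lambda>j. x $ \<iota> j"]
  obtain w where w: "\<And>j. j \<notin> int ` {1..l} \<Longrightarrow> w j = x $ \<iota> j"
    "\<And>j. cmod (w j - x $ \<iota> j) < ?\<delta>" "good l w (den x)" by blast
  define y where "y = (\<chi> i. w (label i))"
  have y: "y $ \<iota> j = w j" if "j \<in> \<Lambda>" for j using that by (simp add: y_def label_iota)
  have "cmod ((y - x) $ i) < ?\<delta>" for i
    using w(2)[of "label i"] by (simp add: y_def iota_label)
  then have "norm (y - x) < real CARD('n) * ?\<delta>" by (rule norm_vec_less_if_components)
  then have "y \<in> ball x r" by (simp add: dist_norm norm_minus_commute)
  then have yUW: "y \<in> U" "y \<in> W" using r by auto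
  have "den y = den x" using w(1) by (intro den_cong) (force simp: y)
  moreover have "good l (\<lambda>j. y $ \<iota> j) (den x) \<longleftrightarrow> good l w (den x)"
    by (rule good_cong) (simp add: y pos_label)
  ultimately show ?thesis using yUW w(3) by (auto simp: generic_def)
qed

lemma euler:
  assumes "x \<in> U"
  shows "E x $ k = (if k = \<iota> 0 then x $ \<iota> 0 else 0)"
proof (rule ccontr)
  assume ne: "E x $ k \<noteq> (if k = \<iota> 0 then x $ \<iota> 0 else 0)"
  let ?F = "\<lambda>y. E y $ k - (if k = \<iota> 0 then y $ \<iota> 0 else 0)"
  have "continuous_on U (\<lambda>y. E y $ k)" by (intro holo_on_imp_continuous_on holo_euler)
  then have "continuous_on U ?F" by (cases "k = \<iota> 0") (auto intro!: continuous_intros)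
  then have "open (?F -` (- {0}) \<inter> U)"
    using continuous_on_open_vimage[OF open_U] by blast
  moreover have "x \<in> ?F -` (- {0}) \<inter> U" using ne assms by auto
  ultimately obtain y where "y \<in> ?F -` (- {0}) \<inter> U" "generic y" using generic_dense[OF assms] by blast
  then show False using euler_generic[of y] by (auto simp: axis_def split: if_splits)
qed

text \<open>Scaling \<open>w\<^sub>0\<close> by \<open>s\<close> multiplies \<open>\<lambda>\<close> by \<open>s\<close>, and hence \<open>g\<^sub>i\<^sub>j\<close> by a power of \<open>s\<close>.\<close>

lemma charge_1:
  assumes "U \<noteq> {}"
  shows "d = 1"
proof -
  obtain x where gx: "generic x" using assms generic_dense[of _ UNIV] by blast
  then have x: "x \<in> U" by (rule generic_in_U)
  have "g x \<noteq> 0"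
  proof
    assume "g x = 0"
    then have "g x *v axis (\<iota> 0) 1 = 0" by (simp add: matrix_vector_mult_def vec_eq_iff)
    then have "axis (\<iota> 0) (1::complex) = 0" using invertible_ker[OF metric_nondegenerate[OF x]] by blast
    then show False by (simp add: axis_eq_0_iff)
  qed
  then obtain i j where gij: "g x $ i $ j \<noteq> 0" by (auto simp: vec_eq_iff)
  \<comment> \<open>Homogeneity in \<open>w\<^sub>0\<close>: the derivative of \<lambda> along
    \<open>w\<^sub>0\<close> has degree 0, all other derivatives have degree 1, and the weight has
    degree -1. \<open>n\<close> below records these degrees.\<close>
  define \<rho> where "\<rho> = (\<lambda>k::'n. \<lambda>s::complex. if k = \<iota> 0 then 1 else s)"
  let ?x0 = "x $ \<iota> 0" and ?z = "\<lambda>t. x + axis (\<iota> 0) t"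
  let ?s = "\<lambda>t. (x $ \<iota> 0 + t) / x $ \<iota> 0"
  have x0: "?x0 \<noteq> 0" using scale_nonzero[OF x] .
  have near: "\<forall>\<^sub>F t in nhds 0. ?z t \<in> U" by (rule eventually_axis_in_open[OF open_U x])
  have scaled: "g (?z t) $ i $ j = \<rho> i (?s t) * \<rho> j (?s t) / ?s t * g x $ i $ j" if t: "?z t \<in> U" for t
  proof -
    define s where "s = ?s t"
    have z0: "?z t $ \<iota> 0 = s * ?x0"
      using axis_component[OF zero_label zero_label] x0 by (simp add: s_def)
    have nz: "s \<noteq> 0" using scale_nonzero[OF t] z0 by auto
    have zk: "?z t $ \<iota> (int k) = x $ \<iota> (int k)" if "k \<in> {1..l}" for k
      using that axis_component[OF zero_label pos_label[OF that]] by simp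
    have den: "den (?z t) = den x" "den' (?z t) = den' x"
      using den_axis[OF zero_label] den'_axis[OF zero_label] by auto
    have Qz: "Q l (\<lambda>k. ?z t $ \<iota> k) \<mu> = Q l (\<lambda>k. x $ \<iota> k) \<mu>" for \<mu>
      by (rule Q_cong) (rule zk)
    have crit: "crit (?z t) = crit x"
      unfolding crit_poly_def den
      by (intro arg_cong2[where f = "(-)"] arg_cong2[where f = "(*)"] arg_cong[where f = pderiv] refl Q_poly_cong zk)
    have gz: "generic (?z t)"
      using gx t good_cong[of l "\<lambda>k. ?z t $ \<iota> k" "\<lambda>k. x $ \<iota> k" "den x"] zk den(1)
      unfolding generic_def by simp
    have label0: "label k = 0 \<longleftrightarrow> k = \<iota> 0" for k
      using iota_label[of k] label_iota[OF zero_label] by auto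
    have h: "lam_d (?z t) k q = \<rho> k s * lam_d x k q" for k q
      unfolding lam_d_def den Qz z0 \<rho>_def using label0[of k] by auto
    have w: "weight (?z t) q = weight x q / s" for q
      unfolding weight_def crit unfolding den z0 using x0 nz by (simp add: field_simps)
    show ?thesis
      unfolding s_def[symmetric] metric_generic[OF gz] metric_generic[OF gx] crit h w
      by (simp add: sum_distrib_left sum_divide_distrib mult_ac)
  qed
  define n where "n = (\<lambda>k::'n. if k = \<iota> 0 then 0 else 1::complex)"
  have "((\<lambda>t. \<rho> i (?s t) * \<rho> j (?s t) / ?s t * g x $ i $ j) has_field_derivative
      (n i + n j - 1) / ?x0 * g x $ i $ j) (at 0)"
  proof (rule DERIV_cong)
    have d\<rho>: "((\<lambda>t. \<rho> k (?s t)) has_field_derivative n k / ?x0) (at 0)" for k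
      unfolding \<rho>_def n_def using x0 by (cases "k = \<iota> 0") (auto intro!: derivative_eq_intros)
    have ds: "(?s has_field_derivative 1 / ?x0) (at 0)"
      using x0 by (auto intro!: derivative_eq_intros)
    have s0: "?s 0 \<noteq> 0" using x0 by simp
    show "((\<lambda>t. \<rho> i (?s t) * \<rho> j (?s t) / ?s t * g x $ i $ j) has_field_derivative
        ((n i / ?x0 * \<rho> j (?s 0) + n j / ?x0 * \<rho> i (?s 0)) * ?s 0 - \<rho> i (?s 0) * \<rho> j (?s 0) * (1 / ?x0))
          / (?s 0 * ?s 0) * g x $ i $ j) (at 0)"
      by (rule DERIV_cmult_right[OF DERIV_divide[OF DERIV_mult[OF d\<rho> d\<rho>] ds s0]])
    have "\<rho> k (?s 0) = 1" "?s 0 = 1" for k using x0 by (simp_all add: \<rho>_def)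
    then show "((n i / ?x0 * \<rho> j (?s 0) + n j / ?x0 * \<rho> i (?s 0)) * ?s 0 - \<rho> i (?s 0) * \<rho> j (?s 0) * (1 / ?x0))
          / (?s 0 * ?s 0) * g x $ i $ j = (n i + n j - 1) / ?x0 * g x $ i $ j"
      by (simp only: mult_1_right div_by_1 mult_1) (simp add: add_divide_distrib diff_divide_distrib)
  qed
  then have "((\<lambda>t. g (?z t) $ i $ j) has_field_derivative (n i + n j - 1) / ?x0 * g x $ i $ j) (at 0)"
    by (subst DERIV_cong_ev[OF refl _ refl]) (use near scaled in \<open>auto elim: eventually_mono\<close>)
  then have pd0: "pd (\<iota> 0) (\<lambda>y. g y $ i $ j) x = (n i + n j - 1) / ?x0 * g x $ i $ j"
    unfolding pd_def by (rule DERIV_imp_deriv)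
  have pdE: "pd k (\<lambda>y. E y $ m) x = (if k = \<iota> 0 \<and> m = \<iota> 0 then 1 else 0)" for k m
  proof -
    have "\<forall>\<^sub>F t in nhds 0. x + axis k t \<in> U" by (rule eventually_axis_in_open[OF open_U x])
    then have ev: "\<forall>\<^sub>F t in nhds 0. E (x + axis k t) $ m = (if m = \<iota> 0 then x $ \<iota> 0 + axis k t $ \<iota> 0 else 0)"
      by eventually_elim (simp add: euler)
    have "((\<lambda>t. if m = \<iota> 0 then x $ \<iota> 0 + axis k t $ \<iota> 0 else 0) has_field_derivative
        (if k = \<iota> 0 \<and> m = \<iota> 0 then 1 else 0)) (at 0)"
      by (cases "m = \<iota> 0"; cases "k = \<iota> 0") (auto intro!: derivative_eq_intros simp: axis_def)
    then have "((\<lambda>t. E (x + axis k t) $ m) has_field_derivative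
        (if k = \<iota> 0 \<and> m = \<iota> 0 then 1 else 0)) (at 0)"
      by (subst DERIV_cong_ev[OF refl ev refl])
    then show ?thesis unfolding pd_def by (rule DERIV_imp_deriv)
  qed
  have "lie_metric E g i j x = (\<Sum>k\<in>UNIV. if k = \<iota> 0 then
      ?x0 * pd (\<iota> 0) (\<lambda>y. g y $ i $ j) x + (if i = \<iota> 0 then g x $ \<iota> 0 $ j else 0)
      + (if j = \<iota> 0 then g x $ i $ \<iota> 0 else 0) else 0)"
    unfolding lie_metric_def by (intro sum.cong refl) (simp add: euler[OF x] pdE)
  \<comment> \<open>The last two terms come from differentiating the only non-zero component of
    \<open>E\<close>; they complete the degree of the metric coefficient to 1 for all
    \<open>i\<close> and \<open>j\<close>, so \<open>2 - d = 1\<close>.\<close>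
  also have "\<dots> = (n i + n j - 1) * g x $ i $ j + (1 - n i) * g x $ i $ j + (1 - n j) * g x $ i $ j"
    using x0 by (simp add: pd0) (simp add: n_def)
  also have "\<dots> = g x $ i $ j" by (simp add: algebra_simps)
  finally have "(2 - d) * g x $ i $ j = g x $ i $ j" using euler_metric[OF x, of i j] by simp
  then show ?thesis using gij by simp
qed

text \<open>The hypothesis bounds the number of critical points by the dimension, so that evaluation of
  \<open>\<partial>\<lambda>\<close> at the critical points is onto and identifies the product with the pointwise one.\<close>

lemma square_zero_generic:
  assumes gx: "generic x" and card: "l + card {z. poly (den x) z = 0} \<le> CARD('n)"
    and v: "tmult C x v v = 0"
  shows "v = 0"
proof (rule evaluation_inj[OF gx])
  have x: "x \<in> U" using gx by (rule generic_in_U)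
  let ?Z = "{q. poly (crit x) q = 0}"
  define A where "A = (\<lambda>v q. \<Sum>k\<in>UNIV. v $ k * lam_d x k q)"
  \<comment> \<open>Up to sign this is the pairing of \<open>v \<cdot> v\<close> with the direction
    \<open>k\<close>, expressed through values at the critical points.\<close>
  have ortho: "(\<Sum>q\<in>?Z. weight x q * (A v q)\<^sup>2 * lam_d x k q) = 0" for k
  proof -
    have "0 = (\<Sum>m\<in>UNIV. tmult C x v v $ m * g x $ m $ k)" by (simp add: v)
    also have "\<dots> = (\<Sum>m\<in>UNIV. \<Sum>i\<in>UNIV. \<Sum>j\<in>UNIV. v $ i * v $ j * (C x m i j * g x $ m $ k))"
      by (simp add: tmult_def sum_distrib_right sum_distrib_left mult_ac)
    also have "\<dots> = (\<Sum>i\<in>UNIV. \<Sum>j\<in>UNIV. v $ i * v $ j * three_tensor g C i j k x)"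
      by (subst sum.swap, rule sum.cong[OF refl], subst sum.swap) (simp add: three_tensor_def sum_distrib_left)
    also have "\<dots> = - (\<Sum>i\<in>UNIV. \<Sum>j\<in>UNIV. \<Sum>q\<in>?Z.
        weight x q * (v $ i * lam_d x i q) * (v $ j * lam_d x j q) * lam_d x k q)"
      by (simp add: three_tensor_generic[OF gx] sum_negf sum_distrib_left mult_ac)
    also have "(\<Sum>i\<in>UNIV. \<Sum>j\<in>UNIV. \<Sum>q\<in>?Z.
        weight x q * (v $ i * lam_d x i q) * (v $ j * lam_d x j q) * lam_d x k q)
      = (\<Sum>q\<in>?Z. \<Sum>i\<in>UNIV. \<Sum>j\<in>UNIV.
        weight x q * (v $ i * lam_d x i q) * (v $ j * lam_d x j q) * lam_d x k q)"
      by (subst (2) sum.swap, subst sum.swap) (rule refl)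
    also have "\<dots> = (\<Sum>q\<in>?Z. weight x q * (A v q)\<^sup>2 * lam_d x k q)"
      by (simp add: A_def power2_eq_square sum_distrib_left sum_distrib_right mult_ac)
    finally show ?thesis by simp
  qed
  fix q0 assume q0: "poly (crit x) q0 = 0"
  have "A v q0 = 0"
  proof (rule ccontr)
    assume ne: "A v q0 \<noteq> 0"
    have fin: "finite ?Z" using finite_crit[OF x] .
    have "card ?Z \<le> CARD('n)"
      using card_poly_roots_bound[OF crit_nonzero[OF x]] degree_crit[OF x] card by simp
    \<comment> \<open>Dropping \<open>q0\<close> leaves fewer conditions than unknowns, so some
      \<open>u \<noteq> 0\<close> has derivative vanishing at all other critical points. Pairing
      \<open>v \<cdot> v\<close> with \<open>u\<close> isolates the term at \<open>q0\<close> and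
      forces \<open>u = 0\<close>.\<close>
    then have "card (?Z - {q0}) < CARD('n)"
      using q0 fin by (metis (mono_tags, lifting) card_Diff1_less mem_Collect_eq order_less_le_trans)
    from homogeneous_system[OF finite_Diff[OF fin] finite_class.finite_UNIV this, of "\<lambda>q k. lam_d x k q"]
    obtain s where s: "\<exists>k. s k \<noteq> 0" "\<And>q. q \<in> ?Z - {q0} \<Longrightarrow> (\<Sum>k\<in>UNIV. lam_d x k q * s k) = 0"
      by blast
    define u where "u = (\<chi> k. s k)"
    have Au: "A u q = (\<Sum>k\<in>UNIV. lam_d x k q * s k)" for q
      by (simp add: A_def u_def mult.commute)
    have "0 = (\<Sum>k\<in>UNIV. s k * (\<Sum>q\<in>?Z. weight x q * (A v q)\<^sup>2 * lam_d x k q))" by (simp add: ortho)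
    also have "\<dots> = (\<Sum>q\<in>?Z. weight x q * (A v q)\<^sup>2 * A u q)"
      unfolding Au sum_distrib_left by (subst sum.swap) (simp add: mult_ac)
    also have "\<dots> = (\<Sum>q\<in>?Z. if q = q0 then weight x q0 * (A v q0)\<^sup>2 * A u q0 else 0)"
      by (intro sum.cong refl) (auto simp: Au s(2))
    also have "\<dots> = weight x q0 * (A v q0)\<^sup>2 * A u q0" using fin q0 by simp
    finally have "A u q0 = 0" using ne weight_nonzero[OF gx q0] by simp
    then have "A u q = 0" if "poly (crit x) q = 0" for q
      using that s(2)[of q] Au by (cases "q = q0") auto
    then have "u = 0" unfolding A_def by (rule evaluation_inj[OF gx])
    then show False using s(1) by (simp add: u_def vec_eq_iff)
  qed
  then show "(\<Sum>k\<in>UNIV. v $ k * lam_d x k q0) = 0" by (simp add: A_def)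
qed

lemma tmult_zero_right: "tmult C x v 0 = 0"
  by (simp add: tmult_def vec_eq_iff)

lemma tmult_power_mult:
  assumes "x \<in> U"
  shows "tmult C x ((tmult C x v ^^ a) v) ((tmult C x v ^^ b) v) = (tmult C x v ^^ (a + b + 1)) v"
  by (induction a) (simp_all add: product_assoc[OF assms])

text \<open>The last non-zero power of \<open>v\<close> has square zero, since powers add by
  \<open>tmult_power_mult\<close>; \<open>(L ^^ a) v\<close> is the power of exponent
  \<open>a + 1\<close>. Rescaling puts it on the unit sphere, where compactness is
  available.\<close>

lemma square_zero_if_nilpotent:
  assumes x: "x \<in> U" and v: "v \<noteq> 0" and nilpotent: "(tmult C x v ^^ N) v = 0"
  shows "\<exists>u. norm u = 1 \<and> tmult C x u u = 0"
proof -
  define L where "L = tmult C x v"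
  define n where "n = (LEAST n. (L ^^ n) v = 0)"
  have n: "(L ^^ n) v = 0" unfolding n_def L_def using nilpotent by (rule LeastI)
  then have "n \<noteq> 0" using v by (intro notI) simp
  then obtain a where a: "n = Suc a" by (cases n) auto
  have u: "(L ^^ a) v \<noteq> 0" using not_less_Least[of a "\<lambda>n. (L ^^ n) v = 0"] a unfolding n_def by simp
  have "(L ^^ (a + n)) v = (L ^^ a) 0" using n by (simp add: funpow_add)
  also have "\<dots> = 0" by (induction a) (simp_all add: L_def tmult_zero_right)
  finally have "tmult C x ((L ^^ a) v) ((L ^^ a) v) = 0"
    using tmult_power_mult[OF x, where v = v and a = a and b = a] a by (simp add: L_def)
  then have "tmult C x (r *\<^sub>R (L ^^ a) v) (r *\<^sub>R (L ^^ a) v) = 0" for r :: real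
  proof -
    have "tmult C x (r *\<^sub>R y) (r *\<^sub>R y) = (r * r) *\<^sub>R tmult C x y y" for y
      by (simp add: tmult_def vec_eq_iff scaleR_sum_right)
    then show ?thesis using \<open>tmult C x ((L ^^ a) v) ((L ^^ a) v) = 0\<close> by simp
  qed
  moreover have "norm ((1 / norm ((L ^^ a) v)) *\<^sub>R (L ^^ a) v) = 1" using u by simp
  ultimately show ?thesis by blast
qed

lemma semisimple:
  assumes card: "\<And>x. x \<in> U \<Longrightarrow> l + card {z. poly (den x) z = 0} \<le> CARD('n)"
  shows "semisimple U C"
proof -
  \<comment> \<open>The bad set is the projection to \<open>U\<close> of a closed subset of
    \<open>sphere 0 1 \<times> U\<close>; projecting along the compact factor keeps it closed in
    \<open>U\<close>.\<close>
  define B where "B = {x. \<exists>v. v \<in> sphere 0 1 \<and> (v, x) \<in> {(v, x). x \<in> U \<and> v \<in> sphere 0 1 \<and> tmult C x v v = 0}}"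
  have "continuous_on (sphere 0 1 \<times> U) (\<lambda>(v, x). tmult C x v v)"
    unfolding tmult_def case_prod_beta
  proof (intro continuous_intros)
    fix k i j
    show "continuous_on (sphere 0 1 \<times> U) (\<lambda>p. C (snd p) k i j)"
      by (rule continuous_on_compose2[OF holo_on_imp_continuous_on[OF holo_product]])
        (auto intro: continuous_intros)
  qed
  then have "closedin (top_of_set (sphere 0 1 \<times> U))
      (sphere 0 1 \<times> U \<inter> (\<lambda>(v, x). tmult C x v v) -` {0})"
    by (intro continuous_closedin_preimage) auto
  also have "sphere 0 1 \<times> U \<inter> (\<lambda>(v, x). tmult C x v v) -` {0}
      = {(v, x). x \<in> U \<and> v \<in> sphere 0 1 \<and> tmult C x v v = 0}" by auto
  finally have "closedin (top_of_set U) B"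
    unfolding B_def by (intro closedin_compact_projection compact_sphere)
  then have "openin (top_of_set U) (U - B)" by (intro openin_diff openin_subtopology_self)
  then have openV: "open (U - B)" using open_U openin_open_trans by blast
  moreover have "U \<subseteq> closure (U - B)"
  proof
    fix x assume x: "x \<in> U"
    show "x \<in> closure (U - B)" unfolding closure_iff_nhds_not_empty
    proof (intro allI impI)
      fix A V assume V: "V \<subseteq> A" "open V" "x \<in> V"
      from generic_dense[OF x V(2,3)] obtain y where y: "y \<in> V" "generic y" ..
      have "y \<notin> B"
      proof
        assume "y \<in> B"
        then obtain v where "norm v = 1" "tmult C y v v = 0" by (auto simp: B_def)
        then show False
          using square_zero_generic[OF y(2) card[OF generic_in_U[OF y(2)]], of v] by simp
      qed
      then show "(U - B) \<inter> A \<noteq> {}" using y(1) generic_in_U[OF y(2)] V(1) by auto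
    qed
  qed
  moreover have "v = 0" if "x \<in> U - B" "(tmult C x v ^^ N) v = 0" for x v N
  proof (rule ccontr)
    assume "v \<noteq> 0"
    from square_zero_if_nilpotent[OF _ this that(2)] that(1) obtain u
      where "norm u = 1" "tmult C x u u = 0" by blast
    then show False using that(1) by (auto simp: B_def)
  qed
  ultimately show ?thesis unfolding semisimple_def by (intro exI[of _ "U - B"]) blast
qed

end

section \<open>A gap in the exponents degenerates the metric\<close>

lemma order_0_eqI:
  fixes p :: "complex poly"
  assumes "\<And>k. k < n \<Longrightarrow> coeff p k = 0" "coeff p n \<noteq> 0"
  shows "order 0 p = n"
proof (rule antisym)
  have p: "p \<noteq> 0" using assms(2) by auto
  show "n \<le> order 0 p" using assms(1) by (simp flip: monom_1_dvd_iff[OF p] add: monom_1_dvd_iff')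
  show "order 0 p \<le> n"
  proof (rule ccontr)
    assume "\<not> order 0 p \<le> n"
    then have "monom 1 (Suc n) dvd p" by (simp add: monom_1_dvd_iff[OF p])
    then show False using assms(2) by (simp add: monom_1_dvd_iff')
  qed
qed

lemma simple_root_factorization:
  fixes D :: "complex poly"
  assumes D: "D \<noteq> 0" and simple: "\<And>z. z \<noteq> 0 \<Longrightarrow> poly D z = 0 \<Longrightarrow> order z D = 1"
  shows "D = smult (lead_coeff D) (monom 1 (order 0 D) * (\<Prod>z|z \<noteq> 0 \<and> poly D z = 0. [:-z, 1:]))"
    (is "_ = smult _ (_ * ?M)")
proof -
  let ?Z = "{z. z \<noteq> 0 \<and> poly D z = 0}"
  have fin: "finite ?Z" using poly_roots_finite[OF D] by (rule rev_finite_subset) auto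
  \<comment> \<open>The origin is inserted whether or not it is a root; otherwise its factor has
    exponent 0.\<close>
  have "(\<Prod>z|poly D z = 0. [:-z, 1:] ^ order z D) = (\<Prod>z\<in>insert 0 ?Z. [:-z, 1:] ^ order z D)"
    using fin by (intro prod.mono_neutral_left) (auto simp: order_0I)
  also have "\<dots> = [:0, 1:] ^ order 0 D * (\<Prod>z\<in>?Z. [:-z, 1:] ^ order z D)"
    using fin by simp
  also have "(\<Prod>z\<in>?Z. [:-z, 1:] ^ order z D) = ?M"
    by (intro prod.cong) (auto simp: simple)
  also have "[:0, 1::complex:] ^ order 0 D = monom 1 (order 0 D)" by (simp add: monom_altdef)
  finally show ?thesis using complex_poly_decompose[of D] by simp
qed

lemma card_simple_nonzero_roots:
  fixes D :: "complex poly"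
  assumes D: "D \<noteq> 0" and simple: "\<And>z. z \<noteq> 0 \<Longrightarrow> poly D z = 0 \<Longrightarrow> order z D = 1"
  shows "degree D = order 0 D + card {z. z \<noteq> 0 \<and> poly D z = 0}"
proof -
  let ?Z = "{z. z \<noteq> 0 \<and> poly D z = 0}"
  have fin: "finite ?Z" using poly_roots_finite[OF D] by (rule rev_finite_subset) auto
  have "degree D = degree (smult (lead_coeff D) (monom 1 (order 0 D) * (\<Prod>z\<in>?Z. [:-z, 1:])))"
    using simple_root_factorization[OF assms] by (rule arg_cong)
  also have "\<dots> = order 0 D + card ?Z"
    using D fin by (simp add: degree_mult_eq degree_monom_eq monom_eq_0_iff degree_prod_linear)
  finally show ?thesis .
qed

lemma pderiv_sum: "pderiv (\<Sum>i\<in>A. f i) = (\<Sum>i\<in>A. pderiv (f i :: complex poly))"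
  by (induction A rule: infinite_finite_induct) (simp_all add: pderiv_add)

context shift_lg
begin

text \<open>
  Let \<open>M\<close> be the monic polynomial with the non-zero roots of \<open>D\<close>, of degree \<open>r = b - a\<close>. For
  \<open>deg S \<le> r - 2\<close> the tangent vector \<open>v\<close> with \<open>\<partial>\<^sub>v \<lambda> = X\<^sup>a\<^sup>+\<^sup>1 S / D\<close> is orthogonal to all
  directions \<open>w\<^sub>0, \<dots>, w\<^sub>l\<close>, and its pairing with the direction of the coefficient \<open>i\<close> is a multiple of
  \<open>W\<^sub>i = \<Sum> S(z) z\<^sup>i / (z\<^sup>a\<^sup>+\<^sup>1 M'(z)\<^sup>2)\<close>, the sum ranging over the roots \<open>z\<close> of \<open>M\<close>. Among the
  equations \<open>W\<^sub>i = 0\<close> there are two relations, from \<open>D(z) = 0\<close> and from \<open>\<Sum> S(z) / M'(z) = 0\<close>, so only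
  \<open>card I - 2\<close> conditions are imposed on the \<open>r - 1\<close> coefficients of \<open>S\<close>.
\<close>

lemma exponents_consecutive:
  fixes I :: "nat set" and c :: "nat \<Rightarrow> complex"
  assumes gx: "generic x"
    and I: "finite I" "I \<subseteq> {a..b}" "a \<in> I" "b \<in> I" "1 \<le> a" "b \<le> l"
    and den: "den x = (\<Sum>i\<in>I. monom (c i) i)" and ca: "c a \<noteq> 0" and cb: "c b \<noteq> 0"
    and simple: "\<And>z. z \<noteq> 0 \<Longrightarrow> poly (den x) z = 0 \<Longrightarrow> order z (den x) = 1"
    and den': "\<And>j. j \<in> \<Lambda> \<Longrightarrow> j < 0 \<Longrightarrow> \<exists>\<gamma>. \<exists>i\<in>I. den' x j = monom \<gamma> i"
  shows "b - a < card I"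
proof (rule ccontr)
  assume "\<not> b - a < card I"
  then have cardI: "card I \<le> b - a" by simp
  have x: "x \<in> U" using gx by (rule generic_in_U)
  have "a \<noteq> b" using cardI I by (metis card_0_eq diff_self_eq_0 empty_iff le_zero_eq)
  moreover have "a \<le> b" using I by auto
  ultimately have ab: "a < b" by simp
  define r where "r = b - a"
  let ?D = "den x" and ?N = "radical_poly (den x)" and ?L = "log_deriv_num (den x)"
  let ?J = "crit x" and ?Q = "Q_poly l (\<lambda>j. x $ \<iota> j)"
  have D0: "?D \<noteq> 0" using den_nonzero[OF x] .
  have coeffD: "coeff ?D k = (if k \<in> I then c k else 0)" for k
    using I(1) by (simp add: den coeff_sum)
  have degD: "degree ?D = b"
  proof (rule antisym)
    show "degree ?D \<le> b" using I(2) by (intro degree_le) (auto simp: coeffD)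
    show "b \<le> degree ?D" using I cb by (intro le_degree) (simp add: coeffD)
  qed
  have ord0: "order 0 ?D = a" using I ca by (intro order_0_eqI) (auto simp: coeffD)
  define Z where "Z = {z. z \<noteq> 0 \<and> poly ?D z = 0}"
  define M where "M = (\<Prod>z\<in>Z. [:-z, 1:])"
  have R: "{z. poly ?D z = 0} = insert 0 Z" using den_0[OF x] by (auto simp: Z_def)
  have finZ: "finite Z" using poly_roots_finite[OF D0] R by simp
  have Z0: "0 \<notin> Z" by (simp add: Z_def)
  have N: "?N = monom 1 1 * M"
    unfolding radical_poly_def R M_def using finZ Z0 by (simp add: monom_Suc monom_0 one_pCons)
  have D: "?D = smult (c b) (monom 1 a * M)"
    using simple_root_factorization[OF D0 simple] I(4) by (simp add: M_def Z_def ord0 degD coeffD)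
  have M0: "M \<noteq> 0" using finZ by (simp add: M_def)
  have cardZ: "card Z = r"
    using card_simple_nonzero_roots[OF D0 simple] by (simp add: degD ord0 Z_def r_def)
  have degM: "degree M = r" using cardZ finZ by (simp add: M_def degree_prod_linear)
  have degJ: "degree ?J = l + 1 + r" using degree_crit[OF x] finZ Z0 cardZ by (simp add: R)
  have Mroot: "poly M z = 0 \<longleftrightarrow> z \<in> Z" for z using finZ by (auto simp: M_def poly_prod)
  have polyD: "poly ?D \<mu> = c b * (\<mu> ^ a * poly M \<mu>)" for \<mu> by (subst D) (simp add: poly_monom)
  have polyN: "poly ?N \<mu> = \<mu> * poly M \<mu>" for \<mu> by (subst N) (simp add: poly_monom)
  have D'z: "poly (pderiv ?D) z = c b * (z ^ a * poly (pderiv M) z)" if "z \<in> Z" for z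
    using that Mroot[of z] by (subst D) (simp add: pderiv_smult pderiv_mult poly_monom)
  \<comment> \<open>Evaluating \<open>L * D = D' * N\<close> at \<open>z\<close> would give
    \<open>0 = 0\<close>; hence \<open>N\<close> is first cancelled as a polynomial.\<close>
  have Lz: "poly ?L z = z * poly (pderiv M) z" if z: "z \<in> Z" for z
  proof -
    have "?L * ?D = pderiv ?D * ?N" using pderiv_mult_radical[OF D0] by simp
    then have "(smult (c b) (monom 1 (a - 1) * ?L)) * ?N = pderiv ?D * ?N"
    proof -
      have "monom 1 a = monom 1 (a - 1) * monom (1::complex) 1"
        using I(5) by (simp add: mult_monom)
      then have "?D = smult (c b) (monom 1 (a - 1) * ?N)"
        by (subst D) (simp only: N mult.assoc)
      then have "?L * ?D = ?L * smult (c b) (monom 1 (a - 1) * ?N)" by (rule arg_cong)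
      also have "\<dots> = (smult (c b) (monom 1 (a - 1) * ?L)) * ?N" by (simp add: mult_ac)
      finally have "?L * ?D = (smult (c b) (monom 1 (a - 1) * ?L)) * ?N" .
      then show ?thesis using \<open>?L * ?D = pderiv ?D * ?N\<close> by simp
    qed
    moreover have "?N \<noteq> 0" using M0 by (simp add: N monom_eq_0_iff)
    ultimately have "smult (c b) (monom 1 (a - 1) * ?L) = pderiv ?D" by (metis mult_right_cancel)
    then have "poly (smult (c b) (monom 1 (a - 1) * ?L)) z = poly (pderiv ?D) z" by simp
    then have "c b * (z ^ (a - 1) * poly ?L z) = c b * (z ^ a * poly (pderiv M) z)"
      by (simp add: poly_monom D'z[OF z])
    moreover have "z ^ a = z ^ (a - 1) * z" using I(5) by (metis power_minus_mult less_le_trans zero_less_one)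
    ultimately show ?thesis using cb z by (simp add: Z_def)
  qed
  have M': "poly (pderiv M) z \<noteq> 0" if z: "z \<in> Z" for z
    using poly_log_deriv_num_nonzero[OF D0, of z] Lz[OF z] z by (auto simp: Z_def)
  have Jz: "poly ?J z = poly ?Q z * (z * poly (pderiv M) z)" if z: "z \<in> Z" for z
    using poly_crit_poly_root[OF D0, of z l "\<lambda>j. x $ \<iota> j"] Lz[OF z] z by (simp add: Z_def poly_Q_poly)
  have Qz: "poly ?Q z \<noteq> 0" if z: "z \<in> Z" for z
    using gx z by (simp add: generic_def good_def Z_def poly_Q_poly)

  define S where "S = (\<lambda>s. \<Sum>k<r-1. monom (s k) k :: complex poly)"
  define W where "W = (\<lambda>s i. \<Sum>z\<in>Z. poly (S s) z * z ^ i / (z ^ (a + 1) * (poly (pderiv M) z)\<^sup>2))"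
  have degS: "degree (S s) \<le> r - 2" for s
    unfolding S_def by (intro degree_sum_le order_trans[OF degree_monom_le]) auto
  have ca_card: "card (I - {a, b}) < card {..<r - 1}"
  proof -
    have "card (I - {a, b}) = card I - 2" using I ab by (subst card_Diff_subset) auto
    moreover have "card {a, b} \<le> card I" using I by (intro card_mono) auto
    ultimately show ?thesis using cardI ab by (simp add: r_def)
  qed
  have r2: "2 \<le> r" using ca_card by simp
  obtain s where s: "\<exists>k<r-1. s k \<noteq> 0" "\<And>i. i \<in> I - {a, b} \<Longrightarrow>
      (\<Sum>k<r-1. (\<Sum>z\<in>Z. z ^ k * z ^ i / (z ^ (a + 1) * (poly (pderiv M) z)\<^sup>2)) * s k) = 0"
    using homogeneous_system[OF finite_Diff[OF I(1)] finite_lessThan ca_card,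
      of "\<lambda>i k. \<Sum>z\<in>Z. z ^ k * z ^ i / (z ^ (a + 1) * (poly (pderiv M) z)\<^sup>2)"] by auto
  have "W s i = (\<Sum>k<r-1. (\<Sum>z\<in>Z. z ^ k * z ^ i / (z ^ (a + 1) * (poly (pderiv M) z)\<^sup>2)) * s k)" for i
    unfolding W_def S_def poly_sum poly_monom sum_distrib_right sum_divide_distrib
    by (subst sum.swap) (simp add: mult_ac)
  then have W0: "W s i = 0" if "i \<in> I - {a, b}" for i using s(2)[OF that] by simp
  have "(\<Sum>i\<in>I. c i * W s i) = (\<Sum>z\<in>Z. poly (S s) z * poly ?D z / (z ^ (a + 1) * (poly (pderiv M) z)\<^sup>2))"
    unfolding W_def den poly_sum poly_monom sum_distrib_left sum_divide_distrib
    by (subst sum.swap) (simp add: mult_ac)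
  also have "\<dots> = 0" by (intro sum.neutral) (simp add: Z_def)
  finally have rel1: "(\<Sum>i\<in>I. c i * W s i) = 0" .
  \<comment> \<open>The factors \<open>of_nat i\<close> amount to applying \<open>X d/dX\<close> to
    \<open>D\<close>. At a root of \<open>M\<close> the result is
    \<open>c b * z ^ (a + 1) * M'(z)\<close>, which cancels the denominator down to
    \<open>M'(z)\<close>.\<close>
  have "(\<Sum>i\<in>I. of_nat i * c i * W s i)
      = (\<Sum>z\<in>Z. poly (S s) z * (z * poly (pderiv ?D) z) / (z ^ (a + 1) * (poly (pderiv M) z)\<^sup>2))"
  proof -
    have "z * poly (pderiv ?D) z = (\<Sum>i\<in>I. of_nat i * c i * z ^ i)" for z
    proof -
      have step: "z * (of_nat i * c i * z ^ (i - 1)) = of_nat i * c i * z ^ i" for i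
        by (cases i) (auto simp: mult_ac)
      have "z * poly (pderiv ?D) z = (\<Sum>i\<in>I. z * (of_nat i * c i * z ^ (i - 1)))"
        by (simp add: den pderiv_sum pderiv_monom poly_sum poly_monom sum_distrib_left)
      then show ?thesis by (simp only: step)
    qed
    then show ?thesis
      unfolding W_def sum_distrib_left sum_divide_distrib by (subst sum.swap) (simp add: mult_ac sum_distrib_left sum_divide_distrib)
  qed
  also have "\<dots> = (\<Sum>z\<in>Z. c b * (poly (S s) z / poly (pderiv M) z))"
  proof (intro sum.cong refl)
    fix z assume z: "z \<in> Z"
    then show "poly (S s) z * (z * poly (pderiv ?D) z) / (z ^ (a + 1) * (poly (pderiv M) z)\<^sup>2)
        = c b * (poly (S s) z / poly (pderiv M) z)"
      using M'[OF z] by (simp add: D'z[OF z] Z_def power2_eq_square field_simps)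
  qed
  also have "\<dots> = c b * (\<Sum>z|poly M z = 0. poly (S s) z / poly (pderiv M) z)"
    by (simp add: Mroot sum_distrib_left)
  also have "\<dots> = 0"
  proof -
    have "degree (S s) + 2 \<le> degree M" using degS[of s] degM r2 by simp
    from euler_jacobi[OF _ this] show ?thesis using Mroot M' by simp
  qed
  finally have rel2: "(\<Sum>i\<in>I. of_nat i * c i * W s i) = 0" .
  have two: "(\<Sum>i\<in>I. f i * W s i) = f a * W s a + f b * W s b" for f
  proof -
    have "(\<Sum>i\<in>I. f i * W s i) = (\<Sum>i\<in>{a, b}. f i * W s i)"
      using I W0 by (intro sum.mono_neutral_right) auto
    then show ?thesis using ab by simp
  qed
  \<comment> \<open>Only the end exponents remain, and the two relations between
    \<open>W s a\<close> and \<open>W s b\<close> have determinant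
    \<open>(b - a) * c a * c b\<close>.\<close>
  have W: "W s i = 0" if "i \<in> I" for i
  proof -
    have 1: "c a * W s a + c b * W s b = 0" using rel1 two[of c] by simp
    have 2: "of_nat a * (c a * W s a) + of_nat b * (c b * W s b) = 0"
      using rel2 two[of "\<lambda>i. of_nat i * c i"] by (simp add: mult.assoc)
    have "c a * W s a = - (c b * W s b)" using 1 by (simp add: add_eq_0_iff2)
    then have "(of_nat b - of_nat a) * (c b * W s b) = 0" using 2 by (simp add: algebra_simps)
    then have "W s b = 0" using ab cb by simp
    then have "W s a = 0" using 1 ca by simp
    then show ?thesis using that W0 \<open>W s b = 0\<close> by (cases "i = a \<or> i = b") auto
  qed

  \<comment> \<open>Chosen to cancel the factor \<open>- w\<^sub>0 * (-1) ^ j\<close> in the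
    derivative along \<open>w\<^sub>j\<close>. The labels \<open>a + 1, \<dots>, b - 1\<close> that
    occur are at most \<open>l\<close>.\<close>
  define \<tau> where "\<tau> = (\<lambda>k. - ((-1) ^ (a + 1 + k)) * s k / (x $ \<iota> 0))"
  define v where "v = (\<Sum>k<r-1. axis (\<iota> (int (a + 1 + k))) (\<tau> k))"
  have lab: "int (a + 1 + k) \<in> \<Lambda>" if "k < r - 1" for k
    using that I(6) by (intro pos_label) (auto simp: r_def)
  have Av: "(\<Sum>i\<in>UNIV. v $ i * lam_d x i q) = q ^ (a + 1) * poly (S s) q / poly ?D q" for q
  proof -
    have "(\<Sum>i\<in>UNIV. v $ i * lam_d x i q) =
      (\<Sum>k<r-1. \<Sum>i\<in>UNIV. axis (\<iota> (int (a + 1 + k))) (\<tau> k) $ i * lam_d x i q)"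
      unfolding v_def by (simp add: sum_distrib_right) (rule sum.swap)
    also have "\<dots> = (\<Sum>k<r-1. \<tau> k * lam_d x (\<iota> (int (a + 1 + k))) q)"
      by (intro sum.cong refl) (simp add: axis_def if_distrib[of "\<lambda>y. y * _"] cong: if_cong)
    also have "\<dots> = (\<Sum>k<r-1. q ^ (a + 1) * (s k * q ^ k) / poly ?D q)"
    proof (intro sum.cong refl)
      fix k assume "k \<in> {..<r-1}"
      then have l: "label (\<iota> (int (a + 1 + k))) = int (a + 1 + k)" using label_iota lab by simp
      have "lam_d x (\<iota> (int (a + 1 + k))) q = - (x $ \<iota> 0) * (-1) ^ (a + 1 + k) * q ^ (a + 1 + k) / poly ?D q"
        unfolding lam_d_def l nat_int by (simp del: power_Suc of_nat_add)
      moreover have "(-1) ^ (a + 1 + k) * (-1) ^ (a + 1 + k) = (1::complex)"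
        by (simp flip: power_mult_distrib)
      ultimately show "\<tau> k * lam_d x (\<iota> (int (a + 1 + k))) q = q ^ (a + 1) * (s k * q ^ k) / poly ?D q"
        using scale_nonzero[OF x] by (simp add: \<tau>_def power_add field_simps)
    qed
    also have "\<dots> = q ^ (a + 1) * poly (S s) q / poly ?D q"
      by (simp add: S_def poly_sum poly_monom sum_distrib_left sum_divide_distrib)
    finally show ?thesis .
  qed
  have v_k: "v $ \<iota> (int (a + 1 + k)) = \<tau> k" if k: "k < r - 1" for k
  proof -
    have "v $ \<iota> (int (a + 1 + k)) = (\<Sum>k'<r-1. axis (\<iota> (int (a + 1 + k'))) (\<tau> k') $ \<iota> (int (a + 1 + k)))"
      by (simp add: v_def)
    also have "\<dots> = (\<Sum>k'<r-1. if k' = k then \<tau> k else 0)"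
      by (intro sum.cong refl) (use lab k in \<open>auto simp: axis_component simp del: of_nat_add\<close>)
    finally show ?thesis using k by simp
  qed
  let ?crit = "{q. poly ?J q = 0}"
  \<comment> \<open>The exponent \<open>a + 1\<close> in the choice of \<open>v\<close> is made for
    this: with \<open>N = X * M\<close> and the \<open>q\<^sup>2\<close> in the weight, what remains
    is \<open>q ^ a * M(q)\<close>, that is \<open>D(q) / c b\<close>, and it cancels a denominator
    of \<open>lam_d\<close>.\<close>
  have weight: "weight x q * h * (q ^ (a + 1) * poly (S s) q / poly ?D q)
      = (q ^ a * poly M q * h) * poly (S s) q / (x $ \<iota> 0 * poly (pderiv ?J) q)"
    if "poly ?J q = 0" for q h
    using den_crit_nonzero[OF gx that] crit_nz[OF gx that] unfolding weight_def polyN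
    by (simp add: power2_eq_square field_simps)
  have qM: "q ^ a * poly M q = poly ?D q / c b" for q using cb by (simp add: polyD)
  have ej: "(\<Sum>q\<in>?crit. poly A q / poly (pderiv ?J) q) = 0" if "degree A + 2 \<le> degree ?J" for A
    by (rule euler_jacobi[OF crit_simple[OF gx] that])
  have "v = 0"
  proof (rule metric_kernel[OF gx], unfold Av)
    fix i
    consider "label i = 0" | "label i > 0" | "label i < 0" by linarith
    then show "(\<Sum>q\<in>?crit. weight x q * lam_d x i q * (q ^ (a + 1) * poly (S s) q / poly ?D q)) = 0"
    proof cases
      case 1
      have "(\<Sum>q\<in>?crit. weight x q * lam_d x i q * (q ^ (a + 1) * poly (S s) q / poly ?D q))
        = (\<Sum>q\<in>?crit. - 1 / (c b * x $ \<iota> 0) * (poly (?Q * S s) q / poly (pderiv ?J) q))"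
      proof (intro sum.cong refl)
        fix q assume "q \<in> ?crit"
        then have q: "poly ?J q = 0" by simp
        show "weight x q * lam_d x i q * (q ^ (a + 1) * poly (S s) q / poly ?D q)
          = - 1 / (c b * x $ \<iota> 0) * (poly (?Q * S s) q / poly (pderiv ?J) q)"
          unfolding weight[OF q] qM using 1 den_crit_nonzero[OF gx q] by (simp add: lam_d_def poly_Q_poly)
      qed
      \<comment> \<open>The degree is at most \<open>(l + 1) + (r - 2)\<close>, exactly two below
        that of the critical polynomial; this dictates the bound on the degree of
        \<open>S\<close>.\<close>
      also have "\<dots> = 0" unfolding sum_distrib_left[symmetric]
        using degree_mult_le[of ?Q "S s"] degS[of s] degree_Q_poly_le[of l "\<lambda>j. x $ \<iota> j"] degJ r2
        by (subst ej) auto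
      finally show ?thesis .
    next
      case 2
      let ?j = "nat (label i)"
      have j: "?j \<le> l" using label_in[of i] labels(2) by auto
      have "(\<Sum>q\<in>?crit. weight x q * lam_d x i q * (q ^ (a + 1) * poly (S s) q / poly ?D q))
        = (\<Sum>q\<in>?crit. - ((-1) ^ ?j) / c b * (poly (monom 1 ?j * S s) q / poly (pderiv ?J) q))"
      proof (intro sum.cong refl)
        fix q assume "q \<in> ?crit"
        then have q: "poly ?J q = 0" by simp
        show "weight x q * lam_d x i q * (q ^ (a + 1) * poly (S s) q / poly ?D q)
          = - ((-1) ^ ?j) / c b * (poly (monom 1 ?j * S s) q / poly (pderiv ?J) q)"
          unfolding weight[OF q] qM using 2 den_crit_nonzero[OF gx q] scale_nonzero[OF x]
          by (simp add: lam_d_def poly_monom)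
      qed
      also have "\<dots> = 0" unfolding sum_distrib_left[symmetric]
        using degree_mult_le[of "monom 1 ?j" "S s"] degS[of s] degree_monom_le[of "1::complex" ?j] degJ r2 j
        by (subst ej) auto
      finally show ?thesis .
    next
      case 3
      obtain \<gamma> i' where i': "i' \<in> I" "den' x (label i) = monom \<gamma> i'" using den'[OF label_in 3] by blast
      have ai: "a \<le> i'" "i' \<le> b" using i' I by auto
      \<comment> \<open>Here a factor \<open>M(q)\<close> stays in the denominator. Since
        \<open>M(q) * J'(q) = (M * J)'(q)\<close> at a root of \<open>J\<close>, Euler-Jacobi is
        applied to \<open>M * J\<close>; the additional roots, those of \<open>M\<close>, contribute
        \<open>W s i'\<close>.\<close>
      let ?A = "?Q * S s * monom 1 (i' - a)" and ?B = "M * ?J"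
      have "(\<Sum>q\<in>?crit. weight x q * lam_d x i q * (q ^ (a + 1) * poly (S s) q / poly ?D q))
        = (\<Sum>q\<in>?crit. \<gamma> / (c b)\<^sup>2 * (poly ?A q / poly (pderiv ?B) q))"
      proof (intro sum.cong refl)
        fix q assume "q \<in> ?crit"
        then have q: "poly ?J q = 0" by simp
        have D: "poly ?D q \<noteq> 0" using den_crit_nonzero[OF gx q] .
        then have nz: "q \<noteq> 0" "poly M q \<noteq> 0" using crit_nz[OF gx q] by (auto simp: polyD)
        have "q ^ i' = q ^ a * q ^ (i' - a)" using ai by (simp flip: power_add)
        then show "weight x q * lam_d x i q * (q ^ (a + 1) * poly (S s) q / poly ?D q)
          = \<gamma> / (c b)\<^sup>2 * (poly ?A q / poly (pderiv ?B) q)"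
          unfolding weight[OF q] lam_d_def i' using 3 q D nz scale_nonzero[OF x] cb
          by (simp add: polyD poly_monom poly_Q_poly pderiv_mult power2_eq_square field_simps)
      qed
      also have "\<dots> = \<gamma> / (c b)\<^sup>2 * (\<Sum>q\<in>?crit. poly ?A q / poly (pderiv ?B) q)"
        by (simp only: sum_distrib_left)
      also have "(\<Sum>q\<in>?crit. poly ?A q / poly (pderiv ?B) q) = 0"
      proof -
        have disj: "Z \<inter> ?crit = {}" using Jz Qz M' by (auto simp: Z_def)
        have roots: "{q. poly ?B q = 0} = Z \<union> ?crit" using Mroot by auto
        have "degree ?A + 2 \<le> degree ?B"
        proof -
          have "degree ?A \<le> l + 1 + (r - 2) + r"
            using degree_Q_poly_le[of l "\<lambda>j. x $ \<iota> j"] degS[of s] ai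
            by (intro order_trans[OF degree_mult_le] add_mono order_trans[OF degree_monom_le]) (auto simp: r_def)
          moreover have "degree ?B = r + (l + 1 + r)"
            using M0 crit_nonzero[OF x] by (simp add: degree_mult_eq degM degJ)
          ultimately show ?thesis using r2 by simp
        qed
        moreover have "poly (pderiv ?B) z \<noteq> 0" if "poly ?B z = 0" for z
        proof (cases "z \<in> Z")
          case True
          then show ?thesis using Jz[OF True] Qz[OF True] M'[OF True] Mroot[of z]
            by (simp add: pderiv_mult Z_def)
        next
          case False
          then have "poly ?J z = 0" "poly M z \<noteq> 0" using that Mroot by auto
          then show ?thesis using crit_simple[OF gx, of z] by (simp add: pderiv_mult)
        qed
        ultimately have "(\<Sum>q|poly ?B q = 0. poly ?A q / poly (pderiv ?B) q) = 0" by (intro euler_jacobi)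
        then have "(\<Sum>z\<in>Z. poly ?A z / poly (pderiv ?B) z) + (\<Sum>q\<in>?crit. poly ?A q / poly (pderiv ?B) q) = 0"
          unfolding roots sum.union_disjoint[OF finZ finite_crit[OF x] disj] .
        moreover have "(\<Sum>z\<in>Z. poly ?A z / poly (pderiv ?B) z) = W s i'"
          unfolding W_def
        proof (intro sum.cong refl)
          fix z assume z: "z \<in> Z"
          have "z ^ i' = z ^ a * z ^ (i' - a)" using ai by (simp flip: power_add)
          then show "poly ?A z / poly (pderiv ?B) z
              = poly (S s) z * z ^ i' / (z ^ (a + 1) * (poly (pderiv M) z)\<^sup>2)"
            using M'[OF z] Qz[OF z] z Mroot[of z]
            by (simp add: pderiv_mult Jz[OF z] poly_monom Z_def power2_eq_square field_simps)
        qed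
        ultimately show ?thesis using W[OF i'(1)] by simp
      qed
      finally show ?thesis by simp
    qed
  qed
  then have "\<tau> k = 0" if "k < r - 1" for k using v_k[OF that] by simp
  then show False using s(1) scale_nonzero[OF x] by (auto simp: \<tau>_def)
qed

end


section \<open>Charts and poles as coordinates\<close>

lemma pd_cong:
  assumes "open V" "x \<in> V" "\<And>y. y \<in> V \<Longrightarrow> f y = f' y"
  shows "pd i f x = pd i f' x"
  unfolding pd_def
  by (intro deriv_cong_ev eventually_mono[OF eventually_axis_in_open[OF assms(1,2)]] refl) (rule assms(3))

text \<open>Tensors and fields stay in the ambient coordinates: rewriting \<lambda> through a chart
  replaces it by an equal function of the point. Equality on an open set is what \<open>pd\<close>
  needs.\<close>

lemma landau_ginzburg_cong:
  assumes lg: "landau_ginzburg U lam g C e E" and V: "open V" "V \<subseteq> U"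
    and eq: "\<And>y. y \<in> V \<Longrightarrow> lam' y = lam y"
  shows "landau_ginzburg V lam' g C e E"
proof -
  have "pd i (\<lambda>y. lam' y \<mu>) x = pd i (\<lambda>y. lam y \<mu>) x" if "x \<in> V" for i x \<mu>
    using V(1) that by (rule pd_cong) (simp add: eq)
  then show ?thesis using lg V(2) unfolding landau_ginzburg_def by (simp add: eq subset_iff)
qed

section \<open>Holomorphic functions and polynomial coefficients\<close>

lemma holo_on_const: "holo_on U (\<lambda>x. c)"
  unfolding holo_on_def by (intro ballI exI[of _ "\<lambda>_. 0"]) auto

lemma holo_on_nth: "holo_on U (\<lambda>x. x $ i)"
  unfolding holo_on_def
  by (intro ballI exI[of _ "\<lambda>v. v $ i"]) (auto intro: bounded_linear_imp_has_derivative bounded_linear_vec_nth)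

lemma holo_on_add:
  assumes "holo_on U f" "holo_on U h"
  shows "holo_on U (\<lambda>x. f x + h x)"
  unfolding holo_on_def
proof
  fix x assume x: "x \<in> U"
  obtain F where F: "(f has_derivative F) (at x)" "\<And>c v. F (c *s v) = c * F v"
    using assms(1) x by (auto simp: holo_on_def)
  obtain H where H: "(h has_derivative H) (at x)" "\<And>c v. H (c *s v) = c * H v"
    using assms(2) x by (auto simp: holo_on_def)
  show "\<exists>D. ((\<lambda>x. f x + h x) has_derivative D) (at x) \<and> (\<forall>c v. D (c *s v) = c * D v)"
    using has_derivative_add[OF F(1) H(1)] by (intro exI[of _ "\<lambda>v. F v + H v"]) (auto simp: F H algebra_simps)
qed

lemma holo_on_mult:
  assumes "holo_on U f" "holo_on U h"
  shows "holo_on U (\<lambda>x. f x * h x)"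
  unfolding holo_on_def
proof
  fix x assume x: "x \<in> U"
  obtain F where F: "(f has_derivative F) (at x)" "\<And>c v. F (c *s v) = c * F v"
    using assms(1) x by (auto simp: holo_on_def)
  obtain H where H: "(h has_derivative H) (at x)" "\<And>c v. H (c *s v) = c * H v"
    using assms(2) x by (auto simp: holo_on_def)
  show "\<exists>D. ((\<lambda>x. f x * h x) has_derivative D) (at x) \<and> (\<forall>c v. D (c *s v) = c * D v)"
    using has_derivative_mult[OF F(1) H(1)]
    by (intro exI[of _ "\<lambda>v. f x * H v + F v * h x"]) (auto simp: F H algebra_simps)
qed

lemma holo_on_sum: "(\<And>i. i \<in> A \<Longrightarrow> holo_on U (f i)) \<Longrightarrow> holo_on U (\<lambda>x. \<Sum>i\<in>A. f i x)"
  by (induction A rule: infinite_finite_induct) (auto intro: holo_on_const holo_on_add)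

lemma holo_on_coeff_mult:
  assumes "\<And>n. holo_on U (\<lambda>x. coeff (p x) n)" "\<And>n. holo_on U (\<lambda>x. coeff (q x) n)"
  shows "holo_on U (\<lambda>x. coeff (p x * q x) n)"
  unfolding coeff_mult by (intro holo_on_sum holo_on_mult assms)

lemma holo_on_coeff_prod:
  assumes "\<And>a n. a \<in> A \<Longrightarrow> holo_on U (\<lambda>x. coeff (p a x) n)"
  shows "holo_on U (\<lambda>x. coeff (\<Prod>a\<in>A. p a x) n)"
  using assms
proof (induction A arbitrary: n rule: infinite_finite_induct)
  case (insert a A)
  then show ?case by (simp add: holo_on_coeff_mult)
qed (simp_all add: holo_on_const)

lemma holo_on_coeff_power:
  assumes "\<And>n. holo_on U (\<lambda>x. coeff (p x) n)"
  shows "holo_on U (\<lambda>x. coeff (p x ^ k) n)"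
proof (induction k arbitrary: n)
  case (Suc k)
  then show ?case by (simp add: holo_on_coeff_mult assms)
qed (simp add: holo_on_const)

lemma holo_on_coeff_linear: "holo_on U (\<lambda>x. coeff [:- (x $ i), 1:] n)"
proof -
  have "holo_on U (\<lambda>x. (-1) * x $ i)" by (intro holo_on_mult holo_on_const holo_on_nth)
  then show ?thesis by (cases n) (simp_all add: coeff_pCons holo_on_const split: nat.split)
qed

lemma holo_on_coeff_pole_poly: "holo_on U (\<lambda>x. coeff (pole_poly k m (\<lambda>j. x $ \<iota> j)) n)"
  unfolding pole_poly_def
  by (intro holo_on_coeff_mult holo_on_coeff_prod holo_on_coeff_power holo_on_coeff_linear holo_on_const)

text \<open>The map is its own inverse because \<open>s * s = 1\<close>. It serves to absorb a sign
  into \<open>w\<^sub>0\<close>.\<close>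

lemma local_chart_scaling:
  fixes s :: complex and U :: "(complex ^ 'n) set" and k :: 'n
  assumes U: "open U" and s: "s * s = 1"
  shows "local_chart U (\<lambda>x. \<chi> i. if i = k then s * x $ i else x $ i)"
proof -
  let ?\<psi> = "\<lambda>x::complex ^ 'n. \<chi> i. if i = k then s * x $ i else x $ i"
  have invol: "?\<psi> (?\<psi> x) = x" for x
    using s by (simp add: vec_eq_iff flip: mult.assoc)
  have holo: "holo_on V (\<lambda>x. ?\<psi> x $ i)" for V i
    by (cases "i = k") (simp_all add: holo_on_nth holo_on_mult holo_on_const)
  have cont: "continuous_on UNIV ?\<psi>"
    by (intro continuous_on_vec_lambda) (use holo[of UNIV] in \<open>auto dest: holo_on_imp_continuous_on\<close>)
  have "?\<psi> ` U = ?\<psi> -` U"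
  proof (intro equalityI subsetI)
    fix y assume "y \<in> ?\<psi> -` U"
    then have "?\<psi> y \<in> U" by (rule vimageD)
    then have "?\<psi> (?\<psi> y) \<in> ?\<psi> ` U" by (rule imageI)
    then show "y \<in> ?\<psi> ` U" unfolding invol .
  next
    fix y assume "y \<in> ?\<psi> ` U"
    then obtain x where "x \<in> U" "y = ?\<psi> x" by (rule imageE)
    then show "y \<in> ?\<psi> -` U" using invol[of x] by (simp only: vimage_eq)
  qed
  then have "open (?\<psi> ` U)" using open_vimage[OF U cont] by simp
  then show ?thesis unfolding local_chart_def
    by (intro conjI allI U holo exI[of _ ?\<psi>] ballI invol)
qed

section \<open>The families with poles as coordinates\<close>

lemma poly_pole_poly: "poly (pole_poly k m w) \<mu> = \<mu> ^ k * (\<Prod>\<alpha> = 1..length m. (\<mu> - w (- int \<alpha>)) ^ (m ! (\<alpha> - 1)))"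
  by (simp add: pole_poly_def poly_monom poly_prod)

lemma pole_poly_nonzero: "pole_poly k m w \<noteq> 0"
  by (simp add: pole_poly_def monom_eq_0_iff)

lemma minus_one_power_square: "(-1) ^ n * (-1) ^ n = (1::complex)"
  by (simp flip: power_mult_distrib)

text \<open>The family has the required shape up to the sign \<open>- (-1) ^ (k + p)\<close>, which
  one global chart absorbs into \<open>w\<^sub>0\<close>. The interval and the partition are given,
  so the content is semisimplicity and the charge.\<close>

lemma pole_case:
  fixes l p k :: nat and U :: "(complex ^ 'n) set"
  assumes l: "I \<subseteq> {1..l}" and I: "I = {k..k + p}" and m: "is_partition m p"
    and bij: "bij_betw \<iota> (pole_labels l m) (UNIV :: 'n set)"
    and U: "U \<subseteq> pole_space m \<iota>" "pole_space m \<iota> \<subseteq> closure U"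
    and frob: "frobenius_manifold U g C e E d"
    and lg: "landau_ginzburg U (pole_lambda l k m \<iota>) g C e E"
  shows "k \<in> {1..l - p} \<and> semisimple U C \<and> CARD('n) = l + 1 + length m \<and> d = 1 \<and>
           bij_betw \<iota> {- int (length m)..int l} (UNIV :: 'n set) \<and>
              (\<forall>x\<in>U. \<exists>V w. x \<in> V \<and> V \<subseteq> U \<and> local_chart V w \<and>
                 landau_ginzburg V
                   (\<lambda>y \<mu>. w y $ \<iota> 0 * Q l (\<lambda>j. w y $ \<iota> j) \<mu> /
                      (\<mu> ^ k * (\<Prod>\<alpha> = 1..length m. (\<mu> - w y $ \<iota> (- int \<alpha>)) ^ (m ! (\<alpha> - 1)))))
                   g C e E)"
proof -
  have sum: "sum_list m = p" using m by (simp add: is_partition_def)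
  have "k \<in> I" "k + p \<in> I" using I by auto
  then have k: "1 \<le> k" "k + p \<le> l" using l by auto
  let ?n = "length m" and ?\<epsilon> = "(-1) ^ (k + p) :: complex"
  define W where "W = (\<lambda>(x :: complex ^ 'n) j. x $ \<iota> j)"
  define den where "den = (\<lambda>x. smult ?\<epsilon> (pole_poly k m (W x)))"
  define fac where "fac = (\<lambda>x \<beta>. [:- W x (- int \<beta>), 1:] ^ (m ! (\<beta> - 1)))"
  \<comment> \<open>The value 0 outside the pole labels makes \<open>den' x\<close> depend on the
    pole coordinates alone, as \<open>den'_cong\<close> requires of it as a function of
    \<open>j\<close>.\<close>
  define den' where "den' = (\<lambda>x j. if j \<in> {- int ?n..-1} then
    smult ?\<epsilon> (monom 1 k * (\<Prod>\<beta>\<in>{1..?n} - {nat (- j)}. fac x \<beta>) *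
    smult (- of_nat (m ! (nat (- j) - 1))) ([:- W x j, 1:] ^ (m ! (nat (- j) - 1) - 1))) else 0)"
  have lam: "pole_lambda l k m \<iota> = (\<lambda>x \<mu>. - (x $ \<iota> 0) * Q l (\<lambda>j. x $ \<iota> j) \<mu> / poly (den x) \<mu>)"
    using shift_den_pole_f[of k m] by (intro ext) (simp add: pole_lambda_def shift_lambda_def den_def W_def sum)
  interpret shift_lg l "pole_labels l m" \<iota> U den den' g C e E d
  proof (rule shift_lg.intro)
    show "bij_betw \<iota> (pole_labels l m) UNIV" by fact
    show "{0..int l} \<subseteq> pole_labels l m" "pole_labels l m \<subseteq> {..int l}" by (auto simp: pole_labels_def)
    show "x $ \<iota> 0 \<noteq> 0" if "x \<in> U" for x using that U by (auto simp: pole_space_def)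
    show "den x \<noteq> 0" for x by (simp add: den_def pole_poly_nonzero)
    show "poly (den x) 0 = 0" for x using k by (simp add: den_def poly_pole_poly)
    show "degree (den x) \<le> l" for x using k by (simp add: den_def degree_pole_poly sum)
    show "frobenius_manifold U g C e E d" by fact
    show "landau_ginzburg U (\<lambda>x \<mu>. - (x $ \<iota> 0) * Q l (\<lambda>j. x $ \<iota> j) \<mu> / poly (den x) \<mu>) g C e E"
      using lg unfolding lam .
  next
    fix x y :: "complex ^ 'n" assume eq: "\<And>j. j \<in> pole_labels l m \<Longrightarrow> j < 0 \<Longrightarrow> x $ \<iota> j = y $ \<iota> j"
    then have W: "W x (- int \<beta>) = W y (- int \<beta>)" if "\<beta> \<in> {1..?n}" for \<beta>
      using that by (auto simp: W_def pole_labels_def)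
    then show "den x = den y" unfolding den_def pole_poly_def
      by (intro arg_cong2[where f = smult] arg_cong2[where f = "(*)"] prod.cong refl) auto
  next
    fix x y :: "complex ^ 'n" assume eq: "\<And>j. j \<in> pole_labels l m \<Longrightarrow> j < 0 \<Longrightarrow> x $ \<iota> j = y $ \<iota> j"
    have W: "W x j = W y j" if "j \<in> {- int ?n..-1}" for j
      using that eq[of j] by (auto simp: W_def pole_labels_def)
    then have "fac x \<beta> = fac y \<beta>" if "\<beta> \<in> {1..?n}" for \<beta>
      using that by (simp add: fac_def)
    with W show "den' x = den' y"
      unfolding den'_def by (intro ext if_cong refl arg_cong2[where f = smult] arg_cong2[where f = "(*)"] prod.cong) auto
  next
    fix x j \<mu> assume x: "x \<in> U" and j: "j \<in> pole_labels l m" "j < 0"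
    define \<alpha> where "\<alpha> = nat (- j)"
    have \<alpha>: "\<alpha> \<in> {1..?n}" "j = - int \<alpha>" using j by (auto simp: \<alpha>_def pole_labels_def)
    have comp: "W (x + axis (\<iota> j) t) (- int \<beta>) = W x (- int \<beta>) + (if \<beta> = \<alpha> then t else 0)"
      if "\<beta> \<in> {1..?n}" for t \<beta>
    proof -
      have "- int \<beta> \<in> pole_labels l m" using that by (simp add: pole_labels_def)
      then have "\<iota> (- int \<beta>) = \<iota> j \<longleftrightarrow> - int \<beta> = j"
        using bij_betw_imp_inj_on[OF bij] j(1) by (auto dest: inj_onD)
      then show ?thesis using \<alpha> by (auto simp: W_def axis_def)
    qed
    have split: "poly (den (x + axis (\<iota> j) t)) \<mu> = ?\<epsilon> * (\<mu> ^ k * (\<Prod>\<beta>\<in>{1..?n} - {\<alpha>}. poly (fac x \<beta>) \<mu>)) *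
        (\<mu> - (W x j + t)) ^ (m ! (\<alpha> - 1))" for t
    proof -
      have "(\<Prod>\<beta> = 1..?n. (\<mu> - W (x + axis (\<iota> j) t) (- int \<beta>)) ^ (m ! (\<beta> - 1)))
         = (\<mu> - (W x j + t)) ^ (m ! (\<alpha> - 1)) *
           (\<Prod>\<beta>\<in>{1..?n} - {\<alpha>}. (\<mu> - W (x + axis (\<iota> j) t) (- int \<beta>)) ^ (m ! (\<beta> - 1)))"
        using comp[OF \<alpha>(1)] \<alpha>(2) by (subst prod.remove[OF _ \<alpha>(1)]) auto
      also have "(\<Prod>\<beta>\<in>{1..?n} - {\<alpha>}. (\<mu> - W (x + axis (\<iota> j) t) (- int \<beta>)) ^ (m ! (\<beta> - 1)))
          = (\<Prod>\<beta>\<in>{1..?n} - {\<alpha>}. poly (fac x \<beta>) \<mu>)"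
        by (intro prod.cong refl) (simp add: comp fac_def)
      finally show ?thesis unfolding den_def by (simp only: poly_smult poly_pole_poly) (simp only: mult_ac)
    qed
    have poly': "poly (den' x j) \<mu> = ?\<epsilon> * (\<mu> ^ k * (\<Prod>\<beta>\<in>{1..?n} - {\<alpha>}. poly (fac x \<beta>) \<mu>)) *
        (- of_nat (m ! (\<alpha> - 1)) * (\<mu> - W x j) ^ (m ! (\<alpha> - 1) - 1))"
      using \<alpha> unfolding den'_def \<alpha>_def[symmetric] by (simp add: poly_prod poly_monom)
    have "((\<lambda>t. (\<mu> - (W x j + t)) ^ (m ! (\<alpha> - 1))) has_field_derivative
        - of_nat (m ! (\<alpha> - 1)) * (\<mu> - W x j) ^ (m ! (\<alpha> - 1) - 1)) (at 0)"
      by (auto intro!: derivative_eq_intros)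
    then show "((\<lambda>t. poly (den (x + axis (\<iota> j) t)) \<mu>) has_field_derivative poly (den' x j) \<mu>) (at 0)"
      unfolding split poly' by (rule DERIV_cmult)
  qed
  have card_n: "CARD('n) = l + 1 + ?n"
    using bij_betw_same_card[OF bij] by (simp add: pole_labels_def)
  \<comment> \<open>Multiplicities do not matter here: the distinct zeros are 0 and at most one per
    pole coordinate.\<close>
  have "l + card {z. poly (den x) z = 0} \<le> CARD('n)" for x
  proof -
    have "{z. poly (den x) z = 0} \<subseteq> insert 0 ((\<lambda>\<beta>. W x (- int \<beta>)) ` {1..?n})"
      by (auto simp: den_def poly_pole_poly)
    then have "card {z. poly (den x) z = 0} \<le> card (insert 0 ((\<lambda>\<beta>. W x (- int \<beta>)) ` {1..?n}))"
      by (intro card_mono) auto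
    also have "\<dots> \<le> Suc (card ((\<lambda>\<beta>. W x (- int \<beta>)) ` {1..?n}))" by (rule card_insert_le_m1) auto
    also have "\<dots> \<le> Suc ?n" using card_image_le[of "{1..?n}" "\<lambda>\<beta>. W x (- int \<beta>)"] by simp
    finally show ?thesis using card_n by simp
  qed
  then have ss: "semisimple U C" by (rule semisimple)
  have "U \<noteq> {}"
  proof -
    \<comment> \<open>A point with poles \<open>-1, \<dots>, - length m\<close>, distinct and
      non-zero.\<close>
    define x0 :: "complex ^ 'n" where "x0 = (\<chi> i. let j = inv_into (pole_labels l m) \<iota> i in if j < 0 then of_int j else 1)"
    have "x0 $ \<iota> j = (if j < 0 then of_int j else 1)" if "j \<in> pole_labels l m" for j
      using bij_betw_inv_into_left[OF bij that] by (simp add: x0_def)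
    then have "x0 \<in> pole_space m \<iota>"
      by (auto simp: pole_space_def pole_labels_def inj_on_def)
    then show ?thesis using U(2) by auto
  qed
  then have d: "d = 1" by (rule charge_1)
  define w where "w = (\<lambda>x :: complex ^ 'n. \<chi> i. if i = \<iota> 0 then - ?\<epsilon> * x $ i else x $ i)"
  have chart: "local_chart U w"
    unfolding w_def by (rule local_chart_scaling[OF open_U]) (simp add: minus_one_power_square)
  have wj: "w y $ \<iota> j = y $ \<iota> j" if "j \<in> pole_labels l m" "j \<noteq> 0" for y j
    using that iota_eq_iff[OF that(1) zero_label] by (simp add: w_def)
  have "landau_ginzburg U
                   (\<lambda>y \<mu>. w y $ \<iota> 0 * Q l (\<lambda>j. w y $ \<iota> j) \<mu> /
                      (\<mu> ^ k * (\<Prod>\<alpha> = 1..length m. (\<mu> - w y $ \<iota> (- int \<alpha>)) ^ (m ! (\<alpha> - 1)))))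
                   g C e E"
  proof (rule landau_ginzburg_cong[OF lg open_U subset_refl], rule ext)
    fix y \<mu> assume "y \<in> U"
    have 1: "Q l (\<lambda>j. w y $ \<iota> j) \<mu> = Q l (\<lambda>j. y $ \<iota> j) \<mu>"
      by (rule Q_cong) (simp add: wj pos_label)
    have 2: "(\<Prod>\<alpha> = 1..length m. (\<mu> - w y $ \<iota> (- int \<alpha>)) ^ (m ! (\<alpha> - 1)))
        = (\<Prod>\<alpha> = 1..length m. (\<mu> - W y (- int \<alpha>)) ^ (m ! (\<alpha> - 1)))"
      by (intro prod.cong refl) (simp add: wj pole_labels_def W_def)
    have 3: "w y $ \<iota> 0 = - ?\<epsilon> * y $ \<iota> 0" by (simp add: w_def)
    have "?\<epsilon> * c / a = c / (?\<epsilon> * a)" for a c :: complex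
      using minus_one_power_square[of "k + p"] by (simp add: divide_simps)
    then show "w y $ \<iota> 0 * Q l (\<lambda>j. w y $ \<iota> j) \<mu> /
                      (\<mu> ^ k * (\<Prod>\<alpha> = 1..length m. (\<mu> - w y $ \<iota> (- int \<alpha>)) ^ (m ! (\<alpha> - 1))))
        = - (y $ \<iota> 0) * Q l (\<lambda>j. y $ \<iota> j) \<mu> / poly (den y) \<mu>"
      unfolding 1 2 3 den_def poly_smult poly_pole_poly by (simp add: mult.assoc)
  qed
  then have "\<forall>x\<in>U. \<exists>V w. x \<in> V \<and> V \<subseteq> U \<and> local_chart V w \<and>
                 landau_ginzburg V
                   (\<lambda>y \<mu>. w y $ \<iota> 0 * Q l (\<lambda>j. w y $ \<iota> j) \<mu> /
                      (\<mu> ^ k * (\<Prod>\<alpha> = 1..length m. (\<mu> - w y $ \<iota> (- int \<alpha>)) ^ (m ! (\<alpha> - 1)))))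
                   g C e E"
    using chart by blast
  then show ?thesis using k ss card_n d bij unfolding pole_labels_def by simp
qed

section \<open>Holomorphic local inverses\<close>

lemma holo_on_subset: "holo_on U f \<Longrightarrow> V \<subseteq> U \<Longrightarrow> holo_on V f"
  unfolding holo_on_def by blast

lemma has_derivative_vec_componentwise:
  fixes f :: "complex ^ 'n \<Rightarrow> complex ^ 'n"
  assumes "\<And>i. ((\<lambda>x. f x $ i) has_derivative (\<lambda>v. F v $ i)) (at y)"
  shows "(f has_derivative F) (at y)"
proof -
  have sum: "u = (\<Sum>i\<in>UNIV. axis i (u $ i))" for u :: "complex ^ 'n"
    by (simp add: vec_eq_iff axis_def)
  have bl: "bounded_linear (axis i :: complex \<Rightarrow> complex ^ 'n)" for i
    by (intro linear_conv_bounded_linear[THEN iffD1] linearI) (auto simp: axis_def vec_eq_iff)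
  have "((\<lambda>x. \<Sum>i\<in>UNIV. axis i (f x $ i)) has_derivative (\<lambda>v. \<Sum>i\<in>UNIV. axis i (F v $ i))) (at y)"
    by (rule has_derivative_sum, rule bounded_linear.has_derivative[OF bl assms])
  then show ?thesis unfolding sum[symmetric] .
qed

text \<open>Injectivity on \<open>B\<close> is assumed, so openness comes from invariance of domain.
  A left inverse of the derivative is a full inverse in finite dimension, and surjectivity of
  \<open>F\<close> transfers complex homogeneity to it.\<close>

lemma holomorphic_local_inverse:
  fixes \<Theta> :: "complex ^ 'n \<Rightarrow> complex ^ 'n"
  assumes B: "open B" and inj: "inj_on \<Theta> B"
    and der: "\<And>y. y \<in> B \<Longrightarrow> \<exists>F. (\<Theta> has_derivative F) (at y) \<and>
      (\<forall>c v. F (c *s v) = c *s F v) \<and> (\<forall>v. F v = 0 \<longrightarrow> v = 0)"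
  shows "open (\<Theta> ` B)" and "holo_on (\<Theta> ` B) (\<lambda>x. inv_into B \<Theta> x $ i)"
proof -
  have cont: "continuous_on B \<Theta>"
    using der by (intro continuous_at_imp_continuous_on ballI) (blast intro: has_derivative_continuous)
  show op: "open (\<Theta> ` B)" by (rule invariance_of_domain[OF cont B inj])
  let ?\<psi> = "inv_into B \<Theta>"
  have inv: "?\<psi> (\<Theta> y) = y" if "y \<in> B" for y using inj that by (rule inv_into_f_f)
  have cont': "continuous_on (\<Theta> ` B) ?\<psi>"
    by (rule continuous_on_inverse_open[OF B cont]) (use inv in auto)
  show "holo_on (\<Theta> ` B) (\<lambda>x. ?\<psi> x $ i)"
    unfolding holo_on_def
  proof
    fix x assume "x \<in> \<Theta> ` B"
    then obtain y where y: "y \<in> B" "x = \<Theta> y" by blast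
    obtain F where F: "(\<Theta> has_derivative F) (at y)" "\<And>c v. F (c *s v) = c *s F v" "\<And>v. F v = 0 \<Longrightarrow> v = 0"
      using der[OF y(1)] by blast
    have lin: "linear F" using F(1) by (intro bounded_linear.linear has_derivative_bounded_linear)
    have injF: "inj F" using F(3) by (simp add: linear_injective_0[OF lin])
    obtain G where G: "linear G" "G \<circ> F = id" using linear_injective_left_inverse[OF lin injF] by blast
    have "(?\<psi> has_derivative G) (at (\<Theta> y))"
      by (rule has_derivative_inverse_dieudonne[OF B op cont cont' _ y(1) F(1)])
        (use G inv in \<open>auto simp: linear_conv_bounded_linear\<close>)
    then have "((\<lambda>x. ?\<psi> x $ i) has_derivative (\<lambda>v. G v $ i)) (at x)"
      unfolding y(2) by (rule bounded_linear.has_derivative[OF bounded_linear_vec_nth])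
    moreover have "G (c *s v) = c *s G v" for c v
    proof -
      have "surj F" using linear_injective_imp_surjective[OF lin injF] by simp
      then obtain u where u: "v = F u" by (metis surjD)
      have GF: "G (F z) = z" for z using G(2) by (metis comp_apply id_apply)
      show ?thesis unfolding u by (simp add: GF flip: F(2))
    qed
    ultimately show "\<exists>D. ((\<lambda>x. ?\<psi> x $ i) has_derivative D) (at x) \<and> (\<forall>c v. D (c *s v) = c * D v)"
      by (intro exI[of _ "\<lambda>v. G v $ i"]) simp
  qed
qed

section \<open>The family with arbitrary exponents\<close>

lemma coeff_shift_den: "finite I \<Longrightarrow> coeff (shift_den I f) n = (if n \<in> I then (-1) ^ n * f n else 0)"
  by (simp add: shift_den_def coeff_sum)

lemma shift_den_cong: "(\<And>i. i \<in> I \<Longrightarrow> f i = f' i) \<Longrightarrow> shift_den I f = shift_den I f'"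
  by (simp add: shift_den_def)

lemma degree_shift_den:
  assumes I: "finite I" "I \<noteq> {}" and f: "f (Max I) \<noteq> 0"
  shows "degree (shift_den I f) = Max I"
proof (rule antisym)
  show "degree (shift_den I f) \<le> Max I" using I by (intro degree_le) (auto simp: coeff_shift_den)
  show "Max I \<le> degree (shift_den I f)" using I f by (intro le_degree) (simp add: coeff_shift_den)
qed

lemma order_shift_den_0:
  assumes I: "finite I" "I \<noteq> {}" and f: "f (Min I) \<noteq> 0"
  shows "order 0 (shift_den I f) = Min I"
  using I f by (intro order_0_eqI) (auto simp: coeff_shift_den)

text \<open>All \<open>f\<^sub>i\<close> except the lowest one are set to \<open>1\<close>; a double root \<open>q\<close> of \<open>D\<close> is then a root of
  \<open>T = X S' - a S\<close>, where \<open>S\<close> is \<open>D\<close> without its lowest term, and determines the lowest coefficient.\<close>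

lemma generic_space_nonempty:
  assumes I: "finite I" "I \<noteq> {}" "0 \<notin> I" and bij: "bij_betw \<iota> (generic_labels l I) (UNIV :: 'n::finite set)"
  shows "(generic_space I \<iota> :: (complex ^ 'n) set) \<noteq> {}"
proof -
  let ?a = "Min I" and ?b = "Max I"
  have ab: "?a \<in> I" "?b \<in> I" "?a \<le> ?b" using I by auto
  define T where "T = (\<Sum>i\<in>I - {?a}. monom ((of_nat i - of_nat ?a) * (-1) ^ i) i :: complex poly)"
  define S where "S = shift_den (I - {?a}) (\<lambda>_. 1)"
  \<comment> \<open>0 is excluded since the lowest coefficient must not vanish. For a singleton
    \<open>I\<close> the denominator is a monomial, without roots in C*, and nothing else has to be
    avoided.\<close>
  define bad where "bad = insert 0 (if ?a = ?b then {} else (\<lambda>q. - ((-1) ^ ?a) * poly S q / q ^ ?a) ` {q. poly T q = 0})"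
  have "finite bad"
  proof (cases "?a = ?b")
    case False
    then have "coeff T ?b \<noteq> 0" using I ab by (simp add: T_def coeff_sum)
    then have "T \<noteq> 0" by auto
    then show ?thesis using poly_roots_finite[of T] by (simp add: bad_def)
  qed (simp add: bad_def)
  then obtain t where t: "t \<notin> bad" using small_avoiding_finite[of bad 1] by auto
  define f where "f = (\<lambda>i. if i = ?b then 1 else if i = ?a then t else 1 :: complex)"
  define x :: "complex ^ 'n" where "x = (\<chi> n. let j = inv_into (generic_labels l I) \<iota> n in if j \<ge> 0 then 1 else f (nat (- j)))"
  have x: "x $ \<iota> j = (if j \<ge> 0 then 1 else f (nat (- j)))" if "j \<in> generic_labels l I" for j
    using bij_betw_inv_into_left[OF bij that] by (simp add: x_def)
  have lab: "0 \<in> generic_labels l I" "i \<in> I - {?b} \<Longrightarrow> - int i \<in> generic_labels l I" for i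
    by (auto simp: generic_labels_def)
  have pos: "i > 0" if "i \<in> I" for i using that I(3) by (cases i) auto
  have gf: "generic_f I (\<lambda>j. x $ \<iota> j) i = f i" if "i \<in> I" for i
    using that pos[OF that] lab(2)[of i] by (simp add: generic_f_def x f_def)
  have den: "shift_den I (generic_f I (\<lambda>j. x $ \<iota> j)) = shift_den I f" (is "?D = _")
    by (rule shift_den_cong) (rule gf)
  have "order q ?D = 1" if q: "q \<noteq> 0" "poly ?D q = 0" for q
  proof (cases "?a = ?b")
    case True
    have "I = {?b}"
    proof -
      have "i = ?b" if "i \<in> I" for i using Min_le[OF I(1) that] Max_ge[OF I(1) that] True by linarith
      then show ?thesis using ab by blast
    qed
    then have "poly ?D q = (\<Sum>i\<in>{?b}. (-1) ^ i * f i * q ^ i)"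
      unfolding den by (metis (no_types, lifting) shift_den_def poly_sum poly_monom sum.cong)
    then show ?thesis using q by (simp add: f_def)
  next
    case False
    have f1: "f i = 1" if "i \<in> I - {?a}" for i using that by (simp add: f_def)
    have fa: "f ?a = t" using False by (simp add: f_def)
    have split: "shift_den I f = monom ((-1) ^ ?a * t) ?a + S"
      unfolding S_def shift_den_def by (subst sum.remove[OF I(1) ab(1)]) (simp add: fa f1)
    have D0: "?D \<noteq> 0" using degree_shift_den[OF I(1,2), of f] pos[OF ab(2)] by (auto simp: den f_def)
    have "poly (pderiv ?D) q \<noteq> 0"
    proof
      assume d: "poly (pderiv ?D) q = 0"
      have "poly T q = q * poly (pderiv S) q - of_nat ?a * poly S q"
      proof -
        have *: "q * (of_nat i * (-1) ^ i * q ^ (i - 1)) = of_nat i * (-1) ^ i * q ^ i" for i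
          by (cases i) (auto simp: mult_ac)
        have "q * poly (pderiv S) q = (\<Sum>i\<in>I - {?a}. q * (of_nat i * (-1) ^ i * q ^ (i - 1)))"
          by (simp add: S_def shift_den_def pderiv_sum pderiv_monom poly_sum poly_monom sum_distrib_left)
        also have "\<dots> = (\<Sum>i\<in>I - {?a}. of_nat i * (-1) ^ i * q ^ i)" by (simp only: *)
        finally show ?thesis
          by (simp add: T_def S_def shift_den_def poly_sum poly_monom sum_distrib_left left_diff_distrib sum_subtractf mult.assoc)
      qed
      moreover have "q * (of_nat ?a * q ^ (?a - 1)) = of_nat ?a * q ^ ?a"
        using pos[OF ab(1)] by (cases ?a) auto
      then have "q * poly (pderiv ?D) q = of_nat ?a * ((-1) ^ ?a * t * q ^ ?a) + q * poly (pderiv S) q"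
        unfolding den split by (simp add: pderiv_add pderiv_monom poly_monom distrib_left) auto
      then have "q * poly (pderiv S) q = - (of_nat ?a * ((-1) ^ ?a * t * q ^ ?a))"
        using d by (simp add: add_eq_0_iff)
      moreover have Sq: "poly S q = - ((-1) ^ ?a * t * q ^ ?a)"
        using q(2) unfolding den split by (simp add: poly_monom add_eq_0_iff)
      ultimately have "poly T q = 0" by simp
      moreover have "t = - ((-1) ^ ?a) * poly S q / q ^ ?a"
        unfolding Sq using q(1) by (simp flip: mult.assoc power_add mult_2)
      ultimately have "t \<in> bad" using False by (auto simp: bad_def)
      then show False using t by simp
    qed
    then have "order q (pderiv ?D) = 0" by (rule order_0I)
    then show ?thesis using order_pderiv[OF D0 q(2)] by simp
  qed
  moreover have "x $ \<iota> 0 \<noteq> 0" using x[OF lab(1)] by simp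
  moreover have "x $ \<iota> (- int i) \<noteq> 0" if "i \<in> I - {?b}" for i
    using that pos[of i] t x[OF lab(2)[OF that]] by (auto simp: f_def bad_def)
  ultimately have "x \<in> generic_space I \<iota>" unfolding generic_space_def by blast
  then show ?thesis by blast
qed

text \<open>\<open>D\<close> is affine in each \<open>f\<^sub>i\<close>, so its derivative along the
  label \<open>- i\<close> is a constant monomial.\<close>

lemma shift_lg_generic:
  fixes U :: "(complex ^ 'n) set"
  assumes I: "I \<subseteq> {1..l}" "I \<noteq> {}"
    and bij: "bij_betw \<iota> (generic_labels l I) (UNIV :: 'n set)"
    and U: "U \<subseteq> generic_space I \<iota>"
    and frob: "frobenius_manifold U g C e E d"
    and lg: "landau_ginzburg U (generic_lambda l I \<iota>) g C e E"
  shows "shift_lg l (generic_labels l I) \<iota> U (\<lambda>x. shift_den I (generic_f I (\<lambda>j. x $ \<iota> j)))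
    (\<lambda>x j. monom ((-1) ^ nat (- j)) (nat (- j))) g C e E d"
proof (rule shift_lg.intro)
  have fin: "finite I" using I(1) finite_subset by blast
  have b: "Max I \<in> I" using fin I(2) by simp
  have deg: "degree (shift_den I (generic_f I w)) = Max I" for w
    using degree_shift_den[OF fin I(2)] by (simp add: generic_f_def)
  have neg: "j \<in> generic_labels l I \<and> j < 0 \<longleftrightarrow> (\<exists>i\<in>I - {Max I}. j = - int i)" for j
    using I(1) by (force simp: generic_labels_def)
  show "bij_betw \<iota> (generic_labels l I) UNIV" by fact
  show "{0..int l} \<subseteq> generic_labels l I" "generic_labels l I \<subseteq> {..int l}" by (auto simp: generic_labels_def)
  show "x $ \<iota> 0 \<noteq> 0" if "x \<in> U" for x using that U by (auto simp: generic_space_def)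
  show "shift_den I (generic_f I (\<lambda>j. x $ \<iota> j)) \<noteq> 0" for x
    using deg[of "\<lambda>j. x $ \<iota> j"] b I(1) by auto
  show "degree (shift_den I (generic_f I (\<lambda>j. x $ \<iota> j))) \<le> l" for x using deg b I(1) by auto
  show "poly (shift_den I (generic_f I (\<lambda>j. x $ \<iota> j))) 0 = 0" for x
    using I(1) fin by (auto simp: poly_0_coeff_0 coeff_shift_den)
  show "frobenius_manifold U g C e E d" by fact
  show "landau_ginzburg U (\<lambda>x \<mu>. - (x $ \<iota> 0) * Q l (\<lambda>j. x $ \<iota> j) \<mu> /
      poly (shift_den I (generic_f I (\<lambda>j. x $ \<iota> j))) \<mu>) g C e E"
    using lg unfolding generic_lambda_def[abs_def] shift_lambda_def[abs_def] .
  show "(\<lambda>j. monom ((-1) ^ nat (- j)) (nat (- j))) = (\<lambda>j. monom ((-1) ^ nat (- j)) (nat (- j)))" by (rule refl)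
next
  fix x y :: "complex ^ 'n" assume eq: "\<And>j. j \<in> generic_labels l I \<Longrightarrow> j < 0 \<Longrightarrow> x $ \<iota> j = y $ \<iota> j"
  have "x $ \<iota> (- int i) = y $ \<iota> (- int i)" if "i \<in> I" "i \<noteq> Max I" for i
    using that I(1) by (intro eq) (auto simp: generic_labels_def)
  then show "shift_den I (generic_f I (\<lambda>j. x $ \<iota> j)) = shift_den I (generic_f I (\<lambda>j. y $ \<iota> j))"
    by (intro shift_den_cong) (simp add: generic_f_def)
next
  fix x :: "complex ^ 'n" and j \<mu> assume j: "j \<in> generic_labels l I" "j < 0"
  have fin: "finite I" using I(1) finite_subset by blast
  obtain i where i: "i \<in> I - {Max I}" "j = - int i"
    using j by (auto simp: generic_labels_def)
  have "generic_f I (\<lambda>j. (x + axis (\<iota> (- int i)) t) $ \<iota> j) i' =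
      generic_f I (\<lambda>j. x $ \<iota> j) i' + (if i' = i then t else 0)" if "i' \<in> I" for t i'
  proof (cases "i' = Max I")
    case False
    then have "- int i' \<in> generic_labels l I" using that by (auto simp: generic_labels_def)
    then have "\<iota> (- int i') = \<iota> (- int i) \<longleftrightarrow> i' = i"
      using bij_betw_imp_inj_on[OF bij] j(1) i(2) by (auto dest: inj_onD)
    then show ?thesis using False by (simp add: generic_f_def axis_def)
  qed (use i in \<open>simp add: generic_f_def\<close>)
  then have "poly (shift_den I (generic_f I (\<lambda>j. (x + axis (\<iota> (- int i)) t) $ \<iota> j))) \<mu>
      = (\<Sum>i'\<in>I. (-1) ^ i' * generic_f I (\<lambda>j. x $ \<iota> j) i' * \<mu> ^ i' + (if i' = i then (-1) ^ i * t * \<mu> ^ i else 0))" for t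
    unfolding shift_den_def poly_sum poly_monom by (intro sum.cong refl) (simp add: algebra_simps del: vector_add_component)
  then have "poly (shift_den I (generic_f I (\<lambda>j. (x + axis (\<iota> (- int i)) t) $ \<iota> j))) \<mu>
      = (\<Sum>i'\<in>I. (-1) ^ i' * generic_f I (\<lambda>j. x $ \<iota> j) i' * \<mu> ^ i') + (-1) ^ i * t * \<mu> ^ i" for t
    using fin i by (simp add: sum.distrib del: vector_add_component)
  then show "((\<lambda>t. poly (shift_den I (generic_f I (\<lambda>ja. (x + axis (\<iota> j) t) $ \<iota> ja))) \<mu>)
      has_field_derivative poly (monom ((-1) ^ nat (- j)) (nat (- j))) \<mu>) (at 0)"
    unfolding i(2) by (auto intro!: derivative_eq_intros simp: poly_monom)
qed

text \<open>\<open>exponents_consecutive\<close> bounds \<open>Max I - Min I\<close> by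
  \<open>card I - 1\<close>, which forces an interval. Then \<open>D\<close> has \<open>p\<close>
  simple zeros in C* besides 0, and the number of critical points equals the dimension.\<close>

lemma generic_case_algebra:
  fixes U :: "(complex ^ 'n) set"
  assumes I: "I \<subseteq> {1..l}" "card I = p + 1"
    and bij: "bij_betw \<iota> (generic_labels l I) (UNIV :: 'n set)"
    and U: "U \<subseteq> generic_space I \<iota>" "generic_space I \<iota> \<subseteq> closure U"
    and frob: "frobenius_manifold U g C e E d"
    and lg: "landau_ginzburg U (generic_lambda l I \<iota>) g C e E"
  obtains k where "k \<in> {1..l - p}" "I = {k..k + p}" "semisimple U C" "CARD('n) = l + 1 + p" "d = 1"
proof -
  have fin: "finite I" using I(1) finite_subset by blast
  have I0: "I \<noteq> {}" using I(2) by auto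
  interpret shift_lg l "generic_labels l I" \<iota> U "\<lambda>x. shift_den I (generic_f I (\<lambda>j. x $ \<iota> j))"
    "\<lambda>x j. monom ((-1) ^ nat (- j)) (nat (- j))" g C e E d
    by (rule shift_lg_generic[OF I(1) I0 bij U(1) frob lg])
  define k where "k = Min I"
  have kI: "k \<in> I" "Max I \<in> I" "I \<subseteq> {k..Max I}" using fin I0 by (auto simp: k_def)
  let ?den = "\<lambda>x. shift_den I (generic_f I (\<lambda>j. x $ \<iota> j))"
  have f_nz: "generic_f I (\<lambda>j. x $ \<iota> j) i \<noteq> 0" if "x \<in> U" "i \<in> I" for x i
    using that U(1) by (auto simp: generic_f_def generic_space_def)
  have simple: "order z (?den x) = 1" if "x \<in> U" "z \<noteq> 0" "poly (?den x) z = 0" for x z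
    using that U(1) by (auto simp: generic_space_def)
  have "generic_space I \<iota> \<noteq> {}"
    using I(1) by (intro generic_space_nonempty[OF fin I0 _ bij]) auto
  then have Une: "U \<noteq> {}" using U(2) by auto
  then obtain x0 where gx: "generic x0" using generic_dense[of _ UNIV] by blast
  have "Max I - k < card I"
  proof (rule exponents_consecutive[OF gx fin kI(3,1,2), where c = "\<lambda>i. (-1) ^ i * generic_f I (\<lambda>j. x0 $ \<iota> j) i"])
    show "1 \<le> k" "Max I \<le> l" using kI I(1) by auto
    show "?den x0 = (\<Sum>i\<in>I. monom ((-1) ^ i * generic_f I (\<lambda>j. x0 $ \<iota> j) i) i)" by (simp add: shift_den_def)
    show "(-1) ^ k * generic_f I (\<lambda>j. x0 $ \<iota> j) k \<noteq> 0" "(-1) ^ Max I * generic_f I (\<lambda>j. x0 $ \<iota> j) (Max I) \<noteq> 0"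
      using f_nz[OF generic_in_U[OF gx]] kI by auto
    show "order z (?den x0) = 1" if "z \<noteq> 0" "poly (?den x0) z = 0" for z
      using simple[OF generic_in_U[OF gx] that] .
    show "\<exists>\<gamma>. \<exists>i\<in>I. monom ((-1) ^ nat (- j)) (nat (- j)) = monom \<gamma> i"
      if j: "j \<in> generic_labels l I" "j < 0" for j :: int
    proof -
      obtain i where "i \<in> I" "j = - int i" using j by (auto simp: generic_labels_def)
      then show ?thesis by (intro exI[of _ "(-1) ^ i"] bexI[of _ i]) auto
    qed
  qed
  then have "card {k..Max I} \<le> card I" using kI by auto
  then have Ik: "I = {k..Max I}" by (rule card_seteq[OF finite_atLeastAtMost kI(3)])
  have "card I = Suc (Max I) - k" using arg_cong[OF Ik, of card] by (simp only: card_atLeastAtMost)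
  moreover have "k \<le> Max I" using kI by auto
  ultimately have b: "Max I = k + p" using I(2) by linarith
  have card_n: "CARD('n) = l + 1 + p"
  proof -
    have "CARD('n) = card (generic_labels l I)" using bij_betw_same_card[OF bij] by simp
    also have "\<dots> = card {0..int l} + card ((\<lambda>i. - int i) ` (I - {Max I}))"
      unfolding generic_labels_def using fin I(1) by (intro card_Un_disjoint) auto
    also have "card ((\<lambda>i. - int i) ` (I - {Max I})) = card (I - {Max I})"
      by (intro card_image) (auto simp: inj_on_def)
    also have "card (I - {Max I}) = p" using fin kI I(2) by simp
    finally show ?thesis by simp
  qed
  have "l + card {z. poly (?den x) z = 0} \<le> CARD('n)" if x: "x \<in> U" for x
  proof -
    have D: "?den x \<noteq> 0" using den_nonzero[OF x] .
    have o: "order 0 (?den x) = k"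
      unfolding k_def using order_shift_den_0[OF fin I0] f_nz[OF x kI(1)] by (simp add: k_def)
    have dg: "degree (?den x) = k + p"
      using degree_shift_den[OF fin I0] b by (simp add: generic_f_def)
    have "card {z. z \<noteq> 0 \<and> poly (?den x) z = 0} = p"
      using card_simple_nonzero_roots[OF D simple[OF x]] o dg by simp
    moreover have "{z. poly (?den x) z = 0} \<subseteq> insert 0 {z. z \<noteq> 0 \<and> poly (?den x) z = 0}" by auto
    moreover have "finite {z. z \<noteq> 0 \<and> poly (?den x) z = 0}"
      using poly_roots_finite[OF D] by (rule rev_finite_subset) auto
    ultimately have "card {z. poly (?den x) z = 0} \<le> p + 1"
      using card_mono[of "insert 0 {z. z \<noteq> 0 \<and> poly (?den x) z = 0}" "{z. poly (?den x) z = 0}"]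
        card_insert_le_m1[of "p + 1" "{z. z \<noteq> 0 \<and> poly (?den x) z = 0}" 0] by simp
    then show ?thesis using card_n by simp
  qed
  then have ss: "semisimple U C" by (rule semisimple)
  have "1 \<le> k" "Max I \<le> l" using kI I(1) by auto
  then have "k \<in> {1..l - p}" using b by simp
  then show ?thesis using that[of k] Ik b ss card_n charge_1[OF Une] by simp
qed

lemma lead_coeff_pole_poly: "coeff (pole_poly k m w) (k + sum_list m) = 1"
proof -
  have "lead_coeff (pole_poly k m w) = 1"
    unfolding pole_poly_def by (simp add: lead_coeff_mult lead_coeff_prod lead_coeff_power degree_monom_eq)
  then show ?thesis by (simp add: degree_pole_poly)
qed

lemma generic_labels_interval:
  assumes "I = {k..k + p}"
  shows "generic_labels l I = {0..int l} \<union> {- int (k + p) + 1..- int k}"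
proof -
  have MaxI: "Max I = k + p" using assms by (auto intro!: Max_eqI)
  have "(\<lambda>i. - int i) ` (I - {k + p}) = {- int (k + p) + 1..- int k}"
  proof (intro equalityI subsetI)
    fix j assume "j \<in> {- int (k + p) + 1..- int k}"
    then show "j \<in> (\<lambda>i. - int i) ` (I - {k + p})"
      using assms by (intro image_eqI[of _ _ "nat (- j)"]) auto
  qed (auto simp: assms)
  then show ?thesis unfolding generic_labels_def MaxI by simp
qed

text \<open>The reflection \<open>j \<mapsto> - (k + p) - j\<close> is an involution exchanging the
  pole labels \<open>- p, \<dots>, - 1\<close> with the coefficient labels
  \<open>- (k + p) + 1, \<dots>, - k\<close>.\<close>

lemma generic_labels_reindex:
  assumes I: "I = {k..k + p}" "1 \<le> k" and bij: "bij_betw \<iota> (generic_labels l I) UNIV"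
  shows "bij_betw (\<lambda>j. if j \<ge> 0 then \<iota> j else \<iota> (- int (k + p) - j)) {- int p..int l} UNIV"
proof -
  define \<sigma> where "\<sigma> = (\<lambda>j. if j \<ge> 0 then j else - int (k + p) - j)"
  have "bij_betw \<sigma> {- int p..int l} (generic_labels l I)"
    using I(2) by (intro bij_betw_byWitness[where f' = \<sigma>])
      (auto simp: \<sigma>_def generic_labels_interval[OF I(1)])
  then have "bij_betw (\<iota> \<circ> \<sigma>) {- int p..int l} UNIV" using bij by (rule bij_betw_trans)
  moreover have "\<iota> \<circ> \<sigma> = (\<lambda>j. if j \<ge> 0 then \<iota> j else \<iota> (- int (k + p) - j))"
    by (auto simp: \<sigma>_def fun_eq_iff)
  ultimately show ?thesis by simp
qed

text \<open>\<open>\<Theta>\<close> maps poles to coefficients. It is injective where each pole stays within half the distance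
  to the others, and its derivative is injective because \<open>D\<close> has simple roots.\<close>

lemma generic_chart:
  fixes U :: "(complex ^ 'n) set" and k p l :: nat and \<iota> :: "int \<Rightarrow> 'n"
  assumes I: "I = {k..k + p}" "1 \<le> k" "k + p \<le> l"
    and bij: "bij_betw \<iota> (generic_labels l I) (UNIV :: 'n set)"
    and m_def: "m = replicate p 1"
    and \<iota>'_def: "\<iota>' = (\<lambda>j. if j \<ge> 0 then \<iota> j else \<iota> (- int (k + p) - j))"
    and U: "open U" "U \<subseteq> generic_space I \<iota>" and x: "x \<in> U"
  shows "\<exists>V w. x \<in> V \<and> V \<subseteq> U \<and> local_chart V w \<and>
      (\<forall>y\<in>V. \<forall>\<mu>. w y $ \<iota>' 0 * Q l (\<lambda>j. w y $ \<iota>' j) \<mu> /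
        (\<mu> ^ k * (\<Prod>\<alpha> = 1..length m. (\<mu> - w y $ \<iota>' (- int \<alpha>)) ^ (m ! (\<alpha> - 1)))) = generic_lambda l I \<iota> y \<mu>)"
proof -
  define b where "b = k + p"
  let ?\<Lambda> = "generic_labels l I" and ?\<epsilon> = "(-1) ^ b :: complex"
  have finI: "finite I" "I \<noteq> {}" and MaxI: "Max I = b" and MinI: "Min I = k"
    using I(1) by (auto simp: b_def intro!: Max_eqI Min_eqI)
  have \<Lambda>: "?\<Lambda> = {0..int l} \<union> {- int b + 1..- int k}"
    unfolding b_def using I(1) by (rule generic_labels_interval)
  have neg\<Lambda>: "- int i \<in> ?\<Lambda>" if "i \<in> I" "i \<noteq> b" for i using that I(1) unfolding \<Lambda> by (auto simp: b_def)
  have pos\<Lambda>: "j \<in> ?\<Lambda>" if "0 \<le> j" "j \<le> int l" for j using that by (simp add: \<Lambda>)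
  have \<iota>'_pos: "\<iota>' j = \<iota> j" if "j \<ge> 0" for j using that by (simp add: \<iota>'_def)
  have \<iota>'_neg: "\<iota>' (- int \<alpha>) = \<iota> (- int (b - \<alpha>))" if "\<alpha> \<in> {1..p}" for \<alpha>
  proof -
    have "- int (k + p) - (- int \<alpha>) = - int (b - \<alpha>)" using that by (simp add: b_def)
    then show ?thesis using that by (simp add: \<iota>'_def)
  qed
  define label where "label = inv_into ?\<Lambda> \<iota>"
  have label: "label (\<iota> j) = j" if "j \<in> ?\<Lambda>" for j
    using bij_betw_inv_into_left[OF bij that] by (simp add: label_def)
  have indices: "(\<And>j. 0 \<le> j \<Longrightarrow> j \<le> int l \<Longrightarrow> P (\<iota> j)) \<Longrightarrow> (\<And>i. i \<in> I \<Longrightarrow> i \<noteq> b \<Longrightarrow> P (\<iota> (- int i))) \<Longrightarrow> P n" for P n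
  proof -
    assume a: "\<And>j. 0 \<le> j \<Longrightarrow> j \<le> int l \<Longrightarrow> P (\<iota> j)" "\<And>i. i \<in> I \<Longrightarrow> i \<noteq> b \<Longrightarrow> P (\<iota> (- int i))"
    obtain j where j: "j \<in> ?\<Lambda>" "n = \<iota> j" using bij by (metis UNIV_I bij_betw_imp_surj_on imageE)
    show "P n"
    proof (cases "j \<ge> 0")
      case True
      then show ?thesis using j a(1) I(2) by (auto simp: \<Lambda>)
    next
      case False
      then have "nat (- j) \<in> I" "nat (- j) \<noteq> b" "j = - int (nat (- j))"
        using j(1)[unfolded \<Lambda>] I(1) by (auto simp: b_def)
      then show ?thesis using a(2)[of "nat (- j)"] j(2) by simp
    qed
  qed
  define W where "W = (\<lambda>(y :: complex ^ 'n) j. y $ \<iota>' j)"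
  \<comment> \<open>A globally defined polynomial map from the new coordinates to the old; the chart
    is its local inverse. The factor on \<open>w\<^sub>0\<close> absorbs both the sign of \<lambda>
    and the leading coefficient of \<open>D\<close>.\<close>
  define \<Theta> where "\<Theta> = (\<lambda>y :: complex ^ 'n. \<chi> n. if label n = 0 then - ?\<epsilon> * y $ n
    else if label n > 0 then y $ n else pole_f k m (W y) (nat (- label n)))"
  define den where "den = (\<lambda>y :: complex ^ 'n. shift_den I (generic_f I (\<lambda>j. y $ \<iota> j)))"
  have sum_m: "sum_list m = p" "length m = p" by (simp_all add: m_def sum_list_replicate)
  have \<Theta>_0: "\<Theta> y $ \<iota> 0 = - ?\<epsilon> * y $ \<iota> 0" for y by (simp add: \<Theta>_def label pos\<Lambda>)
  have \<Theta>_pos: "\<Theta> y $ \<iota> j = y $ \<iota> j" if "0 < j" "j \<le> int l" for y j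
    using that by (simp add: \<Theta>_def label pos\<Lambda>)
  have \<Theta>_neg: "\<Theta> y $ \<iota> (- int i) = pole_f k m (W y) i" if "i \<in> I" "i \<noteq> b" for y i
  proof -
    have "i \<noteq> 0" using that I(1,2) by auto
    then show ?thesis using label[OF neg\<Lambda>[OF that]] by (simp add: \<Theta>_def)
  qed
  have pole_f_top: "pole_f k m w b = 1" for w
    using lead_coeff_pole_poly[of k m w] minus_one_power_square[of b] by (simp add: pole_f_def sum_m b_def)
  have den_\<Theta>: "den (\<Theta> y) = shift_den I (pole_f k m (W y))" for y
    unfolding den_def by (rule shift_den_cong) (auto simp: generic_f_def MaxI pole_f_top \<Theta>_neg)
  have pole_den: "shift_den I (pole_f k m w) = smult ?\<epsilon> (pole_poly k m w)" for w
    using shift_den_pole_f[of k m w] by (simp add: sum_m I(1) b_def)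
  have prod_m: "(\<Prod>\<alpha> = 1..length m. h \<alpha> ^ (m ! (\<alpha> - 1))) = (\<Prod>\<alpha> = 1..p. h \<alpha>)" for h :: "nat \<Rightarrow> 'c::comm_monoid_mult"
    unfolding sum_m by (intro prod.cong refl) (auto simp: m_def)
  have poly_den_\<Theta>: "poly (den (\<Theta> y)) \<mu> = ?\<epsilon> * (\<mu> ^ k * (\<Prod>\<alpha> = 1..p. \<mu> - W y (- int \<alpha>)))" for y \<mu>
    unfolding den_\<Theta> pole_den by (simp only: poly_smult poly_pole_poly prod_m)
  have holo_\<Theta>: "holo_on S (\<lambda>y. \<Theta> y $ n)" for S n
  proof (rule indices[where n = n])
    fix j assume j: "0 \<le> j" "j \<le> int l"
    show "holo_on S (\<lambda>y. \<Theta> y $ \<iota> j)"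
    proof (cases "j = 0")
      case True
      show ?thesis unfolding True \<Theta>_0 by (intro holo_on_mult holo_on_const holo_on_nth)
    next
      case False
      then show ?thesis using j by (simp add: \<Theta>_pos holo_on_nth)
    qed
  next
    fix i assume i: "i \<in> I" "i \<noteq> b"
    show "holo_on S (\<lambda>y. \<Theta> y $ \<iota> (- int i))"
      unfolding \<Theta>_neg[OF i] pole_f_def W_def
      by (intro holo_on_mult holo_on_const holo_on_coeff_pole_poly)
  qed

  have gx: "x \<in> generic_space I \<iota>" using x U(2) by blast
  have f_nz: "generic_f I (\<lambda>j. x $ \<iota> j) i \<noteq> 0" if "i \<in> I" for i
    using that gx by (auto simp: generic_f_def generic_space_def)
  have deg_den: "degree (den y) = b" for y
    using degree_shift_den[OF finI] by (simp add: den_def MaxI generic_f_def)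
  have den_nz: "den y \<noteq> 0" for y using deg_den[of y] I(2) by (auto simp: b_def)
  have simple: "order z (den x) = 1" if "z \<noteq> 0" "poly (den x) z = 0" for z
    using that gx by (auto simp: generic_space_def den_def)
  have ord: "order 0 (den x) = k"
    unfolding den_def by (rule order_shift_den_0[OF finI, unfolded MinI]) (rule f_nz, simp add: I(1))
  define Z where "Z = {z. z \<noteq> 0 \<and> poly (den x) z = 0}"
  have finZ: "finite Z" unfolding Z_def using poly_roots_finite[OF den_nz] by (rule rev_finite_subset) auto
  have cardZ: "card Z = p"
    using card_simple_nonzero_roots[OF den_nz simple] ord deg_den[of x] by (simp add: Z_def b_def)
  have lead: "lead_coeff (den x) = ?\<epsilon>"
  proof -
    have "b \<in> I" using I(1) by (simp add: b_def)
    then show ?thesis unfolding deg_den by (simp add: den_def coeff_shift_den finI generic_f_def MaxI)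
  qed
  obtain pz where pz: "bij_betw pz {1..p} Z" using ex_bij_betw_nat_finite_1[OF finZ] cardZ by auto
  have pz_nz: "pz \<alpha> \<noteq> 0" if "\<alpha> \<in> {1..p}" for \<alpha> using bij_betwE[OF pz] that by (auto simp: Z_def)
  have pz_inj: "pz \<alpha> \<noteq> pz \<beta>" if "\<alpha> \<in> {1..p}" "\<beta> \<in> {1..p}" "\<alpha> \<noteq> \<beta>" for \<alpha> \<beta>
    using bij_betw_imp_inj_on[OF pz] that by (auto dest: inj_onD)
  \<comment> \<open>The preimage of \<open>x\<close> for an arbitrary enumeration \<open>pz\<close>
    of the non-zero roots; the coefficient label \<open>- i\<close> holds the pole number
    \<open>b - i\<close>.\<close>
  define y0 :: "complex ^ 'n" where "y0 = (\<chi> n. if label n = 0 then - ?\<epsilon> * x $ n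
    else if label n > 0 then x $ n else pz (nat (int b + label n)))"
  have W_y0: "W y0 (- int \<alpha>) = pz \<alpha>" if \<alpha>: "\<alpha> \<in> {1..p}" for \<alpha>
  proof -
    define i where "i = b - \<alpha>"
    have i: "i \<in> I" "i \<noteq> b" "b = i + \<alpha>" "0 < i"
      using \<alpha> I(1,2) by (auto simp: b_def i_def)
    have "y0 $ \<iota> (- int i) = pz (nat (int b - int i))"
      using label[OF neg\<Lambda>[OF i(1,2)]] i(4) by (simp add: y0_def)
    also have "nat (int b - int i) = \<alpha>" by (simp add: i(3))
    finally show ?thesis unfolding W_def \<iota>'_neg[OF \<alpha>] i_def .
  qed
  have "pole_poly k m (W y0) = monom 1 k * (\<Prod>z\<in>Z. [:-z, 1:])"
  proof -
    have "(\<Prod>\<alpha> = 1..p. [:- W y0 (- int \<alpha>), 1:]) = (\<Prod>\<alpha> = 1..p. [:- pz \<alpha>, 1:])"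
      by (intro prod.cong refl) (simp add: W_y0)
    also have "\<dots> = (\<Prod>z\<in>Z. [:-z, 1:])"
      by (rule prod.reindex_bij_betw[OF pz])
    finally show ?thesis unfolding pole_poly_def prod_m by simp
  qed
  then have den_y0: "den (\<Theta> y0) = den x"
    using simple_root_factorization[OF den_nz simple] by (simp add: den_\<Theta> pole_den lead ord Z_def)
  have \<Theta>_y0: "\<Theta> y0 = x"
  proof (subst vec_eq_iff, rule allI)
    fix n show "\<Theta> y0 $ n = x $ n"
    proof (rule indices[where n = n])
      fix j assume j: "0 \<le> j" "j \<le> int l"
      then show "\<Theta> y0 $ \<iota> j = x $ \<iota> j"
        using minus_one_power_square[of b]
        by (cases "j = 0") (simp_all add: \<Theta>_0 \<Theta>_pos y0_def label pos\<Lambda> flip: mult.assoc)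
    next
      fix i assume i: "i \<in> I" "i \<noteq> b"
      have "coeff (den (\<Theta> y0)) i = coeff (den x) i" using den_y0 by simp
      then show "\<Theta> y0 $ \<iota> (- int i) = x $ \<iota> (- int i)"
        using i by (simp add: den_def coeff_shift_den finI generic_f_def MaxI)
    qed
  qed

  \<comment> \<open>Besides separating the poles, \<rho> keeps them away from 0. The 1 is inserted
    so that the minimum exists also for \<open>p = 0\<close>.\<close>
  define \<rho> where "\<rho> = Min (insert 1 ((\<lambda>\<alpha>. cmod (pz \<alpha>)) ` {1..p} \<union>
    (\<lambda>(\<alpha>, \<beta>). cmod (pz \<alpha> - pz \<beta>) / 2) ` {(\<alpha>, \<beta>) \<in> {1..p} \<times> {1..p}. \<alpha> \<noteq> \<beta>}))" (is "_ = Min ?M")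
  have finpairs: "finite {(\<alpha>, \<beta>) \<in> {1..p} \<times> {1..p}. \<alpha> \<noteq> \<beta>}"
    by (rule finite_subset[of _ "{1..p} \<times> {1..p}"]) auto
  then have finM: "finite ?M" by simp
  have "0 < \<rho>" unfolding \<rho>_def using finM pz_nz pz_inj by (subst Min_gr_iff) auto
  have \<rho>1: "\<rho> \<le> cmod (pz \<alpha>)" if "\<alpha> \<in> {1..p}" for \<alpha>
    unfolding \<rho>_def using that by (intro Min_le finM) auto
  have \<rho>2: "2 * \<rho> \<le> cmod (pz \<alpha> - pz \<beta>)" if "\<alpha> \<in> {1..p}" "\<beta> \<in> {1..p}" "\<alpha> \<noteq> \<beta>" for \<alpha> \<beta>
  proof -
    have "\<rho> \<le> cmod (pz \<alpha> - pz \<beta>) / 2"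
      unfolding \<rho>_def using that by (intro Min_le finM insertI2 UnI2) force
    then show ?thesis by simp
  qed
  define B where "B = {y. \<forall>\<alpha>\<in>{1..p}. cmod (W y (- int \<alpha>) - pz \<alpha>) < \<rho>}"
  have "B = (\<Inter>\<alpha>\<in>{1..p}. {y. cmod (W y (- int \<alpha>) - pz \<alpha>) < \<rho>})" by (auto simp: B_def)
  also have "open \<dots>"
    unfolding W_def by (intro open_INT finite_atLeastAtMost ballI open_Collect_less continuous_intros)
  finally have openB: "open B" .
  have y0B: "y0 \<in> B" using \<open>0 < \<rho>\<close> by (simp add: B_def W_y0)
  have B_nz: "W y (- int \<alpha>) \<noteq> 0" if "y \<in> B" "\<alpha> \<in> {1..p}" for y \<alpha>
    using that \<rho>1[OF that(2)] by (force simp: B_def)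
  \<comment> \<open>Two points of \<open>B\<close> are allowed: with \<open>y \<noteq> y'\<close>
    this serves the injectivity of \<Theta>, with \<open>y = y'\<close> the simplicity of the
    roots.\<close>
  have B_sep: "\<alpha> = \<beta>" if "y \<in> B" "y' \<in> B" "\<alpha> \<in> {1..p}" "\<beta> \<in> {1..p}" "W y (- int \<alpha>) = W y' (- int \<beta>)" for y y' \<alpha> \<beta>
  proof (rule ccontr)
    assume "\<alpha> \<noteq> \<beta>"
    have "cmod (pz \<alpha> - pz \<beta>) \<le> cmod (W y (- int \<alpha>) - pz \<alpha>) + cmod (W y' (- int \<beta>) - pz \<beta>)"
      using norm_triangle_ineq4[of "W y' (- int \<beta>) - pz \<beta>" "W y (- int \<alpha>) - pz \<alpha>"] that(5)
      by (simp add: algebra_simps)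
    also have "\<dots> < 2 * \<rho>" using that by (force simp: B_def)
    finally show False using \<rho>2[OF that(3,4) \<open>\<alpha> \<noteq> \<beta>\<close>] by simp
  qed
  have root: "poly (den (\<Theta> y)) \<mu> = 0 \<longleftrightarrow> \<mu> = 0 \<or> (\<exists>\<alpha>\<in>{1..p}. \<mu> = W y (- int \<alpha>))" for y \<mu>
    unfolding poly_den_\<Theta> using I(2) by auto
  have injB: "inj_on \<Theta> B"
  proof (rule inj_onI)
    fix y y' assume y: "y \<in> B" "y' \<in> B" and eq: "\<Theta> y = \<Theta> y'"
    have W: "W y (- int \<alpha>) = W y' (- int \<alpha>)" if \<alpha>: "\<alpha> \<in> {1..p}" for \<alpha>
    proof -
      have "poly (den (\<Theta> y')) (W y (- int \<alpha>)) = 0" using root[of y] \<alpha> eq by auto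
      then obtain \<beta> where "\<beta> \<in> {1..p}" "W y (- int \<alpha>) = W y' (- int \<beta>)"
        using root[of y'] B_nz[OF y(1) \<alpha>] by auto
      then show ?thesis using B_sep[OF y \<alpha>] by blast
    qed
    show "y = y'"
    proof (subst vec_eq_iff, rule allI)
      fix n show "y $ n = y' $ n"
      proof (rule indices[where n = n])
        fix j assume j: "0 \<le> j" "j \<le> int l"
        have "\<Theta> y $ \<iota> j = \<Theta> y' $ \<iota> j" using eq by simp
        then show "y $ \<iota> j = y' $ \<iota> j" using j by (cases "j = 0") (simp_all add: \<Theta>_0 \<Theta>_pos)
      next
        fix i assume i: "i \<in> I" "i \<noteq> b"
        then have "b - i \<in> {1..p}" "b - (b - i) = i" using I(1) by (auto simp: b_def)
        then show "y $ \<iota> (- int i) = y' $ \<iota> (- int i)"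
          using W[of "b - i"] \<iota>'_neg[of "b - i"] by (simp add: W_def)
      qed
    qed
  qed
  have der: "\<exists>F. (\<Theta> has_derivative F) (at y) \<and>
      (\<forall>c v. F (c *s v) = c *s F v) \<and> (\<forall>v. F v = 0 \<longrightarrow> v = 0)" if y: "y \<in> B" for y
  proof -
    have "\<forall>n. \<exists>D. ((\<lambda>y. \<Theta> y $ n) has_derivative D) (at y) \<and> (\<forall>c v. D (c *s v) = c * D v)"
      using holo_\<Theta>[of UNIV] by (simp add: holo_on_def)
    then obtain D where D: "\<And>n. ((\<lambda>y. \<Theta> y $ n) has_derivative D n) (at y)" "\<And>n c v. D n (c *s v) = c * D n v"
      by metis
    define F where "F = (\<lambda>v. \<chi> n. D n v)"
    have F: "(\<Theta> has_derivative F) (at y)"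
      by (rule has_derivative_vec_componentwise) (simp add: F_def D(1))
    have "v = 0" if Fv: "F v = 0" for v
    proof -
      have Dv: "D n v = 0" for n using Fv by (simp add: F_def vec_eq_iff)
      have nth: "((\<lambda>y. y $ n) has_derivative (\<lambda>v. v $ n)) (at y)" for n
        by (rule bounded_linear_imp_has_derivative[OF bounded_linear_vec_nth])
      have "v $ n = 0" for n
      proof (rule indices[where n = n])
        fix j assume j: "0 \<le> j" "j \<le> int l"
        show "v $ \<iota> j = 0"
        proof (cases "j = 0")
          case True
          have "((\<lambda>y. \<Theta> y $ \<iota> 0) has_derivative (\<lambda>v. - ?\<epsilon> * v $ \<iota> 0)) (at y)"
            unfolding \<Theta>_0 by (rule has_derivative_mult_right[OF nth])
          from has_derivative_unique[OF D(1) this] Dv[of "\<iota> 0"] have "- ?\<epsilon> * v $ \<iota> 0 = 0" by metis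
          then show ?thesis by (simp add: True)
        next
          case False
          then have "((\<lambda>y. \<Theta> y $ \<iota> j) has_derivative (\<lambda>v. v $ \<iota> j)) (at y)"
            using j nth by (simp add: \<Theta>_pos)
          from has_derivative_unique[OF D(1) this] Dv[of "\<iota> j"] show ?thesis by metis
        qed
      next
        fix i assume i: "i \<in> I" "i \<noteq> b"
        define \<alpha> where "\<alpha> = b - i"
        have \<alpha>: "\<alpha> \<in> {1..p}" "b - \<alpha> = i" using i I(1) by (auto simp: \<alpha>_def b_def)
        define \<mu> where "\<mu> = W y (- int \<alpha>)"
        \<comment> \<open>With \<mu> frozen at the pole of index \<alpha>, the derivative of
          \<open>D(\<mu>)\<close> is computed twice: through the coefficients, where it vanishes
          since \<open>F v = 0\<close>, and through the product, where only the variation of that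
          pole survives.\<close>
        have "poly (den (\<Theta> y')) \<mu> = (\<Sum>i'\<in>I - {b}. (-1) ^ i' * \<mu> ^ i' * \<Theta> y' $ \<iota> (- int i')) + ?\<epsilon> * \<mu> ^ b" for y'
        proof -
          have "b \<in> I" using I(1) by (simp add: b_def)
          then show ?thesis
            unfolding den_def shift_den_def poly_sum poly_monom
            by (subst sum.remove[OF finI(1)]) (auto simp: generic_f_def MaxI mult_ac intro!: sum.cong)
        qed
        moreover have "((\<lambda>y'. (\<Sum>i'\<in>I - {b}. (-1) ^ i' * \<mu> ^ i' * \<Theta> y' $ \<iota> (- int i')) + ?\<epsilon> * \<mu> ^ b)
            has_derivative (\<lambda>v. (\<Sum>i'\<in>I - {b}. (-1) ^ i' * \<mu> ^ i' * D (\<iota> (- int i')) v) + 0)) (at y)"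
          by (intro has_derivative_add has_derivative_sum has_derivative_mult_right D(1) has_derivative_const)
        ultimately have d1: "((\<lambda>y'. poly (den (\<Theta> y')) \<mu>) has_derivative
            (\<lambda>v. (\<Sum>i'\<in>I - {b}. (-1) ^ i' * \<mu> ^ i' * D (\<iota> (- int i')) v) + 0)) (at y)" by simp
        have d2: "((\<lambda>y'. poly (den (\<Theta> y')) \<mu>) has_derivative
            (\<lambda>v. ?\<epsilon> * (\<mu> ^ k * (\<Sum>\<beta> = 1..p. (0 - v $ \<iota>' (- int \<beta>)) * (\<Prod>\<gamma>\<in>{1..p} - {\<beta>}. \<mu> - W y (- int \<gamma>)))))) (at y)"
          unfolding poly_den_\<Theta> W_def
          by (intro has_derivative_mult_right has_derivative_prod has_derivative_diff has_derivative_const nth)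
        have "?\<epsilon> * (\<mu> ^ k * (\<Sum>\<beta> = 1..p. (0 - v $ \<iota>' (- int \<beta>)) * (\<Prod>\<gamma>\<in>{1..p} - {\<beta>}. \<mu> - W y (- int \<gamma>)))) = 0"
          using fun_cong[OF has_derivative_unique[OF d1 d2], of v] Dv by simp
        moreover have "(\<Sum>\<beta> = 1..p. (0 - v $ \<iota>' (- int \<beta>)) * (\<Prod>\<gamma>\<in>{1..p} - {\<beta>}. \<mu> - W y (- int \<gamma>)))
          = (\<Sum>\<beta> = 1..p. if \<beta> = \<alpha> then - v $ \<iota>' (- int \<alpha>) * (\<Prod>\<gamma>\<in>{1..p} - {\<alpha>}. \<mu> - W y (- int \<gamma>)) else 0)"
        proof (intro sum.cong refl)
          fix \<beta> assume "\<beta> \<in> {1..p}"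
          have "(\<Prod>\<gamma>\<in>{1..p} - {\<beta>}. \<mu> - W y (- int \<gamma>)) = 0" if "\<beta> \<noteq> \<alpha>"
            using that \<alpha>(1) by (intro prod_zero) (auto simp: \<mu>_def)
          then show "(0 - v $ \<iota>' (- int \<beta>)) * (\<Prod>\<gamma>\<in>{1..p} - {\<beta>}. \<mu> - W y (- int \<gamma>)) =
            (if \<beta> = \<alpha> then - v $ \<iota>' (- int \<alpha>) * (\<Prod>\<gamma>\<in>{1..p} - {\<alpha>}. \<mu> - W y (- int \<gamma>)) else 0)" by auto
        qed
        ultimately have "\<mu> ^ k * (v $ \<iota>' (- int \<alpha>) * (\<Prod>\<gamma>\<in>{1..p} - {\<alpha>}. \<mu> - W y (- int \<gamma>))) = 0"
          using \<alpha>(1) by simp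
        moreover have "\<mu> \<noteq> 0" using B_nz[OF y \<alpha>(1)] by (simp add: \<mu>_def)
        moreover have "(\<Prod>\<gamma>\<in>{1..p} - {\<alpha>}. \<mu> - W y (- int \<gamma>)) \<noteq> 0"
          using B_sep[OF y y \<alpha>(1)] by (auto simp: \<mu>_def)
        ultimately have "v $ \<iota>' (- int \<alpha>) = 0" by simp
        then show "v $ \<iota> (- int i) = 0" using \<iota>'_neg[OF \<alpha>(1)] \<alpha>(2) by simp
      qed
      then show ?thesis by (simp add: vec_eq_iff)
    qed
    then show ?thesis using F D(2) by (intro exI[of _ F]) (simp add: F_def vec_eq_iff)
  qed
  let ?\<psi> = "inv_into B \<Theta>" and ?V = "\<Theta> ` B \<inter> U"
  have inverse: "open (\<Theta> ` B)" "holo_on (\<Theta> ` B) (\<lambda>x. ?\<psi> x $ i)" for i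
    using holomorphic_local_inverse[OF openB injB] der by blast+
  have \<Theta>\<psi>: "\<Theta> (?\<psi> y) = y" if "y \<in> \<Theta> ` B" for y using that by (rule f_inv_into_f)
  have \<psi>\<Theta>: "?\<psi> (\<Theta> y) = y" if "y \<in> B" for y using injB that by (rule inv_into_f_f)
  have "x \<in> ?V" using y0B \<Theta>_y0 x by force
  moreover have "local_chart ?V ?\<psi>"
    unfolding local_chart_def
  proof (intro conjI allI exI[of _ \<Theta>] ballI)
    show "open ?V" using inverse(1) U(1) by (rule open_Int)
    show "holo_on ?V (\<lambda>x. ?\<psi> x $ i)" for i using inverse(2) by (rule holo_on_subset) (rule Int_lower1)
    have "?\<psi> ` ?V = \<Theta> -` U \<inter> B"
    proof (intro equalityI subsetI)
      fix y assume "y \<in> \<Theta> -` U \<inter> B"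
      then have "\<Theta> y \<in> ?V" "y = ?\<psi> (\<Theta> y)" using \<psi>\<Theta>[of y] by auto
      then show "y \<in> ?\<psi> ` ?V" by (rule rev_image_eqI)
    next
      fix y assume "y \<in> ?\<psi> ` ?V"
      then show "y \<in> \<Theta> -` U \<inter> B" using \<psi>\<Theta> by auto
    qed
    moreover have "continuous_on B \<Theta>"
      using der by (intro continuous_at_imp_continuous_on ballI) (meson has_derivative_continuous)
    ultimately show "open (?\<psi> ` ?V)" using U(1) openB by (simp add: continuous_on_open_vimage)
    show "holo_on (?\<psi> ` ?V) (\<lambda>y. \<Theta> y $ i)" for i by (rule holo_\<Theta>)
    show "\<Theta> (?\<psi> y) = y" if "y \<in> ?V" for y using that \<Theta>\<psi> by simp
  qed
  moreover have "?\<psi> y $ \<iota>' 0 * Q l (\<lambda>j. ?\<psi> y $ \<iota>' j) \<mu> /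
        (\<mu> ^ k * (\<Prod>\<alpha> = 1..length m. (\<mu> - ?\<psi> y $ \<iota>' (- int \<alpha>)) ^ (m ! (\<alpha> - 1)))) = generic_lambda l I \<iota> y \<mu>"
    if y: "y \<in> ?V" for y \<mu>
  proof -
    define u where "u = ?\<psi> y"
    have yu: "y = \<Theta> u" using \<Theta>\<psi>[of y] y by (simp add: u_def)
    have "Q l (\<lambda>j. u $ \<iota>' j) \<mu> = Q l (\<lambda>j. y $ \<iota> j) \<mu>"
      by (rule Q_cong) (simp add: yu \<Theta>_pos \<iota>'_pos)
    moreover have "poly (den y) \<mu> = ?\<epsilon> * (\<mu> ^ k * (\<Prod>\<alpha> = 1..p. \<mu> - u $ \<iota>' (- int \<alpha>)))"
      unfolding yu poly_den_\<Theta> W_def ..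
    moreover have "y $ \<iota> 0 = - ?\<epsilon> * u $ \<iota>' 0" by (simp add: yu \<Theta>_0 \<iota>'_pos)
    moreover have "?\<epsilon> * c / (?\<epsilon> * a) = c / a" for a c :: complex by simp
    moreover have "shift_den I (generic_f I (\<lambda>j. y $ \<iota> j)) = den y" by (simp add: den_def)
    ultimately show ?thesis
      unfolding prod_m generic_lambda_def shift_lambda_def u_def[symmetric]
      by (simp add: mult.assoc)
  qed
  ultimately show ?thesis by (intro exI[of _ ?V] exI[of _ ?\<psi>]) auto
qed

theorem theorem1p1:
  fixes l p :: nat and I :: "nat set"
    and U :: "(complex ^ 'n) set"
    and g :: "complex ^ 'n \<Rightarrow> complex ^ 'n ^ 'n"
    and C :: "complex ^ 'n \<Rightarrow> 'n \<Rightarrow> 'n \<Rightarrow> 'n \<Rightarrow> complex"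
    and e E :: "complex ^ 'n \<Rightarrow> complex ^ 'n"
    and d :: complex
  assumes "1 \<le> l"
    and "I \<subseteq> {1..l}"
    and "card I = p + 1"
    and "shift_frobenius_manifold l I U g C e E d"
  shows "\<exists>k m. k \<in> {1..l - p} \<and> I = {k..k + p} \<and> is_partition m p \<and>
           semisimple U C \<and> CARD('n) = l + 1 + length m \<and> d = 1 \<and>
           (\<exists>\<iota>. bij_betw \<iota> {- int (length m)..int l} (UNIV :: 'n set) \<and>
              (\<forall>x\<in>U. \<exists>V w. x \<in> V \<and> V \<subseteq> U \<and> local_chart V w \<and>
                 landau_ginzburg V
                   (\<lambda>y \<mu>. w y $ \<iota> 0 * Q l (\<lambda>j. w y $ \<iota> j) \<mu> /
                      (\<mu> ^ k * (\<Prod>\<alpha> = 1..length m. (\<mu> - w y $ \<iota> (- int \<alpha>)) ^ (m ! (\<alpha> - 1)))))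
                   g C e E))"
proof -
  obtain P lam where fam: "shift_family l I P lam" and U: "U \<subseteq> P" "P \<subseteq> closure U"
    and frob: "frobenius_manifold U g C e E d" and lg: "landau_ginzburg U lam g C e E"
    using assms(4) unfolding shift_frobenius_manifold_def by blast
  from fam consider
    (generic) \<iota> where "bij_betw \<iota> (generic_labels l I) (UNIV :: 'n set)" "P = generic_space I \<iota>" "lam = generic_lambda l I \<iota>"
    | (pole) k p' m \<iota> where "I = {k..k + p'}" "is_partition m p'" "bij_betw \<iota> (pole_labels l m) (UNIV :: 'n set)"
        "P = pole_space m \<iota>" "lam = pole_lambda l k m \<iota>"
    unfolding shift_family_def by blast
  then show ?thesis
  proof cases
    case generic
    obtain k where k: "k \<in> {1..l - p}" "I = {k..k + p}" "semisimple U C" "CARD('n) = l + 1 + p" "d = 1"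
      by (rule generic_case_algebra[OF assms(2,3) generic(1) U[unfolded generic(2)] frob lg[unfolded generic(3)]])
    have "k \<in> I" "k + p \<in> I" using k(2) by auto
    then have kl: "1 \<le> k" "k + p \<le> l" using assms(2) by auto
    have openU: "open U" using frob by (rule frobenius_manifold.open_U)
    define m :: "nat list" where "m = replicate p 1"
    define \<iota>' where "\<iota>' = (\<lambda>j. if j \<ge> 0 then \<iota> j else \<iota> (- int (k + p) - j))"
    note chart = generic_chart[OF k(2) kl generic(1) m_def \<iota>'_def openU U(1)[unfolded generic(2)]]
    have "\<exists>V w. x \<in> V \<and> V \<subseteq> U \<and> local_chart V w \<and>
                 landau_ginzburg V
                   (\<lambda>y \<mu>. w y $ \<iota>' 0 * Q l (\<lambda>j. w y $ \<iota>' j) \<mu> /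
                      (\<mu> ^ k * (\<Prod>\<alpha> = 1..length m. (\<mu> - w y $ \<iota>' (- int \<alpha>)) ^ (m ! (\<alpha> - 1)))))
                   g C e E" if x: "x \<in> U" for x
    proof -
      from chart[OF x] obtain V w where V: "x \<in> V" "V \<subseteq> U" "local_chart V w"
        and eq: "\<forall>y\<in>V. \<forall>\<mu>. w y $ \<iota>' 0 * Q l (\<lambda>j. w y $ \<iota>' j) \<mu> /
          (\<mu> ^ k * (\<Prod>\<alpha> = 1..length m. (\<mu> - w y $ \<iota>' (- int \<alpha>)) ^ (m ! (\<alpha> - 1)))) = generic_lambda l I \<iota> y \<mu>"
        by (elim exE conjE) (rule that)
      have openV: "open V" using V(3) by (simp add: local_chart_def)
      have "landau_ginzburg V
        (\<lambda>y \<mu>. w y $ \<iota>' 0 * Q l (\<lambda>j. w y $ \<iota>' j) \<mu> /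
          (\<mu> ^ k * (\<Prod>\<alpha> = 1..length m. (\<mu> - w y $ \<iota>' (- int \<alpha>)) ^ (m ! (\<alpha> - 1)))))
        g C e E"
        by (rule landau_ginzburg_cong[OF lg openV V(2)], rule ext) (simp only: generic(3) eq[rule_format])
      then show ?thesis by (intro exI conjI) (rule V | assumption)+
    qed
    moreover have "is_partition m p" by (simp add: is_partition_def m_def sum_list_replicate sorted_wrt_iff_nth_less)
    moreover have "length m = p" by (simp add: m_def)
    moreover have "bij_betw \<iota>' {- int p..int l} (UNIV :: 'n set)"
      unfolding \<iota>'_def by (rule generic_labels_reindex[OF k(2) kl(1) generic(1)])
    ultimately show ?thesis using k by (intro exI[of _ k] exI[of _ m]) auto
  next
    case pole
    have "p' = p" using pole(1) assms(3) by simp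
    then show ?thesis
      using pole_case[OF assms(2) pole(1-3) U[unfolded pole(4)] frob lg[unfolded pole(5)]] pole(1,2)
      by (intro exI[of _ k] exI[of _ m]) auto
  qed
qed

end
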